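(* $\Omega^1(\mathbb{C}_q[S^2])=\Omega^{0,1}\oplus\Omega^{1,0}$, where $\Omega^{1,0}$ and $\Omega^{0,1}$ are each first order left-covariant (under the coaction of $\mathbb{C}_q[SL_2]$) differential calculi over $\mathbb{C}_q[S^2]$, with differentials $\partial$ and $\bar\partial$ respectively obeying $\mathrm{d}=\partial+\bar\partial$ and the bimodule relations $$\partial b_-\,b_+=q^{-2}b_+\partial b_-,\quad \partial b_-\,b_-=q^2b_-\partial b_-,\quad \partial b_-\,b_0=b_0\,\partial b_-,$$ $$\partial b_+\,b_+=q^2b_+\partial b_+,\quad \partial b_+\,b_-=q^2b_-\partial b_++(q^2-q^{-2})b_+\partial b_-,\quad \partial b_+\,b_0=q^4b_0\,\partial b_+,$$ $$\bar\partial b_-\,b_+=q^{-2}b_+\bar\partial b_-+(q^{-2}-q^2)b_-\bar\partial b_+,\quad \bar\partial b_-\,b_-=q^{-2}b_-\bar\partial b_-,\quad \bar\partial b_-\,b_0=q^{-4}b_0\,\bar\partial b_-,$$ $$\bar\partial b_+\,b_+=q^{-2}b_+\bar\partial b_+,\quad \bar\partial b_+\,b_-=q^2b_-\bar\partial b_+,\quad \bar\partial b_+\,b_0=b_0\,\bar\partial b_+.$$ Moreover one has the relations $$\partial b_0=q^2b_-\partial b_+-q^{-2}b_+\partial b_-,\qquad \bar\partial b_0=b_+\bar\partial b_--q^4b_-\bar\partial b_+,$$ $$b_0b_-\partial b_+=q^{-3}(1+q^{-1}b_0)b_+\partial b_-,\qquad b_0b_+\bar\partial b_-=q^3(1+qb_0)b_-\bar\partial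 b_+.$$
   Context: $q\in\mathbb{C}$ is invertible. $\mathbb{C}_q[SL_2]$ is the Hopf algebra generated by $a,b,c,d$ with $ba=qab$, $ca=qac$, $db=qbd$, $dc=qcd$, $bc=cb$, $ad=1+q^{-1}bc$, $da=1+qbc$ and matrix coproduct. It is $\mathbb{Z}$-graded by $\deg a=\deg c=1$, $\deg b=\deg d=-1$; $\mathbb{C}_q[SL_2]_n$ is the degree $n$ component. $\mathbb{C}_q[S^2]=\mathbb{C}_q[SL_2]_0$ is generated by $b_0=bc$, $b_+=cd$, $b_-=ab$; the coproduct restricts to a left coaction $\Delta_L$ of $\mathbb{C}_q[SL_2]$ on $\mathbb{C}_q[S^2]$. $\Omega^1(\mathbb{C}_q[SL_2])$ is the left-covariant bimodule calculus that is free as a left module on left-invariant forms $e^+,e^-,e^0$, with $e^\pm x=q^{\deg x}x\,e^\pm$ and $e^0x=q^{2\deg x}x\,e^0$ for homogeneous $x$, and $$\mathrm{d}a=ae^0+qbe^+,\quad \mathrm{d}b=ae^--q^{-2}be^0,\quad \mathrm{d}c=ce^0+qde^+,\quad \mathrm{d}d=ce^--q^{-2}de^0.$$ $\Omega^1(\mathbb{C}_q[S^2])=\mathrm{span}\{m\,\mathrm{d}n: m,n\in\mathbb{C}_q[S^2]\}\subset\Omega^1(\mathbb{C}_q[SL_2])$. Here $\Omega^{1,0}=\mathbb{C}_q[SL_2]_{-2}\,e^+$ and $\Omega^{0,1}=\mathbb{C}_q[SL_2]_{2}\,e^-$, and $\partial f,\bar\partial f$ are the components of $\mathrm{d}f$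 in $\Omega^{1,0},\Omega^{0,1}$; explicitly $\partial b_-=b^2e^+$, $\partial b_0=db\,e^+$, $\partial b_+=d^2e^+$, $\bar\partial b_-=a^2e^-$, $\bar\partial b_0=ca\,e^-$, $\bar\partial b_+=c^2e^-$. A first order differential calculus over an algebra $B$ is a $B$-bimodule $\Omega$ with a linear map $\delta:B\to\Omega$ obeying the Leibniz rule and such that $\Omega=\mathrm{span}\{x\,\delta y\}$; it is left-covariant if the coaction $\Delta_L$ on $B$ extends to a coaction on $\Omega$ that is compatible with the bimodule structure and intertwined by $\delta$. *)

theory Defs
  imports
    Complex_Main
    "HOL-Algebra.Module"
    "HOL-Algebra.QuotRing"
    "HOL-Algebra.Algebraic_Closure_Type"
    "HOL-Library.Poly_Mapping"
begin

section \<open>Complex vector spaces and algebras with explicit carriers\<close>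

text \<open>
  Complex vector spaces and algebras are records of type \<open>(complex, 'a) module\<close>: the operations
  of a ring together with a scalar multiplication. For a mere vector space the two ring fields
  \<open>mult\<close> and \<open>one\<close> carry no meaning.
\<close>

abbreviation complex_ring :: "complex ring"
  where "complex_ring \<equiv> ring_of_type_algebra"

definition complex_line :: "(complex, complex) module"
  where "complex_line = ring.extend complex_ring (module.fields (*))"

locale complex_algebra = module complex_ring A + ring A for A (structure) +
  assumes smult_mult_left:
      "\<lbrakk>x \<in> carrier A; y \<in> carrier A\<rbrakk> \<Longrightarrow> (z \<odot>\<^bsub>A\<^esub> x) \<otimes>\<^bsub>A\<^esub> y = z \<odot>\<^bsub>A\<^esub> (x \<otimes>\<^bsub>A\<^esub> y)"
    and smult_mult_right:
      "\<lbrakk>x \<in> carrier A; y \<in> carrier A\<rbrakk> \<Longrightarrow> x \<otimes>\<^bsub>A\<^esub> (z \<odot>\<^bsub>A\<^esub> y) = z \<odot>\<^bsub>A\<^esub> (x \<otimes>\<^bsub>A\<^esub> y)"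

definition linear_map ::
    "(complex, 'v, 'm) module_scheme \<Rightarrow> (complex, 'w, 'n) module_scheme \<Rightarrow> ('v \<Rightarrow> 'w) \<Rightarrow> bool"
  where "linear_map V W f \<longleftrightarrow>
    f \<in> carrier V \<rightarrow> carrier W \<and>
    (\<forall>x\<in>carrier V. \<forall>y\<in>carrier V. f (x \<oplus>\<^bsub>V\<^esub> y) = f x \<oplus>\<^bsub>W\<^esub> f y) \<and>
    (\<forall>z. \<forall>x\<in>carrier V. f (z \<odot>\<^bsub>V\<^esub> x) = z \<odot>\<^bsub>W\<^esub> f x)"

definition cspan :: "(complex, 'v, 'm) module_scheme \<Rightarrow> 'v set \<Rightarrow> 'v set"
  where "cspan V S = \<Inter>{N. submodule N complex_ring V \<and> S \<subseteq> N}"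

text \<open>
  The vector space with basis \<open>S\<close>, with the product that extends the binary operation \<open>f\<close> on \<open>S\<close>
  bilinearly.
\<close>

definition monoid_algebra ::
    "'x set \<Rightarrow> ('x \<Rightarrow> 'x \<Rightarrow> 'x) \<Rightarrow> 'x \<Rightarrow> (complex, 'x \<Rightarrow>\<^sub>0 complex) module"
  where "monoid_algebra S f e =
    \<lparr>carrier = {u. Poly_Mapping.keys u \<subseteq> S},
     monoid.mult = (\<lambda>u v. \<Sum>x\<in>Poly_Mapping.keys u. \<Sum>y\<in>Poly_Mapping.keys v.
       Poly_Mapping.single (f x y) (Poly_Mapping.lookup u x * Poly_Mapping.lookup v y)),
     one = Poly_Mapping.single e 1,
     zero = 0,
     add = (+),
     module.smult = (\<lambda>z. Poly_Mapping.map ((*) z))\<rparr>"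

text \<open>The quotient of \<open>V\<close> by \<open>N\<close>, whose elements are the cosets of \<open>N\<close>. If \<open>V\<close> is only a vector
  space and \<open>N\<close> a subspace, then \<open>mult\<close> and \<open>one\<close> are meaningless.\<close>

definition quotient_module ::
    "(complex, 'v, 'm) module_scheme \<Rightarrow> 'v set \<Rightarrow> (complex, 'v set) module"
  where "quotient_module V N =
    ring.extend (V Quot N) (module.fields (\<lambda>z C. \<Union>x\<in>C. N +>\<^bsub>V\<^esub> (z \<odot>\<^bsub>V\<^esub> x)))"

text \<open>
  The linear map given by \<open>g\<close> on a basis \<open>'x\<close>, and the map it induces on cosets in a quotient of
  the free vector space. The latter is used only where the linear extension is constant on cosets.
\<close>

definition linear_extension ::
    "(complex, 'w, 'n) module_scheme \<Rightarrow> ('x \<Rightarrow> 'w) \<Rightarrow> ('x \<Rightarrow>\<^sub>0 complex) \<Rightarrow> 'w"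
  where "linear_extension W g u =
    (\<Oplus>\<^bsub>W\<^esub>x\<in>Poly_Mapping.keys u. Poly_Mapping.lookup u x \<odot>\<^bsub>W\<^esub> g x)"

definition induced_map ::
    "(complex, 'w, 'n) module_scheme \<Rightarrow> ('x \<Rightarrow> 'w) \<Rightarrow> ('x \<Rightarrow>\<^sub>0 complex) set \<Rightarrow> 'w"
  where "induced_map W g C = the_elem (linear_extension W g ` C)"


section \<open>Tensor products over the complex numbers\<close>

definition bilinear_relators ::
    "(complex, 'v, 'm) module_scheme \<Rightarrow> (complex, 'w, 'n) module_scheme
      \<Rightarrow> ('v \<times> 'w \<Rightarrow>\<^sub>0 complex) set"
  where "bilinear_relators V W =
    {Poly_Mapping.single (x \<oplus>\<^bsub>V\<^esub> x', y) 1 - Poly_Mapping.single (x, y) 1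
        - Poly_Mapping.single (x', y) 1 | x x' y.
      x \<in> carrier V \<and> x' \<in> carrier V \<and> y \<in> carrier W} \<union>
    {Poly_Mapping.single (x, y \<oplus>\<^bsub>W\<^esub> y') 1 - Poly_Mapping.single (x, y) 1
        - Poly_Mapping.single (x, y') 1 | x y y'.
      x \<in> carrier V \<and> y \<in> carrier W \<and> y' \<in> carrier W} \<union>
    {Poly_Mapping.single (z \<odot>\<^bsub>V\<^esub> x, y) 1 - Poly_Mapping.single (x, y) z | z x y.
      x \<in> carrier V \<and> y \<in> carrier W} \<union>
    {Poly_Mapping.single (x, z \<odot>\<^bsub>W\<^esub> y) 1 - Poly_Mapping.single (x, y) z | z x y.
      x \<in> carrier V \<and> y \<in> carrier W}"

definition free_pairs ::
    "(complex, 'v, 'm) module_scheme \<Rightarrow> (complex, 'w, 'n) module_scheme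
      \<Rightarrow> (complex, 'v \<times> 'w \<Rightarrow>\<^sub>0 complex) module"
  where "free_pairs V W =
    monoid_algebra (carrier V \<times> carrier W)
      (\<lambda>(x, y) (x', y'). (x \<otimes>\<^bsub>V\<^esub> x', y \<otimes>\<^bsub>W\<^esub> y')) (\<one>\<^bsub>V\<^esub>, \<one>\<^bsub>W\<^esub>)"

definition tensor_null ::
    "(complex, 'v, 'm) module_scheme \<Rightarrow> (complex, 'w, 'n) module_scheme
      \<Rightarrow> ('v \<times> 'w \<Rightarrow>\<^sub>0 complex) set"
  where "tensor_null V W = cspan (free_pairs V W) (bilinear_relators V W)"

text \<open>For algebras \<open>V\<close>, \<open>W\<close> this is the tensor product algebra.\<close>

definition tensor ::
    "(complex, 'v, 'm) module_scheme \<Rightarrow> (complex, 'w, 'n) module_scheme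
      \<Rightarrow> (complex, ('v \<times> 'w \<Rightarrow>\<^sub>0 complex) set) module"
  where "tensor V W = quotient_module (free_pairs V W) (tensor_null V W)"

definition pure_tensor ::
    "(complex, 'v, 'm) module_scheme \<Rightarrow> (complex, 'w, 'n) module_scheme
      \<Rightarrow> 'v \<Rightarrow> 'w \<Rightarrow> ('v \<times> 'w \<Rightarrow>\<^sub>0 complex) set"
  where "pure_tensor V W x y =
    tensor_null V W +>\<^bsub>free_pairs V W\<^esub> Poly_Mapping.single (x, y) 1"

text \<open>In \<open>tensor_map\<close> and \<open>tensor_map2\<close> the records \<open>V\<close>, \<open>W\<close> are those of the target space.\<close>

definition tensor_map ::
    "(complex, 'v, 'm) module_scheme \<Rightarrow> (complex, 'w, 'n) module_scheme
      \<Rightarrow> ('x \<Rightarrow> 'v) \<Rightarrow> ('y \<Rightarrow> 'w)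
      \<Rightarrow> ('x \<times> 'y \<Rightarrow>\<^sub>0 complex) set \<Rightarrow> ('v \<times> 'w \<Rightarrow>\<^sub>0 complex) set"
  where "tensor_map V W f g =
    induced_map (tensor V W) (\<lambda>(x, y). pure_tensor V W (f x) (g y))"

text \<open>The bilinear map taking \<open>(x \<otimes> y, x' \<otimes> y')\<close> to \<open>f x x' \<otimes> g y y'\<close>.\<close>

definition tensor_map2 ::
    "(complex, 'v, 'm) module_scheme \<Rightarrow> (complex, 'w, 'n) module_scheme
      \<Rightarrow> ('x1 \<Rightarrow> 'x2 \<Rightarrow> 'v) \<Rightarrow> ('y1 \<Rightarrow> 'y2 \<Rightarrow> 'w)
      \<Rightarrow> ('x1 \<times> 'y1 \<Rightarrow>\<^sub>0 complex) set \<Rightarrow> ('x2 \<times> 'y2 \<Rightarrow>\<^sub>0 complex) set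
      \<Rightarrow> ('v \<times> 'w \<Rightarrow>\<^sub>0 complex) set"
  where "tensor_map2 V W f g S T =
    induced_map (tensor V W)
      (\<lambda>(x, y). induced_map (tensor V W) (\<lambda>(x', y'). pure_tensor V W (f x x') (g y y')) T) S"

text \<open>The canonical map from \<open>(U \<otimes> V) \<otimes> W\<close> to \<open>U \<otimes> (V \<otimes> W)\<close>.\<close>

definition tensor_assoc ::
    "(complex, 'u, 'k) module_scheme \<Rightarrow> (complex, 'v, 'm) module_scheme
      \<Rightarrow> (complex, 'w, 'n) module_scheme
      \<Rightarrow> (('u \<times> 'v \<Rightarrow>\<^sub>0 complex) set \<times> 'w \<Rightarrow>\<^sub>0 complex) set
      \<Rightarrow> ('u \<times> ('v \<times> 'w \<Rightarrow>\<^sub>0 complex) set \<Rightarrow>\<^sub>0 complex) set"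
  where "tensor_assoc U V W =
    induced_map (tensor U (tensor V W))
      (\<lambda>(t, z). induced_map (tensor U (tensor V W))
        (\<lambda>(x, y). pure_tensor U (tensor V W) x (pure_tensor V W y z)) t)"


section \<open>First order differential calculi and left covariance\<close>

record ('r, 'b, 'w) bimodule = "('r, 'w) module" +
  lact :: "'b \<Rightarrow> 'w \<Rightarrow> 'w"  (infixr \<open>\<triangleright>\<index>\<close> 72)
  ract :: "'w \<Rightarrow> 'b \<Rightarrow> 'w"  (infixl \<open>\<triangleleft>\<index>\<close> 72)

locale algebra_bimodule = B: complex_algebra B + \<Omega>: module complex_ring \<Omega>
  for B :: "(complex, 'b, 'm) module_scheme" (structure)
    and \<Omega> :: "(complex, 'b, 'w, 'n) bimodule_scheme" +
  assumes lact_linear: "x \<in> carrier B \<Longrightarrow> linear_map \<Omega> \<Omega> (\<lambda>w. x \<triangleright>\<^bsub>\<Omega>\<^esub> w)"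
    and lact_linear_left: "w \<in> carrier \<Omega> \<Longrightarrow> linear_map B \<Omega> (\<lambda>x. x \<triangleright>\<^bsub>\<Omega>\<^esub> w)"
    and ract_linear: "x \<in> carrier B \<Longrightarrow> linear_map \<Omega> \<Omega> (\<lambda>w. w \<triangleleft>\<^bsub>\<Omega>\<^esub> x)"
    and ract_linear_right: "w \<in> carrier \<Omega> \<Longrightarrow> linear_map B \<Omega> (\<lambda>x. w \<triangleleft>\<^bsub>\<Omega>\<^esub> x)"
    and lact_one: "w \<in> carrier \<Omega> \<Longrightarrow> \<one>\<^bsub>B\<^esub> \<triangleright>\<^bsub>\<Omega>\<^esub> w = w"
    and ract_one: "w \<in> carrier \<Omega> \<Longrightarrow> w \<triangleleft>\<^bsub>\<Omega>\<^esub> \<one>\<^bsub>B\<^esub> = w"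
    and lact_mult: "\<lbrakk>x \<in> carrier B; y \<in> carrier B; w \<in> carrier \<Omega>\<rbrakk>
      \<Longrightarrow> (x \<otimes>\<^bsub>B\<^esub> y) \<triangleright>\<^bsub>\<Omega>\<^esub> w = x \<triangleright>\<^bsub>\<Omega>\<^esub> (y \<triangleright>\<^bsub>\<Omega>\<^esub> w)"
    and ract_mult: "\<lbrakk>x \<in> carrier B; y \<in> carrier B; w \<in> carrier \<Omega>\<rbrakk>
      \<Longrightarrow> w \<triangleleft>\<^bsub>\<Omega>\<^esub> (x \<otimes>\<^bsub>B\<^esub> y) = (w \<triangleleft>\<^bsub>\<Omega>\<^esub> x) \<triangleleft>\<^bsub>\<Omega>\<^esub> y"
    and lact_ract: "\<lbrakk>x \<in> carrier B; y \<in> carrier B; w \<in> carrier \<Omega>\<rbrakk>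
      \<Longrightarrow> (x \<triangleright>\<^bsub>\<Omega>\<^esub> w) \<triangleleft>\<^bsub>\<Omega>\<^esub> y = x \<triangleright>\<^bsub>\<Omega>\<^esub> (w \<triangleleft>\<^bsub>\<Omega>\<^esub> y)"

locale first_order_calculus = algebra_bimodule B \<Omega>
  for B :: "(complex, 'b, 'm) module_scheme" (structure)
    and \<Omega> :: "(complex, 'b, 'w, 'n) bimodule_scheme"
    and \<delta> :: "'b \<Rightarrow> 'w" +
  assumes differential_linear: "linear_map B \<Omega> \<delta>"
    and leibniz: "\<lbrakk>x \<in> carrier B; y \<in> carrier B\<rbrakk>
      \<Longrightarrow> \<delta> (x \<otimes>\<^bsub>B\<^esub> y) = \<delta> x \<triangleleft>\<^bsub>\<Omega>\<^esub> y \<oplus>\<^bsub>\<Omega>\<^esub> x \<triangleright>\<^bsub>\<Omega>\<^esub> \<delta> y"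
    and spanned: "carrier \<Omega> = cspan \<Omega> {x \<triangleright>\<^bsub>\<Omega>\<^esub> \<delta> y | x y. x \<in> carrier B \<and> y \<in> carrier B}"

text \<open>\<open>D\<close> and \<open>\<epsilon>\<close> are the coproduct and the counit of \<open>H\<close>.\<close>

definition left_coaction ::
    "(complex, 'h, 'k) module_scheme \<Rightarrow> ('h \<Rightarrow> ('h \<times> 'h \<Rightarrow>\<^sub>0 complex) set) \<Rightarrow> ('h \<Rightarrow> complex)
      \<Rightarrow> (complex, 'v, 'm) module_scheme \<Rightarrow> ('v \<Rightarrow> ('h \<times> 'v \<Rightarrow>\<^sub>0 complex) set) \<Rightarrow> bool"
  where "left_coaction H D \<epsilon> V \<rho> \<longleftrightarrow>
    linear_map V (tensor H V) \<rho> \<and>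
    (\<forall>v\<in>carrier V.
      tensor_assoc H H V (tensor_map (tensor H H) V D id (\<rho> v))
        = tensor_map H (tensor H V) id \<rho> (\<rho> v)) \<and>
    (\<forall>v\<in>carrier V. induced_map V (\<lambda>(h, w). \<epsilon> h \<odot>\<^bsub>V\<^esub> w) (\<rho> v) = v)"

text \<open>
  \<open>DL\<close> is the left coaction of \<open>H\<close> on \<open>B\<close>; \<open>H \<otimes> \<Omega>\<close> is a bimodule over \<open>H \<otimes> B\<close> factor by factor.
\<close>

definition left_covariant ::
    "(complex, 'h, 'k) module_scheme \<Rightarrow> ('h \<Rightarrow> ('h \<times> 'h \<Rightarrow>\<^sub>0 complex) set) \<Rightarrow> ('h \<Rightarrow> complex)
      \<Rightarrow> (complex, 'b, 'm) module_scheme \<Rightarrow> ('b \<Rightarrow> ('h \<times> 'b \<Rightarrow>\<^sub>0 complex) set)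
      \<Rightarrow> (complex, 'b, 'w, 'n) bimodule_scheme \<Rightarrow> ('b \<Rightarrow> 'w) \<Rightarrow> bool"
  where "left_covariant H D \<epsilon> B DL \<Omega> \<delta> \<longleftrightarrow>
    (\<exists>\<rho>. left_coaction H D \<epsilon> \<Omega> \<rho> \<and>
      (\<forall>x\<in>carrier B. \<forall>w\<in>carrier \<Omega>.
        \<rho> (x \<triangleright>\<^bsub>\<Omega>\<^esub> w) = tensor_map2 H \<Omega> (monoid.mult H) (lact \<Omega>) (DL x) (\<rho> w) \<and>
        \<rho> (w \<triangleleft>\<^bsub>\<Omega>\<^esub> x) = tensor_map2 H \<Omega> (monoid.mult H) (ract \<Omega>) (\<rho> w) (DL x)) \<and>
      (\<forall>x\<in>carrier B. \<rho> (\<delta> x) = tensor_map H \<Omega> id \<delta> (DL x)))"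


section \<open>The quantum group\<close>

datatype gen = ga | gb | gc | gd

definition free_algebra :: "(complex, gen list \<Rightarrow>\<^sub>0 complex) module"
  where "free_algebra = monoid_algebra UNIV (@) []"

definition SL2_relations :: "complex \<Rightarrow> (gen list \<Rightarrow>\<^sub>0 complex) set"
  where "SL2_relations q =
    {Poly_Mapping.single [gb, ga] 1 - Poly_Mapping.single [ga, gb] q,
     Poly_Mapping.single [gc, ga] 1 - Poly_Mapping.single [ga, gc] q,
     Poly_Mapping.single [gd, gb] 1 - Poly_Mapping.single [gb, gd] q,
     Poly_Mapping.single [gd, gc] 1 - Poly_Mapping.single [gc, gd] q,
     Poly_Mapping.single [gb, gc] 1 - Poly_Mapping.single [gc, gb] 1,
     Poly_Mapping.single [ga, gd] 1 - Poly_Mapping.single [] 1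
       - Poly_Mapping.single [gb, gc] (inverse q),
     Poly_Mapping.single [gd, ga] 1 - Poly_Mapping.single [] 1
       - Poly_Mapping.single [gb, gc] q}"

definition SL2_ideal :: "complex \<Rightarrow> (gen list \<Rightarrow>\<^sub>0 complex) set"
  where "SL2_ideal q = genideal free_algebra (SL2_relations q)"

definition SL2 :: "complex \<Rightarrow> (complex, (gen list \<Rightarrow>\<^sub>0 complex) set) module"
  where "SL2 q = quotient_module free_algebra (SL2_ideal q)"

text \<open>The image in \<open>SL2 q\<close> of a word in the generators.\<close>

definition word_class :: "complex \<Rightarrow> gen list \<Rightarrow> (gen list \<Rightarrow>\<^sub>0 complex) set"
  where "word_class q w = SL2_ideal q +>\<^bsub>free_algebra\<^esub> Poly_Mapping.single w 1"

fun gen_counit :: "gen \<Rightarrow> complex"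
  where
    "gen_counit ga = 1"
  | "gen_counit gb = 0"
  | "gen_counit gc = 0"
  | "gen_counit gd = 1"

definition SL2_counit :: "complex \<Rightarrow> (gen list \<Rightarrow>\<^sub>0 complex) set \<Rightarrow> complex"
  where "SL2_counit q = induced_map complex_line (\<lambda>w. prod_list (map gen_counit w))"

abbreviation SL2_tensor :: "complex \<Rightarrow> gen \<Rightarrow> gen
    \<Rightarrow> ((gen list \<Rightarrow>\<^sub>0 complex) set \<times> (gen list \<Rightarrow>\<^sub>0 complex) set \<Rightarrow>\<^sub>0 complex) set"
  where "SL2_tensor q g h \<equiv> pure_tensor (SL2 q) (SL2 q) (word_class q [g]) (word_class q [h])"

fun gen_coproduct :: "complex \<Rightarrow> gen
    \<Rightarrow> ((gen list \<Rightarrow>\<^sub>0 complex) set \<times> (gen list \<Rightarrow>\<^sub>0 complex) set \<Rightarrow>\<^sub>0 complex) set"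
  where
    "gen_coproduct q ga = SL2_tensor q ga ga \<oplus>\<^bsub>tensor (SL2 q) (SL2 q)\<^esub> SL2_tensor q gb gc"
  | "gen_coproduct q gb = SL2_tensor q ga gb \<oplus>\<^bsub>tensor (SL2 q) (SL2 q)\<^esub> SL2_tensor q gb gd"
  | "gen_coproduct q gc = SL2_tensor q gc ga \<oplus>\<^bsub>tensor (SL2 q) (SL2 q)\<^esub> SL2_tensor q gd gc"
  | "gen_coproduct q gd = SL2_tensor q gc gb \<oplus>\<^bsub>tensor (SL2 q) (SL2 q)\<^esub> SL2_tensor q gd gd"

definition SL2_coproduct :: "complex \<Rightarrow> (gen list \<Rightarrow>\<^sub>0 complex) set
    \<Rightarrow> ((gen list \<Rightarrow>\<^sub>0 complex) set \<times> (gen list \<Rightarrow>\<^sub>0 complex) set \<Rightarrow>\<^sub>0 complex) set"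
  where "SL2_coproduct q = induced_map (tensor (SL2 q) (SL2 q))
    (\<lambda>w. foldr (\<lambda>g t. gen_coproduct q g \<otimes>\<^bsub>tensor (SL2 q) (SL2 q)\<^esub> t) w
      \<one>\<^bsub>tensor (SL2 q) (SL2 q)\<^esub>)"

fun gen_degree :: "gen \<Rightarrow> int"
  where
    "gen_degree ga = 1"
  | "gen_degree gb = -1"
  | "gen_degree gc = 1"
  | "gen_degree gd = -1"

definition word_degree :: "gen list \<Rightarrow> int"
  where "word_degree w = sum_list (map gen_degree w)"

definition SL2_component :: "complex \<Rightarrow> int \<Rightarrow> (gen list \<Rightarrow>\<^sub>0 complex) set set"
  where "SL2_component q n =
    {SL2_ideal q +>\<^bsub>free_algebra\<^esub> u | u. \<forall>w\<in>Poly_Mapping.keys u. word_degree w = n}"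

text \<open>The algebra automorphism with \<open>x \<mapsto> q\<^sup>k\<^sup>n x\<close> for \<open>x\<close> of degree \<open>n\<close>.\<close>

definition degree_twist ::
    "complex \<Rightarrow> int \<Rightarrow> (gen list \<Rightarrow>\<^sub>0 complex) set \<Rightarrow> (gen list \<Rightarrow>\<^sub>0 complex) set"
  where "degree_twist q k =
    induced_map (SL2 q) (\<lambda>w. (q powi (k * word_degree w)) \<odot>\<^bsub>SL2 q\<^esub> word_class q w)"


section \<open>The calculus on the quantum group\<close>

type_synonym form =
  "(gen list \<Rightarrow>\<^sub>0 complex) set \<times> (gen list \<Rightarrow>\<^sub>0 complex) set \<times> (gen list \<Rightarrow>\<^sub>0 complex) set"

text \<open>The triple \<open>(x, y, z)\<close> stands for \<open>x e\<^sup>+ + y e\<^sup>- + z e\<^sup>0\<close>; the right action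
  encodes \<open>e\<^sup>\<plusminus> x = q\<^bsup>deg x\<^esup> x e\<^sup>\<plusminus>\<close> and \<open>e\<^sup>0 x = q\<^bsup>2 deg x\<^esup> x e\<^sup>0\<close>.\<close>

definition SL2_forms ::
    "complex \<Rightarrow> (complex, (gen list \<Rightarrow>\<^sub>0 complex) set, form) bimodule"
  where "SL2_forms q =
    \<lparr>carrier = carrier (SL2 q) \<times> carrier (SL2 q) \<times> carrier (SL2 q),
     monoid.mult = undefined,
     one = undefined,
     zero = (\<zero>\<^bsub>SL2 q\<^esub>, \<zero>\<^bsub>SL2 q\<^esub>, \<zero>\<^bsub>SL2 q\<^esub>),
     add = (\<lambda>(x, y, z) (x', y', z'). (x \<oplus>\<^bsub>SL2 q\<^esub> x', y \<oplus>\<^bsub>SL2 q\<^esub> y', z \<oplus>\<^bsub>SL2 q\<^esub> z')),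
     module.smult = (\<lambda>c (x, y, z). (c \<odot>\<^bsub>SL2 q\<^esub> x, c \<odot>\<^bsub>SL2 q\<^esub> y, c \<odot>\<^bsub>SL2 q\<^esub> z)),
     lact = (\<lambda>f (x, y, z). (f \<otimes>\<^bsub>SL2 q\<^esub> x, f \<otimes>\<^bsub>SL2 q\<^esub> y, f \<otimes>\<^bsub>SL2 q\<^esub> z)),
     ract = (\<lambda>(x, y, z) f. (x \<otimes>\<^bsub>SL2 q\<^esub> degree_twist q 1 f,
                           y \<otimes>\<^bsub>SL2 q\<^esub> degree_twist q 1 f,
                           z \<otimes>\<^bsub>SL2 q\<^esub> degree_twist q 2 f))\<rparr>"

fun d_gen :: "complex \<Rightarrow> gen \<Rightarrow> form"
  where
    "d_gen q ga = (q \<odot>\<^bsub>SL2 q\<^esub> word_class q [gb], \<zero>\<^bsub>SL2 q\<^esub>, word_class q [ga])"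
  | "d_gen q gb = (\<zero>\<^bsub>SL2 q\<^esub>, word_class q [ga], (- (q powi (-2))) \<odot>\<^bsub>SL2 q\<^esub> word_class q [gb])"
  | "d_gen q gc = (q \<odot>\<^bsub>SL2 q\<^esub> word_class q [gd], \<zero>\<^bsub>SL2 q\<^esub>, word_class q [gc])"
  | "d_gen q gd = (\<zero>\<^bsub>SL2 q\<^esub>, word_class q [gc], (- (q powi (-2))) \<odot>\<^bsub>SL2 q\<^esub> word_class q [gd])"

fun d_word :: "complex \<Rightarrow> gen list \<Rightarrow> form"
  where
    "d_word q [] = \<zero>\<^bsub>SL2_forms q\<^esub>"
  | "d_word q (g # w) =
      d_gen q g \<triangleleft>\<^bsub>SL2_forms q\<^esub> word_class q w \<oplus>\<^bsub>SL2_forms q\<^esub> word_class q [g] \<triangleright>\<^bsub>SL2_forms q\<^esub> d_word q w"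

definition ext_d :: "complex \<Rightarrow> (gen list \<Rightarrow>\<^sub>0 complex) set \<Rightarrow> form"
  where "ext_d q = induced_map (SL2_forms q) (d_word q)"


section \<open>The quantum sphere\<close>

definition S2 :: "complex \<Rightarrow> (complex, (gen list \<Rightarrow>\<^sub>0 complex) set) module"
  where "S2 q = SL2 q \<lparr>carrier := SL2_component q 0\<rparr>"

definition b_zero :: "complex \<Rightarrow> (gen list \<Rightarrow>\<^sub>0 complex) set"
  where "b_zero q = word_class q [gb, gc]"

definition b_plus :: "complex \<Rightarrow> (gen list \<Rightarrow>\<^sub>0 complex) set"
  where "b_plus q = word_class q [gc, gd]"

definition b_minus :: "complex \<Rightarrow> (gen list \<Rightarrow>\<^sub>0 complex) set"
  where "b_minus q = word_class q [ga, gb]"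

text \<open>The coproduct restricted to the sphere: \<open>SL2 \<otimes> S2\<close> is a subspace of \<open>SL2 \<otimes> SL2\<close> by means of
  the map \<open>tensor_map (SL2 q) (SL2 q) id id\<close> that the inclusion of \<open>S2\<close> induces.\<close>

definition coaction_S2 :: "complex \<Rightarrow> (gen list \<Rightarrow>\<^sub>0 complex) set
    \<Rightarrow> ((gen list \<Rightarrow>\<^sub>0 complex) set \<times> (gen list \<Rightarrow>\<^sub>0 complex) set \<Rightarrow>\<^sub>0 complex) set"
  where "coaction_S2 q x =
    (THE t. t \<in> carrier (tensor (SL2 q) (S2 q)) \<and>
      tensor_map (SL2 q) (SL2 q) id id t = SL2_coproduct q x)"

definition S2_forms ::
    "complex \<Rightarrow> (complex, (gen list \<Rightarrow>\<^sub>0 complex) set, form) bimodule"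
  where "S2_forms q = SL2_forms q
    \<lparr>carrier := cspan (SL2_forms q)
       {m \<triangleright>\<^bsub>SL2_forms q\<^esub> ext_d q n | m n. m \<in> carrier (S2 q) \<and> n \<in> carrier (S2 q)}\<rparr>"

definition S2_forms10 ::
    "complex \<Rightarrow> (complex, (gen list \<Rightarrow>\<^sub>0 complex) set, form) bimodule"
  where "S2_forms10 q = SL2_forms q
    \<lparr>carrier := {(x, \<zero>\<^bsub>SL2 q\<^esub>, \<zero>\<^bsub>SL2 q\<^esub>) | x. x \<in> SL2_component q (-2)}\<rparr>"

definition S2_forms01 ::
    "complex \<Rightarrow> (complex, (gen list \<Rightarrow>\<^sub>0 complex) set, form) bimodule"
  where "S2_forms01 q = SL2_forms q
    \<lparr>carrier := {(\<zero>\<^bsub>SL2 q\<^esub>, y, \<zero>\<^bsub>SL2 q\<^esub>) | y. y \<in> SL2_component q 2}\<rparr>"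

definition del :: "complex \<Rightarrow> (gen list \<Rightarrow>\<^sub>0 complex) set \<Rightarrow> form"
  where "del q f = (case ext_d q f of (x, y, z) \<Rightarrow> (x, \<zero>\<^bsub>SL2 q\<^esub>, \<zero>\<^bsub>SL2 q\<^esub>))"

definition delbar :: "complex \<Rightarrow> (gen list \<Rightarrow>\<^sub>0 complex) set \<Rightarrow> form"
  where "delbar q f = (case ext_d q f of (x, y, z) \<Rightarrow> (\<zero>\<^bsub>SL2 q\<^esub>, y, \<zero>\<^bsub>SL2 q\<^esub>))"

end

theory Submission
  imports Defs
begin

text \<open>
  A map on words in the generators descends to \<open>A = SL2 q\<close> as soon as it respects the seven relations
  in every context \<open>u _ v\<close>; this gives counit, coproduct, degree twists, the differential and the projections
  onto the homogeneous components \<open>A\<^sub>n\<close>. The grading splits the inclusion of the sphere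
  \<open>B = A\<^sub>0\<close> in \<open>A\<close>, so \<open>A \<otimes> B\<close> embeds in \<open>A \<otimes> A\<close> and the coaction on \<open>B\<close> is
  \<open>(id \<otimes> \<pi>\<^sub>0) \<Delta>\<close>. Since \<open>e\<^sup>\<plusminus>\<close> are left-invariant, \<open>x e\<^sup>\<plusminus> \<mapsto> \<Delta>(x) (1 \<otimes> e\<^sup>\<plusminus>)\<close>
  is the coaction on \<open>A\<^sub>\<minusplus>\<^sub>2 e\<^sup>\<plusminus>\<close>.

  That the \<open>m dn\<close> span both summands rests on the partition of unity
  \<open>1 = a\<^sup>2 \<cdot> d\<^sup>2 - (q\<^sup>-\<^sup>1 + q\<^sup>-\<^sup>3) ca \<cdot> db + q\<^sup>-\<^sup>2 c\<^sup>2 \<cdot> b\<^sup>2\<close>, obtained by inserting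
  \<open>1 = ad - q\<^sup>-\<^sup>1 bc\<close> into itself: the right factors are the coefficients of \<open>\<partial>b\<^sub>+\<close>,
  \<open>\<partial>b\<^sub>0\<close>, \<open>\<partial>b\<^sub>-\<close>, and with those of the antiholomorphic differentials in their place the sum
  vanishes. The same holds with the two differentials exchanged.
\<close>

text \<open>No basis of \<open>SL2 q\<close> is established. Only equalities have to be proved, so
  it suffices to move b and c to the left of a and d and to compare coefficients; independence of
  the ordered words would be needed only to refute an identity. That the two summands meet in 0 is
  visible from the encoding of forms as triples. The obstacle is that every space is a quotient and
  every map is given on representatives: each map must first be shown constant on cosets. Two
  universal properties carry this burden, one for \<open>SL2 q\<close> and one for
  \<open>tensor\<close>. The e^0 part disappears on the sphere because on a word of degree n it is
  the word times the q^2-integer (q^(2n) - 1)/(q^2 - 1), or times n if q^2 = 1. Left covariance of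
  the differential has a matrix reason: the coefficients of e^+ and e^- act on the generators by
  column operations, while the coproduct multiplies the generator matrix from the left. The
  coefficients of the partition of unity are those of the antipode axiom S(x_1) x_2 = \<epsilon>(x)
  for x = d^2, and for x = a^2 in the antiholomorphic case; the vanishing sums are the axiom for c^2
  and b^2.\<close>

lemma complex_ring_simps [simp]:
  "carrier complex_ring = UNIV"
  "x \<oplus>\<^bsub>complex_ring\<^esub> y = x + y"
  "x \<otimes>\<^bsub>complex_ring\<^esub> y = x * y"
  "\<zero>\<^bsub>complex_ring\<^esub> = 0"
  "\<one>\<^bsub>complex_ring\<^esub> = 1"
  by (simp_all add: ring_of_type_algebra_def)

lemma cring_complex_ring [simp]: "cring complex_ring"
  by (rule cring_from_type_algebra)

lemma complex_ring_uminus [simp]: "\<ominus>\<^bsub>complex_ring\<^esub> x = - x"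
proof -
  interpret R: cring complex_ring by simp
  show ?thesis
    using R.minus_equality[of "- x" x] by simp
qed

section \<open>Complex vector spaces, subspaces, spans and linear maps\<close>

locale complex_space = module complex_ring V for V (structure)
begin

lemma smult_cl [simp, intro]: "x \<in> carrier V \<Longrightarrow> c \<odot> x \<in> carrier V"
  using smult_closed[of c x] by simp

lemma smult_add_scalar: "x \<in> carrier V \<Longrightarrow> (c + d) \<odot> x = c \<odot> x \<oplus> d \<odot> x"
  using smult_l_distr[of c d x] by simp

lemma smult_add: "x \<in> carrier V \<Longrightarrow> y \<in> carrier V \<Longrightarrow> c \<odot> (x \<oplus> y) = c \<odot> x \<oplus> c \<odot> y"
  using smult_r_distr[of c x y] by simp

lemma smult_smult [simp]: "x \<in> carrier V \<Longrightarrow> c \<odot> (d \<odot> x) = (c * d) \<odot> x"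
  using smult_assoc1[of c d x] by simp

lemma one_smult [simp]: "x \<in> carrier V \<Longrightarrow> 1 \<odot> x = x"
  using smult_one[of x] by simp

lemma zero_smult [simp]: "x \<in> carrier V \<Longrightarrow> 0 \<odot> x = \<zero>"
  using smult_l_null[of x] by simp

lemma smult_zero [simp]: "c \<odot> \<zero> = \<zero>"
  using smult_r_null[of c] by simp

lemma minus_one_smult: "x \<in> carrier V \<Longrightarrow> (- 1) \<odot> x = \<ominus> x"
  using smult_l_minus[of 1 x] by simp

lemma minus_eq_smult: "x \<in> carrier V \<Longrightarrow> y \<in> carrier V \<Longrightarrow> x \<ominus> y = x \<oplus> (- 1) \<odot> y"
  by (simp add: minus_one_smult a_minus_def)

lemma subspaceI:
  assumes "N \<subseteq> carrier V" "\<zero> \<in> N"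
    and "\<And>x y. x \<in> N \<Longrightarrow> y \<in> N \<Longrightarrow> x \<oplus> y \<in> N"
    and "\<And>c x. x \<in> N \<Longrightarrow> c \<odot> x \<in> N"
  shows "submodule N complex_ring V"
proof (rule submoduleI)
  show "\<ominus> a \<in> N" if "a \<in> N" for a
    using assms(4)[OF that, of "- 1"] assms(1) that minus_one_smult[of a] by auto
qed (use assms in auto)

lemma subspaceD:
  assumes "submodule N complex_ring V"
  shows "N \<subseteq> carrier V" "\<zero> \<in> N"
    "\<And>x y. x \<in> N \<Longrightarrow> y \<in> N \<Longrightarrow> x \<oplus> y \<in> N"
    "\<And>c x. x \<in> N \<Longrightarrow> c \<odot> x \<in> N"
proof -
  note E = submoduleE[OF assms]
  show N: "N \<subseteq> carrier V" "\<And>x y. x \<in> N \<Longrightarrow> y \<in> N \<Longrightarrow> x \<oplus> y \<in> N" "\<And>c x. x \<in> N \<Longrightarrow> c \<odot> x \<in> N"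
    using E by auto
  obtain x where "x \<in> N" using E(2) by auto
  then show "\<zero> \<in> N" using N(3)[of x 0] N(1) by auto
qed

lemma subspace_space:
  "submodule N complex_ring V \<Longrightarrow> complex_space (V\<lparr>carrier := N\<rparr>)"
  unfolding complex_space_def
  by (rule submodule.submodule_is_module) (auto intro: module_axioms)

lemma cspan_subspace: "S \<subseteq> carrier V \<Longrightarrow> submodule (cspan V S) complex_ring V"
  unfolding cspan_def
  by (rule subspaceI) (use carrier_is_submodule subspaceD(2-4) in auto)

lemma cspan_incl: "x \<in> S \<Longrightarrow> x \<in> cspan V S"
  unfolding cspan_def by auto

lemma cspan_least: "submodule N complex_ring V \<Longrightarrow> S \<subseteq> N \<Longrightarrow> cspan V S \<subseteq> N"
  unfolding cspan_def by auto

lemma cspan_carrier: "S \<subseteq> carrier V \<Longrightarrow> cspan V S \<subseteq> carrier V"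
  using cspan_least[OF carrier_is_submodule] .

lemma cspan_induct [consumes 2, case_names zero incl add smult]:
  assumes "x \<in> cspan V S" "S \<subseteq> carrier V"
    and "P \<zero>" "\<And>x. x \<in> S \<Longrightarrow> P x"
    and "\<And>x y. x \<in> carrier V \<Longrightarrow> y \<in> carrier V \<Longrightarrow> P x \<Longrightarrow> P y \<Longrightarrow> P (x \<oplus> y)"
    and "\<And>c x. x \<in> carrier V \<Longrightarrow> P x \<Longrightarrow> P (c \<odot> x)"
  shows "P x"
proof -
  have "submodule {x \<in> carrier V. P x} complex_ring V"
    by (rule subspaceI) (use assms in auto)
  then have "cspan V S \<subseteq> {x \<in> carrier V. P x}"
    by (rule cspan_least) (use assms in auto)
  then show ?thesis using assms(1) by auto
qed

end

text \<open>Scaling by - 1 provides the additive inverses, so concrete records can be checked by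
  equations alone, without exhibiting an inverse operation.\<close>

lemma complex_spaceI:
  fixes V (structure)
  assumes "\<And>x y. x \<in> carrier V \<Longrightarrow> y \<in> carrier V \<Longrightarrow> x \<oplus> y \<in> carrier V"
    and "\<zero> \<in> carrier V"
    and "\<And>c x. x \<in> carrier V \<Longrightarrow> c \<odot> x \<in> carrier V"
    and "\<And>x y z. x \<in> carrier V \<Longrightarrow> y \<in> carrier V \<Longrightarrow> z \<in> carrier V \<Longrightarrow> (x \<oplus> y) \<oplus> z = x \<oplus> (y \<oplus> z)"
    and "\<And>x y. x \<in> carrier V \<Longrightarrow> y \<in> carrier V \<Longrightarrow> x \<oplus> y = y \<oplus> x"
    and "\<And>x. x \<in> carrier V \<Longrightarrow> \<zero> \<oplus> x = x"
    and "\<And>x. x \<in> carrier V \<Longrightarrow> (- 1) \<odot> x \<oplus> x = \<zero>"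
    and "\<And>c d x. x \<in> carrier V \<Longrightarrow> (c + d) \<odot> x = c \<odot> x \<oplus> d \<odot> x"
    and "\<And>c x y. x \<in> carrier V \<Longrightarrow> y \<in> carrier V \<Longrightarrow> c \<odot> (x \<oplus> y) = c \<odot> x \<oplus> c \<odot> y"
    and "\<And>c d x. x \<in> carrier V \<Longrightarrow> (c * d) \<odot> x = c \<odot> (d \<odot> x)"
    and "\<And>x. x \<in> carrier V \<Longrightarrow> 1 \<odot> x = x"
  shows "complex_space V"
  unfolding complex_space_def
proof (rule moduleI)
  show "abelian_group V"
  proof (rule abelian_groupI)
    show "\<exists>y\<in>carrier V. y \<oplus> x = \<zero>" if "x \<in> carrier V" for x
      by (rule bexI[where x="(- 1) \<odot> x"]) (simp_all only: assms(3,7) that)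
  qed (simp_all only: assms(1,2,4,6), rule assms(5))
qed (use assms(3,8-11) in auto)

lemma linear_mapI:
  assumes "\<And>x. x \<in> carrier V \<Longrightarrow> f x \<in> carrier W"
    and "\<And>x y. x \<in> carrier V \<Longrightarrow> y \<in> carrier V \<Longrightarrow> f (x \<oplus>\<^bsub>V\<^esub> y) = f x \<oplus>\<^bsub>W\<^esub> f y"
    and "\<And>c x. x \<in> carrier V \<Longrightarrow> f (c \<odot>\<^bsub>V\<^esub> x) = c \<odot>\<^bsub>W\<^esub> f x"
  shows "linear_map V W f"
  using assms unfolding linear_map_def by auto

lemma linear_mapD:
  assumes "linear_map V W f"
  shows "x \<in> carrier V \<Longrightarrow> f x \<in> carrier W"
    and "x \<in> carrier V \<Longrightarrow> y \<in> carrier V \<Longrightarrow> f (x \<oplus>\<^bsub>V\<^esub> y) = f x \<oplus>\<^bsub>W\<^esub> f y"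
    and "x \<in> carrier V \<Longrightarrow> f (c \<odot>\<^bsub>V\<^esub> x) = c \<odot>\<^bsub>W\<^esub> f x"
  using assms unfolding linear_map_def by auto

lemma linear_map_zero:
  assumes "complex_space V" "complex_space W" "linear_map V W f"
  shows "f \<zero>\<^bsub>V\<^esub> = \<zero>\<^bsub>W\<^esub>"
proof -
  interpret V: complex_space V by fact
  interpret W: complex_space W by fact
  have "f (0 \<odot>\<^bsub>V\<^esub> \<zero>\<^bsub>V\<^esub>) = 0 \<odot>\<^bsub>W\<^esub> f \<zero>\<^bsub>V\<^esub>"
    by (rule linear_mapD[OF assms(3)]) simp
  then show ?thesis using linear_mapD(1)[OF assms(3)] by simp
qed

lemma linear_map_minus:
  assumes "complex_space V" "complex_space W" "linear_map V W f" "x \<in> carrier V" "y \<in> carrier V"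
  shows "f (x \<ominus>\<^bsub>V\<^esub> y) = f x \<ominus>\<^bsub>W\<^esub> f y"
proof -
  interpret V: complex_space V by fact
  interpret W: complex_space W by fact
  show ?thesis using assms
    by (simp add: V.minus_eq_smult W.minus_eq_smult linear_mapD[OF assms(3)])
qed

lemma linear_map_id: "linear_map V V id"
  by (rule linear_mapI) auto

lemma linear_map_comp:
  "linear_map U V f \<Longrightarrow> linear_map V W g \<Longrightarrow> linear_map U W (\<lambda>x. g (f x))"
  by (rule linear_mapI) (auto simp: linear_mapD)

lemma linear_map_cong:
  assumes "linear_map V W f" "\<And>x. x \<in> carrier V \<Longrightarrow> g x = f x" "complex_space V"
  shows "linear_map V W g"
proof -
  interpret V: complex_space V by fact
  show ?thesis by (rule linear_mapI) (simp_all add: assms(2) linear_mapD[OF assms(1)])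
qed

lemma linear_map_add:
  assumes "linear_map V W f" "linear_map V W g" "complex_space W"
  shows "linear_map V W (\<lambda>x. f x \<oplus>\<^bsub>W\<^esub> g x)"
proof -
  interpret W: complex_space W by fact
  show ?thesis
    by (rule linear_mapI)
      (simp_all add: linear_mapD[OF assms(1)] linear_mapD[OF assms(2)] W.smult_add W.a_ac)
qed

lemma linear_map_smult:
  assumes "linear_map V W f" "complex_space W"
  shows "linear_map V W (\<lambda>x. c \<odot>\<^bsub>W\<^esub> f x)"
proof -
  interpret W: complex_space W by fact
  show ?thesis
    by (rule linear_mapI)
      (simp_all add: linear_mapD[OF assms(1)] W.smult_add mult.commute[of c])
qed

lemma linear_map_null:
  assumes "complex_space W"
  shows "linear_map V W (\<lambda>x. \<zero>\<^bsub>W\<^esub>)"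
proof -
  interpret W: complex_space W by fact
  show ?thesis by (rule linear_mapI) simp_all
qed

lemma linear_map_eq_on_cspan:
  assumes "complex_space V" "complex_space W" "linear_map V W f" "linear_map V W g"
    and "S \<subseteq> carrier V" "\<And>x. x \<in> S \<Longrightarrow> f x = g x" "x \<in> cspan V S"
  shows "f x = g x"
proof -
  interpret V: complex_space V by fact
  interpret W: complex_space W by fact
  show ?thesis using assms(7,5)
    by (induct rule: V.cspan_induct)
      (auto simp: linear_mapD[OF assms(3)] linear_mapD[OF assms(4)] assms(6)
        linear_map_zero[OF assms(1-3)] linear_map_zero[OF assms(1,2,4)])
qed

lemma (in complex_algebra) complex_space: "complex_space A"
  unfolding complex_space_def by (rule module_axioms)

sublocale complex_algebra \<subseteq> space: complex_space A
  by (rule complex_space)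

lemma complex_algebraI:
  assumes "complex_space A" "ring A"
    and "\<And>z x y. x \<in> carrier A \<Longrightarrow> y \<in> carrier A \<Longrightarrow> (z \<odot>\<^bsub>A\<^esub> x) \<otimes>\<^bsub>A\<^esub> y = z \<odot>\<^bsub>A\<^esub> (x \<otimes>\<^bsub>A\<^esub> y)"
    and "\<And>z x y. x \<in> carrier A \<Longrightarrow> y \<in> carrier A \<Longrightarrow> x \<otimes>\<^bsub>A\<^esub> (z \<odot>\<^bsub>A\<^esub> y) = z \<odot>\<^bsub>A\<^esub> (x \<otimes>\<^bsub>A\<^esub> y)"
  shows "complex_algebra A"
  using assms unfolding complex_algebra_def complex_space_def complex_algebra_axioms_def by auto

section \<open>Quotients\<close>

locale complex_quotient = complex_space V for V (structure) +
  fixes N assumes subspace: "submodule N complex_ring V"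
begin

abbreviation "Q \<equiv> quotient_module V N"

lemma N_sub: "N \<subseteq> carrier V" and N_zero: "\<zero> \<in> N"
  and N_add: "x \<in> N \<Longrightarrow> y \<in> N \<Longrightarrow> x \<oplus> y \<in> N"
  and N_smult: "x \<in> N \<Longrightarrow> c \<odot> x \<in> N"
  using subspaceD[OF subspace] by auto

sublocale N: abelian_subgroup N V
  by (rule abelian_subgroupI3)
    (auto intro: additive_subgroupI submodule.axioms(1)[OF subspace] M.abelian_group_axioms)

lemma coset_eq_iff:
  assumes "x \<in> carrier V" "y \<in> carrier V"
  shows "N +> x = N +> y \<longleftrightarrow> x \<ominus> y \<in> N"
proof -
  have "x \<ominus> y \<in> N \<longleftrightarrow> x \<in> N +> y"
    using N.a_rcos_module[OF assms(2,1)]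
    by (simp add: a_minus_def)
  then show ?thesis
    using N.a_repr_independence'[OF _ assms(2)] N.a_rcos_self[OF assms(1)] by auto
qed

lemma carrier_quotient: "carrier Q = (\<lambda>x. N +> x) ` carrier V"
  by (auto simp: quotient_module_def ring.defs module.defs FactRing_def A_RCOSETS_def')

lemma carrier_quotientE:
  assumes "C \<in> carrier Q"
  obtains x where "x \<in> carrier V" "C = N +> x"
  using assms carrier_quotient by auto

lemma coset_closed [simp]: "x \<in> carrier V \<Longrightarrow> N +> x \<in> carrier Q"
  by (auto simp: carrier_quotient)

lemma quotient_zero: "\<zero>\<^bsub>Q\<^esub> = N +> \<zero>"
  using a_coset_add_zero[of N] N_sub
  by (simp add: quotient_module_def ring.defs module.defs FactRing_def)

lemma quotient_add:
  "x \<in> carrier V \<Longrightarrow> y \<in> carrier V \<Longrightarrow> (N +> x) \<oplus>\<^bsub>Q\<^esub> (N +> y) = N +> (x \<oplus> y)"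
  using N.a_rcos_sum[of x y]
  by (simp add: quotient_module_def ring.defs module.defs FactRing_def)

text \<open>The scalar action on a coset is defined as a union over all representatives. The members
  of that union coincide because N is closed under scalars.\<close>

lemma quotient_smult:
  assumes x: "x \<in> carrier V"
  shows "c \<odot>\<^bsub>Q\<^esub> (N +> x) = N +> (c \<odot> x)"
proof -
  have "N +> (c \<odot> y) = N +> (c \<odot> x)" if "y \<in> N +> x" for y
  proof -
    have y: "y \<in> carrier V" using that x N.a_elemrcos_carrier by auto
    have "y \<ominus> x \<in> N"
      using that coset_eq_iff[OF y x] N.a_repr_independence'[OF that x] by auto
    then have "c \<odot> (y \<ominus> x) \<in> N" by (rule N_smult)
    then show ?thesis
      using coset_eq_iff x y by (simp add: minus_eq_smult smult_add)
  qed
  then have "(\<Union>y\<in>N +> x. N +> (c \<odot> y)) = N +> (c \<odot> x)"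
    using N.a_rcos_self[OF x] by blast
  then show ?thesis
    by (simp add: quotient_module_def ring.defs module.defs FactRing_def)
qed

lemma quotient_space: "complex_space Q"
  by (rule complex_spaceI)
    (auto elim!: carrier_quotientE
      simp: quotient_zero quotient_add quotient_smult a_ac minus_one_smult M.l_neg M.r_neg
        smult_add_scalar smult_add)

lemma coset_linear: "linear_map V Q (\<lambda>x. N +> x)"
  by (rule linear_mapI) (auto simp: quotient_add quotient_smult)

lemma coset_eq_zero_iff: "x \<in> carrier V \<Longrightarrow> N +> x = \<zero>\<^bsub>Q\<^esub> \<longleftrightarrow> x \<in> N"
  unfolding quotient_zero by (subst coset_eq_iff) (auto simp: minus_eq_smult)

text \<open>This justifies \<open>the_elem\<close> in \<open>induced_map\<close>: a linear map that
  kills N takes a single value on each coset.\<close>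

lemma image_coset:
  assumes W: "complex_space W" and f: "linear_map V W f"
    and null: "\<And>n. n \<in> N \<Longrightarrow> f n = \<zero>\<^bsub>W\<^esub>" and x: "x \<in> carrier V"
  shows "f ` (N +> x) = {f x}"
proof -
  interpret W: complex_space W by fact
  have "f y = f x" if "y \<in> N +> x" for y
  proof -
    obtain n where n: "n \<in> N" "y = n \<oplus> x"
      using \<open>y \<in> N +> x\<close> by (auto simp: a_r_coset_def')
    then have "n \<in> carrier V" using N_sub by auto
    then show ?thesis using n x null by (simp add: linear_mapD[OF f])
  qed
  then show ?thesis using N.a_rcos_self[OF x] by blast
qed

end

section \<open>Free spaces\<close>

abbreviation "single \<equiv> Poly_Mapping.single"
abbreviation "keys \<equiv> Poly_Mapping.keys"
abbreviation "lookup \<equiv> Poly_Mapping.lookup"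
abbreviation scale :: "complex \<Rightarrow> ('x \<Rightarrow>\<^sub>0 complex) \<Rightarrow> 'x \<Rightarrow>\<^sub>0 complex"
  where "scale c \<equiv> Poly_Mapping.map ((*) c)"

lemma lookup_map_scale [simp]:
  "lookup (scale z u) k = z * lookup u (k::'x)"
  for z :: complex
  by (transfer) (auto simp: when_def)

lemma map_scale_single [simp]:
  "scale z (single x c) = single x (z * c)"
  for z :: complex
  by (rule poly_mapping_eqI) (auto simp: lookup_single when_def)

lemma keys_map_scale: "keys (scale z u) \<subseteq> keys u"
  for z :: complex
  by (auto simp: in_keys_iff)

lemma monoid_algebra_simps:
  "carrier (monoid_algebra S f e) = {u. keys u \<subseteq> S}"
  "x \<oplus>\<^bsub>monoid_algebra S f e\<^esub> y = x + y"
  "\<zero>\<^bsub>monoid_algebra S f e\<^esub> = 0"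
  "\<one>\<^bsub>monoid_algebra S f e\<^esub> = single e 1"
  "c \<odot>\<^bsub>monoid_algebra S f e\<^esub> x = scale c x"
  by (simp_all add: monoid_algebra_def)

lemma monoid_algebra_space: "complex_space (monoid_algebra S f e)"
  by (rule complex_spaceI)
    (auto simp: monoid_algebra_simps poly_mapping_eq_iff fun_eq_iff lookup_add algebra_simps
      dest!: subsetD[OF keys_add] subsetD[OF keys_map_scale])

lemma single_in_monoid_algebra [simp]:
  "x \<in> S \<Longrightarrow> single x c \<in> carrier (monoid_algebra S f e)"
  by (simp add: monoid_algebra_simps)

lemma poly_mapping_sum_singles:
  "u = (\<Sum>x\<in>keys u. single x (lookup u x))"
  by (rule poly_mapping_eqI) (auto simp: lookup_sum lookup_single when_def in_keys_iff)

lemma monoid_algebra_induct [consumes 1, case_names zero single add]: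
  assumes u: "u \<in> carrier (monoid_algebra S f e)"
    and "P 0" "\<And>x c. x \<in> S \<Longrightarrow> P (single x c)"
    and "\<And>u v. u \<in> carrier (monoid_algebra S f e) \<Longrightarrow> v \<in> carrier (monoid_algebra S f e)
      \<Longrightarrow> P u \<Longrightarrow> P v \<Longrightarrow> P (u + v)"
  shows "P u"
proof -
  interpret F: complex_space "monoid_algebra S f e" by (rule monoid_algebra_space)
  let ?s = "\<lambda>J. \<Sum>x\<in>J. single x (lookup u x)"
  \<comment> \<open>Membership is carried along because the additive case of the rule demands that
    both summands lie in the carrier.\<close>
  have "?s J \<in> carrier (monoid_algebra S f e) \<and> P (?s J)" if "finite J" "J \<subseteq> S" for J
    using that
  proof (induct J)
    case empty
    then show ?case using assms(2) F.zero_closed by (simp add: monoid_algebra_simps)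
  next
    case (insert x J)
    let ?t = "single x (lookup u x)"
    have t: "?t \<in> carrier (monoid_algebra S f e)" "P ?t"
      using insert.prems assms(3) by auto
    have J: "?s J \<in> carrier (monoid_algebra S f e)" "P (?s J)"
      using insert by auto
    have "?s (insert x J) = ?t + ?s J"
      using insert by simp
    then show ?case
      using assms(4)[OF t(1) J(1) t(2) J(2)] F.a_closed[OF t(1) J(1)]
      by (simp only: monoid_algebra_simps(2))
  qed
  then show ?thesis
    using u poly_mapping_sum_singles[of u, symmetric]
    by (metis (no_types, lifting) finite_keys mem_Collect_eq monoid_algebra_simps(1))
qed

text \<open>The support of a sum can be smaller than the union of the supports. Summing over a
  common finite superset makes linearity a termwise matter.\<close>

lemma linear_extension_superset:
  assumes "complex_space W" "g \<in> S \<rightarrow> carrier W" "keys u \<subseteq> J" "finite J" "J \<subseteq> S"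
  shows "linear_extension W g u = (\<Oplus>\<^bsub>W\<^esub>x\<in>J. lookup u x \<odot>\<^bsub>W\<^esub> g x)"
proof -
  interpret W: complex_space W by fact
  show ?thesis unfolding linear_extension_def
  proof (rule W.add.finprod_mono_neutral_cong_left)
    show "lookup u i \<odot>\<^bsub>W\<^esub> g i = \<zero>\<^bsub>W\<^esub>" if "i \<in> J - keys u" for i
    proof -
      have "g i \<in> carrier W" using assms that by auto
      then show ?thesis using that by (simp add: in_keys_iff)
    qed
  qed (use assms in auto)
qed

lemma linear_extension_linear:
  assumes W: "complex_space W" and g: "g \<in> S \<rightarrow> carrier W"
  shows "linear_map (monoid_algebra S f e) W (linear_extension W g)"
proof -
  interpret W: complex_space W by fact
  show ?thesis
  proof (rule linear_mapI)
    show "linear_extension W g x \<in> carrier W" if "x \<in> carrier (monoid_algebra S f e)" for x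
      unfolding linear_extension_def
      by (rule W.finsum_closed) (use that g in \<open>auto simp: monoid_algebra_simps\<close>)
    show "linear_extension W g (x \<oplus>\<^bsub>monoid_algebra S f e\<^esub> y)
        = linear_extension W g x \<oplus>\<^bsub>W\<^esub> linear_extension W g y"
      if "x \<in> carrier (monoid_algebra S f e)" "y \<in> carrier (monoid_algebra S f e)" for x y
    proof -
      let ?X = "keys x \<union> keys y"
      have J: "finite ?X" "?X \<subseteq> S" using that by (auto simp: monoid_algebra_simps)
      have gX: "g i \<in> carrier W" if "i \<in> ?X" for i using that J g by auto
      have "linear_extension W g (x + y) = (\<Oplus>\<^bsub>W\<^esub>i\<in>?X. lookup (x + y) i \<odot>\<^bsub>W\<^esub> g i)"
        by (rule linear_extension_superset[OF W g keys_add J])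
      also have "\<dots> = (\<Oplus>\<^bsub>W\<^esub>i\<in>?X. lookup x i \<odot>\<^bsub>W\<^esub> g i \<oplus>\<^bsub>W\<^esub> lookup y i \<odot>\<^bsub>W\<^esub> g i)"
        by (rule W.finsum_cong')
          (use gX in \<open>auto simp: lookup_add W.smult_add_scalar\<close>)
      also have "\<dots> = (\<Oplus>\<^bsub>W\<^esub>i\<in>?X. lookup x i \<odot>\<^bsub>W\<^esub> g i) \<oplus>\<^bsub>W\<^esub> (\<Oplus>\<^bsub>W\<^esub>i\<in>?X. lookup y i \<odot>\<^bsub>W\<^esub> g i)"
        by (rule W.finsum_addf) (use gX in auto)
      also have "\<dots> = linear_extension W g x \<oplus>\<^bsub>W\<^esub> linear_extension W g y"
        using linear_extension_superset[OF W g _ J] by simp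
      finally show ?thesis by (simp add: monoid_algebra_simps)
    qed
    show "linear_extension W g (c \<odot>\<^bsub>monoid_algebra S f e\<^esub> x) = c \<odot>\<^bsub>W\<^esub> linear_extension W g x"
      if "x \<in> carrier (monoid_algebra S f e)" for c x
    proof -
      let ?X = "keys x"
      have J: "finite ?X" "?X \<subseteq> S" using that by (auto simp: monoid_algebra_simps)
      have gX: "g i \<in> carrier W" if "i \<in> ?X" for i using that J g by auto
      have "linear_extension W g (scale c x)
          = (\<Oplus>\<^bsub>W\<^esub>i\<in>?X. lookup (scale c x) i \<odot>\<^bsub>W\<^esub> g i)"
        by (rule linear_extension_superset[OF W g keys_map_scale J])
      also have "\<dots> = (\<Oplus>\<^bsub>W\<^esub>i\<in>?X. c \<odot>\<^bsub>W\<^esub> (lookup x i \<odot>\<^bsub>W\<^esub> g i))"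
        by (rule W.finsum_cong') (use gX in auto)
      also have "\<dots> = c \<odot>\<^bsub>W\<^esub> linear_extension W g x"
        unfolding linear_extension_def
        by (rule W.finsum_smult_ldistr[symmetric]) (use gX in auto)
      finally show ?thesis by (simp add: monoid_algebra_simps)
    qed
  qed
qed

lemma linear_extension_single:
  assumes W: "complex_space W" and g: "g x \<in> carrier W"
  shows "linear_extension W g (single x c) = c \<odot>\<^bsub>W\<^esub> g x"
proof -
  interpret W: complex_space W by fact
  have "linear_extension W g (single x c)
      = (\<Oplus>\<^bsub>W\<^esub>i\<in>{x}. lookup (single x c) i \<odot>\<^bsub>W\<^esub> g i)"
    by (rule linear_extension_superset[where S="{x}"]) (use assms in auto)
  then show ?thesis using g by simp
qed

lemma linear_map_eq_on_singles:
  assumes W: "complex_space W" and h: "linear_map (monoid_algebra S f e) W h"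
    and k: "linear_map (monoid_algebra S f e) W k"
    and eq: "\<And>x c. x \<in> S \<Longrightarrow> h (single x c) = k (single x c)"
    and u: "u \<in> carrier (monoid_algebra S f e)"
  shows "h u = k u"
  using u
proof (induct rule: monoid_algebra_induct)
  case zero
  then show ?case
    using linear_map_zero[OF monoid_algebra_space W h] linear_map_zero[OF monoid_algebra_space W k]
    by (simp add: monoid_algebra_simps)
next
  case (add u v)
  then show ?case
    using linear_mapD(2)[OF h, of u v] linear_mapD(2)[OF k, of u v] by (simp add: monoid_algebra_simps(2))
qed (rule eq)

text \<open>The same device as for linear extensions: distributivity is proved over supersets of the
  supports, where cancellation causes no trouble.\<close>

lemma monoid_algebra_mult_superset:
  assumes "finite J" "finite Y" "keys u \<subseteq> J" "keys v \<subseteq> Y"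
  shows "u \<otimes>\<^bsub>monoid_algebra S f e\<^esub> v =
    (\<Sum>x\<in>J. \<Sum>y\<in>Y. single (f x y) (lookup u x * lookup v y))"
proof -
  have "(\<Sum>x\<in>J. \<Sum>y\<in>Y. single (f x y) (lookup u x * lookup v y))
    = (\<Sum>x\<in>J. \<Sum>y\<in>keys v. single (f x y) (lookup u x * lookup v y))"
    by (rule sum.cong[OF refl], rule sum.mono_neutral_right)
      (use assms in \<open>auto simp: in_keys_iff\<close>)
  also have "\<dots> = (\<Sum>x\<in>keys u. \<Sum>y\<in>keys v. single (f x y) (lookup u x * lookup v y))"
    by (rule sum.mono_neutral_right)
      (use assms in \<open>auto simp: in_keys_iff\<close>)
  finally show ?thesis by (simp add: monoid_algebra_def)
qed

lemma monoid_algebra_mult_single [simp]: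
  "single x c \<otimes>\<^bsub>monoid_algebra S f e\<^esub> single y d
    = single (f x y) (c * d)"
  by (subst monoid_algebra_mult_superset[of "{x}" "{y}"]) auto

lemma monoid_algebra_add_mult:
  "(u + u') \<otimes>\<^bsub>monoid_algebra S f e\<^esub> v
    = u \<otimes>\<^bsub>monoid_algebra S f e\<^esub> v + u' \<otimes>\<^bsub>monoid_algebra S f e\<^esub> v"
  using keys_add[of u u']
  by (simp add: monoid_algebra_mult_superset[of "keys u \<union> keys u'" "keys v"]
      lookup_add distrib_right single_add sum.distrib)

lemma monoid_algebra_mult_add:
  "v \<otimes>\<^bsub>monoid_algebra S f e\<^esub> (u + u')
    = v \<otimes>\<^bsub>monoid_algebra S f e\<^esub> u + v \<otimes>\<^bsub>monoid_algebra S f e\<^esub> u'"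
  using keys_add[of u u']
  by (simp add: monoid_algebra_mult_superset[of "keys v" "keys u \<union> keys u'"]
      lookup_add distrib_left single_add sum.distrib)

lemma map_scale_sum: "scale z (sum h J) = (\<Sum>x\<in>J. scale z (h x))"
  for z :: complex
  by (rule poly_mapping_eqI) (simp add: lookup_sum sum_distrib_left)

lemma monoid_algebra_smult_mult:
  "scale c u \<otimes>\<^bsub>monoid_algebra S f e\<^esub> v
    = scale c (u \<otimes>\<^bsub>monoid_algebra S f e\<^esub> v)"
  using keys_map_scale[of c u]
  by (simp add: monoid_algebra_mult_superset[of "keys u" "keys v"]
      map_scale_sum mult.assoc)

lemma monoid_algebra_mult_smult:
  "v \<otimes>\<^bsub>monoid_algebra S f e\<^esub> scale c u
    = scale c (v \<otimes>\<^bsub>monoid_algebra S f e\<^esub> u)"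
  using keys_map_scale[of c u]
  by (simp add: monoid_algebra_mult_superset[of "keys v" "keys u"]
      map_scale_sum mult.left_commute)

lemma monoid_algebra_mult_0 [simp]:
  "0 \<otimes>\<^bsub>monoid_algebra S f e\<^esub> v = 0" "v \<otimes>\<^bsub>monoid_algebra S f e\<^esub> 0 = 0"
  by (simp_all add: monoid_algebra_def)

lemma monoid_algebra_mult_closed:
  assumes "\<And>x y. x \<in> S \<Longrightarrow> y \<in> S \<Longrightarrow> f x y \<in> S"
    and "u \<in> carrier (monoid_algebra S f e)" "v \<in> carrier (monoid_algebra S f e)"
  shows "u \<otimes>\<^bsub>monoid_algebra S f e\<^esub> v \<in> carrier (monoid_algebra S f e)"
proof -
  interpret F: complex_space "monoid_algebra S f e" by (rule monoid_algebra_space)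
  note add_closed = F.a_closed[unfolded monoid_algebra_simps(2)]
  note zero_closed = F.zero_closed[unfolded monoid_algebra_simps(3)]
  show ?thesis using assms(2)
  proof (induct rule: monoid_algebra_induct)
    case (single x c)
    show ?case using assms(3)
      by (induct rule: monoid_algebra_induct)
        (auto simp: monoid_algebra_mult_add assms(1) single intro: zero_closed add_closed)
  qed (auto simp: monoid_algebra_add_mult intro: zero_closed add_closed)
qed

text \<open>Both sides of each law are additive in every argument, so the laws of f on S suffice;
  they are transferred by nested inductions over single terms.\<close>

lemma monoid_algebra_algebra:
  assumes e: "e \<in> S" and closed: "\<And>x y. x \<in> S \<Longrightarrow> y \<in> S \<Longrightarrow> f x y \<in> S"
    and assoc: "\<And>x y z. x \<in> S \<Longrightarrow> y \<in> S \<Longrightarrow> z \<in> S \<Longrightarrow> f (f x y) z = f x (f y z)"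
    and unit: "\<And>x. x \<in> S \<Longrightarrow> f e x = x" "\<And>x. x \<in> S \<Longrightarrow> f x e = x"
  shows "complex_algebra (monoid_algebra S f e)" (is "complex_algebra ?F")
proof (rule complex_algebraI[OF monoid_algebra_space])
  interpret F: complex_space ?F by (rule monoid_algebra_space)
  have assoc': "(x \<otimes>\<^bsub>?F\<^esub> y) \<otimes>\<^bsub>?F\<^esub> z = x \<otimes>\<^bsub>?F\<^esub> (y \<otimes>\<^bsub>?F\<^esub> z)"
    if "x \<in> carrier ?F" "y \<in> carrier ?F" "z \<in> carrier ?F" for x y z
    using that(1)
  proof (induct rule: monoid_algebra_induct)
    case (single x1 c)
    show ?case using that(2)
    proof (induct rule: monoid_algebra_induct)
      case (single y1 d)
      show ?case using that(3)
        by (induct rule: monoid_algebra_induct)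
          (auto simp: monoid_algebra_mult_add assoc \<open>x1 \<in> S\<close> \<open>y1 \<in> S\<close> mult.assoc)
    qed (auto simp: monoid_algebra_mult_add monoid_algebra_add_mult)
  qed (auto simp: monoid_algebra_add_mult)
  have unit': "\<one>\<^bsub>?F\<^esub> \<otimes>\<^bsub>?F\<^esub> x = x" "x \<otimes>\<^bsub>?F\<^esub> \<one>\<^bsub>?F\<^esub> = x" if "x \<in> carrier ?F" for x
    using that by (induct rule: monoid_algebra_induct)
      (auto simp: monoid_algebra_mult_add monoid_algebra_add_mult monoid_algebra_simps unit)
  show "ring ?F"
  proof (rule ringI)
    show "abelian_group ?F" by (rule F.abelian_group_axioms)
    show "monoid ?F"
    proof (rule monoidI)
      show "\<one>\<^bsub>?F\<^esub> \<in> carrier ?F" using e by (simp add: monoid_algebra_simps)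
    qed (simp_all only: assoc' unit' monoid_algebra_mult_closed closed)
  qed (auto simp: monoid_algebra_simps(2) monoid_algebra_add_mult monoid_algebra_mult_add)
qed (auto simp: monoid_algebra_simps(5) monoid_algebra_smult_mult monoid_algebra_mult_smult)

lemma complex_quotientI:
  "complex_space V \<Longrightarrow> submodule N complex_ring V \<Longrightarrow> complex_quotient V N"
  by (simp add: complex_quotient_def complex_quotient_axioms_def)

text \<open>The product is that of the ring quotient and needs an ideal, whereas the scalar action
  needs a subspace; the two descriptions of N meet here.\<close>

lemma quotient_algebra:
  assumes V: "complex_algebra V" and N: "ideal N V" and sub: "submodule N complex_ring V"
  shows "complex_algebra (quotient_module V N)"
    and "\<And>x y. x \<in> carrier V \<Longrightarrow> y \<in> carrier V \<Longrightarrow>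
      (N +>\<^bsub>V\<^esub> x) \<otimes>\<^bsub>quotient_module V N\<^esub> (N +>\<^bsub>V\<^esub> y) = N +>\<^bsub>V\<^esub> (x \<otimes>\<^bsub>V\<^esub> y)"
    and "\<one>\<^bsub>quotient_module V N\<^esub> = N +>\<^bsub>V\<^esub> \<one>\<^bsub>V\<^esub>"
proof -
  interpret V: complex_algebra V by fact
  interpret N: ideal N V by fact
  interpret Q: complex_quotient V N by (rule complex_quotientI) (rule V.complex_space sub)+
  let ?Q = "quotient_module V N"
  interpret Qs: complex_space ?Q by (rule Q.quotient_space)
  show mult: "(N +>\<^bsub>V\<^esub> x) \<otimes>\<^bsub>?Q\<^esub> (N +>\<^bsub>V\<^esub> y) = N +>\<^bsub>V\<^esub> (x \<otimes>\<^bsub>V\<^esub> y)"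
    if "x \<in> carrier V" "y \<in> carrier V" for x y
    using N.rcoset_mult_add[OF that]
    by (simp add: quotient_module_def ring.defs module.defs FactRing_def)
  show one: "\<one>\<^bsub>?Q\<^esub> = N +>\<^bsub>V\<^esub> \<one>\<^bsub>V\<^esub>"
    by (simp add: quotient_module_def ring.defs module.defs FactRing_def)
  show "complex_algebra ?Q"
  proof (rule complex_algebraI[OF Q.quotient_space])
    show "ring ?Q"
    proof (rule ringI)
      show "abelian_group ?Q" by (rule Qs.abelian_group_axioms)
      show "monoid ?Q"
        by (rule monoidI) (auto elim!: Q.carrier_quotientE simp: mult one V.m_assoc)
    qed (auto elim!: Q.carrier_quotientE simp: mult Q.quotient_add V.l_distr V.r_distr)
  qed (auto elim!: Q.carrier_quotientE
      simp: mult Q.quotient_smult V.smult_mult_left V.smult_mult_right)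
qed

text \<open>The descent principle on which every later construction rests: once the linear extension
  kills N, any representative may be used to compute.\<close>

lemma induced_map_coset:
  assumes W: "complex_space W" and g: "g \<in> S \<rightarrow> carrier W"
    and sub: "submodule N complex_ring (monoid_algebra S f e)"
    and null: "\<And>n. n \<in> N \<Longrightarrow> linear_extension W g n = \<zero>\<^bsub>W\<^esub>"
    and u: "u \<in> carrier (monoid_algebra S f e)"
  shows "induced_map W g (N +>\<^bsub>monoid_algebra S f e\<^esub> u) = linear_extension W g u"
proof -
  interpret Q: complex_quotient "monoid_algebra S f e" N
    by (rule complex_quotientI[OF monoid_algebra_space sub])
  show ?thesis
    unfolding induced_map_def
    by (subst Q.image_coset[OF W linear_extension_linear[OF W g] null u]) simp_all
qed

lemma induced_map_linear:
  assumes W: "complex_space W" and g: "g \<in> S \<rightarrow> carrier W"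
    and sub: "submodule N complex_ring (monoid_algebra S f e)"
    and null: "\<And>n. n \<in> N \<Longrightarrow> linear_extension W g n = \<zero>\<^bsub>W\<^esub>"
  shows "linear_map (quotient_module (monoid_algebra S f e) N) W (induced_map W g)"
proof -
  interpret Q: complex_quotient "monoid_algebra S f e" N
    by (rule complex_quotientI[OF monoid_algebra_space sub])
  note lin = linear_mapD[OF linear_extension_linear[OF W g]]
  note coset = induced_map_coset[OF W g sub null]
  show ?thesis
    by (rule linear_mapI)
      (auto elim!: Q.carrier_quotientE simp: Q.quotient_add Q.quotient_smult coset lin)
qed

lemma map_scale_minus_one: "u + scale (- 1) v = u - v"
  for v :: "'x \<Rightarrow>\<^sub>0 complex"
  by (rule poly_mapping_eqI) (simp add: lookup_add lookup_minus)

lemma monoid_algebra_minus: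
  assumes "u \<in> carrier (monoid_algebra S f e)" "v \<in> carrier (monoid_algebra S f e)"
  shows "u \<ominus>\<^bsub>monoid_algebra S f e\<^esub> v = u - v"
proof -
  interpret F: complex_space "monoid_algebra S f e" by (rule monoid_algebra_space)
  show ?thesis
    using F.minus_eq_smult[OF assms] by (simp add: monoid_algebra_simps map_scale_minus_one)
qed

lemma monoid_algebra_diff_closed:
  assumes "u \<in> carrier (monoid_algebra S f e)" "v \<in> carrier (monoid_algebra S f e)"
  shows "u - v \<in> carrier (monoid_algebra S f e)"
proof -
  interpret F: complex_space "monoid_algebra S f e" by (rule monoid_algebra_space)
  show ?thesis
    using monoid_algebra_minus[OF assms] F.minus_closed[OF assms] by simp
qed

lemma monoid_algebra_mult_diff:
  "v \<otimes>\<^bsub>monoid_algebra S f e\<^esub> (u - u')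
    = v \<otimes>\<^bsub>monoid_algebra S f e\<^esub> u - v \<otimes>\<^bsub>monoid_algebra S f e\<^esub> u'"
  "(u - u') \<otimes>\<^bsub>monoid_algebra S f e\<^esub> v
    = u \<otimes>\<^bsub>monoid_algebra S f e\<^esub> v - u' \<otimes>\<^bsub>monoid_algebra S f e\<^esub> v"
  by (simp_all add: map_scale_minus_one[symmetric] monoid_algebra_mult_add
      monoid_algebra_add_mult monoid_algebra_mult_smult monoid_algebra_smult_mult)

lemma linear_extension_diff:
  assumes W: "complex_space W" and g: "g \<in> S \<rightarrow> carrier W"
    and "keys u \<subseteq> S" "keys v \<subseteq> S"
  shows "linear_extension W g (u - v) = linear_extension W g u \<ominus>\<^bsub>W\<^esub> linear_extension W g v"
  using linear_map_minus[OF monoid_algebra_space W linear_extension_linear[OF W g], of u undefined undefined v]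
    monoid_algebra_minus[of u S undefined undefined v] assms(3,4)
  by (simp add: monoid_algebra_simps)

section \<open>Tensor products\<close>

definition bilinear_map ::
    "(complex, 'v, 'm) module_scheme \<Rightarrow> (complex, 'w, 'n) module_scheme
      \<Rightarrow> (complex, 'u, 'k) module_scheme \<Rightarrow> ('v \<Rightarrow> 'w \<Rightarrow> 'u) \<Rightarrow> bool"
  where "bilinear_map V W U h \<longleftrightarrow>
    (\<forall>y\<in>carrier W. linear_map V U (\<lambda>x. h x y)) \<and> (\<forall>x\<in>carrier V. linear_map W U (h x))"

lemma bilinear_mapI:
  assumes "\<And>y. y \<in> carrier W \<Longrightarrow> linear_map V U (\<lambda>x. h x y)"
    and "\<And>x. x \<in> carrier V \<Longrightarrow> linear_map W U (h x)"
  shows "bilinear_map V W U h"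
  using assms by (simp add: bilinear_map_def)

lemma bilinear_mapD:
  assumes "bilinear_map V W U h"
  shows "y \<in> carrier W \<Longrightarrow> linear_map V U (\<lambda>x. h x y)"
    and "x \<in> carrier V \<Longrightarrow> linear_map W U (h x)"
  using assms by (simp_all add: bilinear_map_def)

lemma free_pairs_space: "complex_space (free_pairs V W)"
  unfolding free_pairs_def by (rule monoid_algebra_space)

lemma single_in_free_pairs:
  "x \<in> carrier V \<Longrightarrow> y \<in> carrier W \<Longrightarrow> single (x, y) c \<in> carrier (free_pairs V W)"
  by (simp add: free_pairs_def)

locale tensor_product = V: complex_space V + W: complex_space W
  for V :: "(complex, 'v, 'm) module_scheme" and W :: "(complex, 'w, 'n) module_scheme"
begin

lemma relators_carrier: "bilinear_relators V W \<subseteq> carrier (free_pairs V W)"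
  unfolding bilinear_relators_def free_pairs_def
  by (auto intro!: monoid_algebra_diff_closed single_in_monoid_algebra)

lemma null_subspace: "submodule (tensor_null V W) complex_ring (free_pairs V W)"
proof -
  interpret F: complex_space "free_pairs V W" by (rule free_pairs_space)
  show ?thesis
    unfolding tensor_null_def by (rule F.cspan_subspace[OF relators_carrier])
qed

sublocale Q: complex_quotient "free_pairs V W" "tensor_null V W"
  by (rule complex_quotientI[OF free_pairs_space null_subspace])

lemma tensor_space: "complex_space (tensor V W)"
  unfolding tensor_def by (rule Q.quotient_space)

sublocale T: complex_space "tensor V W"
  by (rule tensor_space)

lemma relator_null: "r \<in> bilinear_relators V W \<Longrightarrow> r \<in> tensor_null V W"
  unfolding tensor_null_def by (rule Q.cspan_incl)

lemma pure_closed [simp, intro]: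
  "x \<in> carrier V \<Longrightarrow> y \<in> carrier W \<Longrightarrow> pure_tensor V W x y \<in> carrier (tensor V W)"
  unfolding pure_tensor_def tensor_def
  by (rule Q.coset_closed) (rule single_in_free_pairs)

text \<open>Each of the four bilinearity rules that follow is witnessed by exactly one relator, so
  no combination of relators ever has to be found.\<close>

lemma coset_eqI:
  assumes "u - v \<in> bilinear_relators V W" "u \<in> carrier (free_pairs V W)" "v \<in> carrier (free_pairs V W)"
  shows "tensor_null V W +>\<^bsub>free_pairs V W\<^esub> u = tensor_null V W +>\<^bsub>free_pairs V W\<^esub> v"
proof (subst Q.coset_eq_iff[OF assms(2,3)])
  show "u \<ominus>\<^bsub>free_pairs V W\<^esub> v \<in> tensor_null V W"
    using relator_null[OF assms(1)] assms(2,3) unfolding free_pairs_def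
    by (simp add: monoid_algebra_minus)
qed

lemma coset_single:
  assumes "x \<in> carrier V" "y \<in> carrier W"
  shows "tensor_null V W +>\<^bsub>free_pairs V W\<^esub> single (x, y) c = c \<odot>\<^bsub>tensor V W\<^esub> pure_tensor V W x y"
proof -
  have "single (x, y) c = c \<odot>\<^bsub>free_pairs V W\<^esub> single (x, y) 1"
    by (simp add: free_pairs_def monoid_algebra_simps)
  then show ?thesis
    unfolding pure_tensor_def tensor_def
    using Q.quotient_smult[OF single_in_free_pairs[OF assms]] by simp
qed

lemma coset_single_add:
  assumes "x \<in> carrier V" "y \<in> carrier W" "x' \<in> carrier V" "y' \<in> carrier W"
  shows "single (x, y) 1 + single (x', y') 1 \<in> carrier (free_pairs V W)"
    and "tensor_null V W +>\<^bsub>free_pairs V W\<^esub> (single (x, y) 1 + single (x', y') 1)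
      = pure_tensor V W x y \<oplus>\<^bsub>tensor V W\<^esub> pure_tensor V W x' y'"
  using Q.a_closed[OF single_in_free_pairs single_in_free_pairs, OF assms]
    Q.quotient_add[OF single_in_free_pairs single_in_free_pairs, OF assms, of 1 1]
  unfolding pure_tensor_def tensor_def by (simp_all add: free_pairs_def monoid_algebra_simps)

lemma pure_add_left:
  assumes "x \<in> carrier V" "x' \<in> carrier V" "y \<in> carrier W"
  shows "pure_tensor V W (x \<oplus>\<^bsub>V\<^esub> x') y = pure_tensor V W x y \<oplus>\<^bsub>tensor V W\<^esub> pure_tensor V W x' y"
  unfolding coset_single_add(2)[OF assms(1,3,2,3), symmetric] pure_tensor_def[of _ _ "_ \<oplus>\<^bsub>V\<^esub> _"]
  by (rule coset_eqI)
    (use assms in \<open>auto simp: bilinear_relators_def single_in_free_pairs coset_single_add(1) diff_diff_eq[symmetric]\<close>)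

lemma pure_add_right:
  assumes "x \<in> carrier V" "y \<in> carrier W" "y' \<in> carrier W"
  shows "pure_tensor V W x (y \<oplus>\<^bsub>W\<^esub> y') = pure_tensor V W x y \<oplus>\<^bsub>tensor V W\<^esub> pure_tensor V W x y'"
  unfolding coset_single_add(2)[OF assms(1,2,1,3), symmetric] pure_tensor_def[of _ _ _ "_ \<oplus>\<^bsub>W\<^esub> _"]
  by (rule coset_eqI)
    (use assms in \<open>auto simp: bilinear_relators_def single_in_free_pairs coset_single_add(1) diff_diff_eq[symmetric]\<close>)

lemma pure_smult_left:
  assumes "x \<in> carrier V" "y \<in> carrier W"
  shows "pure_tensor V W (c \<odot>\<^bsub>V\<^esub> x) y = c \<odot>\<^bsub>tensor V W\<^esub> pure_tensor V W x y"
  unfolding coset_single[OF assms, symmetric] pure_tensor_def[of _ _ "_ \<odot>\<^bsub>V\<^esub> _"]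
  by (rule coset_eqI) (use assms in \<open>auto simp: bilinear_relators_def single_in_free_pairs\<close>)

lemma pure_smult_right:
  assumes "x \<in> carrier V" "y \<in> carrier W"
  shows "pure_tensor V W x (c \<odot>\<^bsub>W\<^esub> y) = c \<odot>\<^bsub>tensor V W\<^esub> pure_tensor V W x y"
  unfolding coset_single[OF assms, symmetric] pure_tensor_def[of _ _ _ "_ \<odot>\<^bsub>W\<^esub> _"]
  by (rule coset_eqI) (use assms in \<open>auto simp: bilinear_relators_def single_in_free_pairs\<close>)

lemma pure_zero_right: "x \<in> carrier V \<Longrightarrow> pure_tensor V W x \<zero>\<^bsub>W\<^esub> = \<zero>\<^bsub>tensor V W\<^esub>"
  using pure_smult_right[of x "\<zero>\<^bsub>W\<^esub>" 0] by simp

text \<open>No case for zero or for scalars is needed: zero is the pure tensor of two zeros, and a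
  scalar in front of a pure tensor can be absorbed in the left leg.\<close>

lemma tensor_induct [consumes 1, case_names pure add]:
  assumes t: "t \<in> carrier (tensor V W)"
    and pure: "\<And>x y. x \<in> carrier V \<Longrightarrow> y \<in> carrier W \<Longrightarrow> P (pure_tensor V W x y)"
    and add: "\<And>s t. s \<in> carrier (tensor V W) \<Longrightarrow> t \<in> carrier (tensor V W) \<Longrightarrow> P s \<Longrightarrow> P t
      \<Longrightarrow> P (s \<oplus>\<^bsub>tensor V W\<^esub> t)"
  shows "P t"
proof -
  let ?C = "\<lambda>u. tensor_null V W +>\<^bsub>free_pairs V W\<^esub> u"
  obtain u where u: "u \<in> carrier (free_pairs V W)" "t = ?C u"
    using t unfolding tensor_def by (elim Q.carrier_quotientE)
  have "P (?C u)"
    using u(1) unfolding free_pairs_def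
  proof (induct rule: monoid_algebra_induct)
    case zero
    have "?C 0 = \<zero>\<^bsub>tensor V W\<^esub>"
      using Q.quotient_zero by (simp add: tensor_def free_pairs_def monoid_algebra_simps)
    then show ?case
      using pure_zero_right[of "\<zero>\<^bsub>V\<^esub>"] pure[of "\<zero>\<^bsub>V\<^esub>" "\<zero>\<^bsub>W\<^esub>"]
      by (simp add: free_pairs_def)
  next
    case (single p c)
    obtain x y where p: "p = (x, y)" "x \<in> carrier V" "y \<in> carrier W" using single by auto
    have "?C (single p c) = pure_tensor V W (c \<odot>\<^bsub>V\<^esub> x) y"
      using coset_single[OF p(2,3)] pure_smult_left[OF p(2,3)] p(1) by simp
    then show ?case using pure[of "c \<odot>\<^bsub>V\<^esub> x" y] p by (simp add: free_pairs_def)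
  next
    case (add u v)
    have "?C (u + v) = ?C u \<oplus>\<^bsub>tensor V W\<^esub> ?C v"
      using Q.quotient_add[of u v] add(1,2)
      by (simp add: tensor_def free_pairs_def monoid_algebra_simps)
    moreover have "?C u \<in> carrier (tensor V W)" "?C v \<in> carrier (tensor V W)"
      using Q.coset_closed add(1,2) by (simp_all add: tensor_def free_pairs_def)
    ultimately show ?case
      using assms(3)[of "?C u" "?C v"] add(3,4) by (simp add: free_pairs_def)
  qed
  then show ?thesis using u by simp
qed

lemma linear_eq_on_pure:
  assumes "linear_map (tensor V W) U f" "linear_map (tensor V W) U g"
    and "\<And>x y. x \<in> carrier V \<Longrightarrow> y \<in> carrier W \<Longrightarrow> f (pure_tensor V W x y) = g (pure_tensor V W x y)"
    and "t \<in> carrier (tensor V W)"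
  shows "f t = g t"
  using assms(4)
  by (induct rule: tensor_induct)
    (simp_all add: assms(3) linear_mapD(2)[OF assms(1)] linear_mapD(2)[OF assms(2)])

text \<open>The universal property. A bilinear map sends each of the four kinds of relators to zero,
  hence its linear extension kills their span.\<close>

lemma
  assumes U: "complex_space U" and h: "bilinear_map V W U h"
  shows lift_null: "\<And>n. n \<in> tensor_null V W \<Longrightarrow> linear_extension U (\<lambda>(x, y). h x y) n = \<zero>\<^bsub>U\<^esub>"
    and lift_linear: "linear_map (tensor V W) U (induced_map U (\<lambda>(x, y). h x y))"
    and lift_pure: "\<And>x y. x \<in> carrier V \<Longrightarrow> y \<in> carrier W
      \<Longrightarrow> induced_map U (\<lambda>(x, y). h x y) (pure_tensor V W x y) = h x y"
proof -
  let ?g = "\<lambda>(x, y). h x y"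
  let ?S = "carrier V \<times> carrier W"
  interpret U: complex_space U by fact
  note hl = linear_mapD[OF bilinear_mapD(1)[OF h]] and hr = linear_mapD[OF bilinear_mapD(2)[OF h]]
  have g: "?g \<in> ?S \<rightarrow> carrier U" using hl(1) by auto
  have lin: "linear_map (free_pairs V W) U (linear_extension U ?g)"
    unfolding free_pairs_def by (rule linear_extension_linear[OF U g])
  have diff: "linear_extension U ?g (u - v) = linear_extension U ?g u \<ominus>\<^bsub>U\<^esub> linear_extension U ?g v"
    if "keys u \<subseteq> ?S" "keys v \<subseteq> ?S" for u v
    by (rule linear_extension_diff[OF U g that])
  have keys_diff: "keys (u - v) \<subseteq> ?S"
    if "keys u \<subseteq> ?S" "keys v \<subseteq> ?S" for u v :: "'v \<times> 'w \<Rightarrow>\<^sub>0 complex"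
    using monoid_algebra_diff_closed[of u ?S undefined undefined v] that
    by (simp add: monoid_algebra_simps)
  have single: "linear_extension U ?g (single (x, y) c) = c \<odot>\<^bsub>U\<^esub> h x y"
    if "x \<in> carrier V" "y \<in> carrier W" for x y c
    using linear_extension_single[OF U, of ?g "(x, y)" c] hl(1) that by simp
  have cancel: "x \<in> carrier U \<Longrightarrow> y \<in> carrier U \<Longrightarrow> (x \<oplus>\<^bsub>U\<^esub> y) \<ominus>\<^bsub>U\<^esub> x \<ominus>\<^bsub>U\<^esub> y = \<zero>\<^bsub>U\<^esub>"
    "x \<in> carrier U \<Longrightarrow> x \<ominus>\<^bsub>U\<^esub> x = \<zero>\<^bsub>U\<^esub>" for x y
    by (simp_all add: a_minus_def U.a_assoc U.a_comm[of x] U.r_neg U.r_neg1)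
  show null: "linear_extension U ?g n = \<zero>\<^bsub>U\<^esub>" if n: "n \<in> tensor_null V W" for n
  proof -
    have "linear_extension U ?g n = (\<lambda>_. \<zero>\<^bsub>U\<^esub>) n"
    proof (rule linear_map_eq_on_cspan[OF free_pairs_space U lin linear_map_null[OF U] relators_carrier _ n[unfolded tensor_null_def]])
      show "linear_extension U ?g r = \<zero>\<^bsub>U\<^esub>" if "r \<in> bilinear_relators V W" for r
        using that unfolding bilinear_relators_def
        by (auto simp: diff keys_diff single hl hr cancel)
    qed
    then show ?thesis by simp
  qed
  show "linear_map (tensor V W) U (induced_map U ?g)"
    unfolding tensor_def free_pairs_def
    by (rule induced_map_linear[OF U g null_subspace[unfolded free_pairs_def] null])
  show "induced_map U ?g (pure_tensor V W x y) = h x y" if "x \<in> carrier V" "y \<in> carrier W" for x y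
    unfolding pure_tensor_def free_pairs_def
    by (subst induced_map_coset[OF U g null_subspace[unfolded free_pairs_def] null])
      (use that hl(1) in \<open>auto simp: single\<close>)
qed

end

lemma tensor_productI: "complex_space V \<Longrightarrow> complex_space W \<Longrightarrow> tensor_product V W"
  by (simp add: tensor_product_def)

lemma
  assumes "complex_space V" "complex_space W" "complex_space V'" "complex_space W'"
    and f: "linear_map V V' f" and g: "linear_map W W' g"
  shows tensor_map_linear: "linear_map (tensor V W) (tensor V' W') (tensor_map V' W' f g)"
    and tensor_map_pure: "\<And>x y. x \<in> carrier V \<Longrightarrow> y \<in> carrier W
      \<Longrightarrow> tensor_map V' W' f g (pure_tensor V W x y) = pure_tensor V' W' (f x) (g y)"
proof -
  interpret T: tensor_product V W by (rule tensor_productI) fact+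
  interpret T': tensor_product V' W' by (rule tensor_productI) fact+
  have b: "bilinear_map V W (tensor V' W') (\<lambda>x y. pure_tensor V' W' (f x) (g y))"
    by (intro bilinear_mapI linear_mapI)
      (auto simp: linear_mapD[OF f] linear_mapD[OF g] T'.pure_add_left T'.pure_add_right
        T'.pure_smult_left T'.pure_smult_right)
  show "linear_map (tensor V W) (tensor V' W') (tensor_map V' W' f g)"
    unfolding tensor_map_def by (rule T.lift_linear[OF T'.tensor_space b])
  show "tensor_map V' W' f g (pure_tensor V W x y) = pure_tensor V' W' (f x) (g y)"
    if "x \<in> carrier V" "y \<in> carrier W" for x y
    unfolding tensor_map_def by (rule T.lift_pure[OF T'.tensor_space b that])
qed

text \<open>\<open>tensor_map2\<close> is a lift inside a lift. The inner one is linear in the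
  second tensor by construction and depends bilinearly on the legs of the first, which can be tested
  on pure second tensors; this allows the outer lift.\<close>

lemma
  assumes sp: "complex_space V1" "complex_space W1" "complex_space V2" "complex_space W2"
      "complex_space V" "complex_space W"
    and f: "bilinear_map V1 V2 V f" and g: "bilinear_map W1 W2 W g"
  shows tensor_map2_bilinear:
      "bilinear_map (tensor V1 W1) (tensor V2 W2) (tensor V W) (tensor_map2 V W f g)"
    and tensor_map2_pure: "\<And>x y x' y'. x \<in> carrier V1 \<Longrightarrow> y \<in> carrier W1 \<Longrightarrow> x' \<in> carrier V2
      \<Longrightarrow> y' \<in> carrier W2 \<Longrightarrow>
      tensor_map2 V W f g (pure_tensor V1 W1 x y) (pure_tensor V2 W2 x' y')
        = pure_tensor V W (f x x') (g y y')"
proof -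
  interpret T1: tensor_product V1 W1 by (rule tensor_productI) fact+
  interpret T2: tensor_product V2 W2 by (rule tensor_productI) fact+
  interpret T: tensor_product V W by (rule tensor_productI) fact+
  note fl = linear_mapD[OF bilinear_mapD(1)[OF f]] and fr = linear_mapD[OF bilinear_mapD(2)[OF f]]
  note gl = linear_mapD[OF bilinear_mapD(1)[OF g]] and gr = linear_mapD[OF bilinear_mapD(2)[OF g]]
  note pure = T.pure_add_left T.pure_add_right T.pure_smult_left T.pure_smult_right
  define h where "h x y = induced_map (tensor V W) (\<lambda>(x', y'). pure_tensor V W (f x x') (g y y'))" for x y
  have b: "bilinear_map V2 W2 (tensor V W) (\<lambda>x' y'. pure_tensor V W (f x x') (g y y'))"
    if "x \<in> carrier V1" "y \<in> carrier W1" for x y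
    by (intro bilinear_mapI linear_mapI) (use that in \<open>auto simp: fl fr gl gr pure\<close>)
  have h_lin: "linear_map (tensor V2 W2) (tensor V W) (h x y)"
    if "x \<in> carrier V1" "y \<in> carrier W1" for x y
    unfolding h_def by (rule T2.lift_linear[OF T.tensor_space b[OF that]])
  have h_pure: "h x y (pure_tensor V2 W2 x' y') = pure_tensor V W (f x x') (g y y')"
    if "x \<in> carrier V1" "y \<in> carrier W1" "x' \<in> carrier V2" "y' \<in> carrier W2" for x y x' y'
    unfolding h_def by (rule T2.lift_pure[OF T.tensor_space b[OF that(1,2)] that(3,4)])
  have h_closed: "h x y t \<in> carrier (tensor V W)"
    if "x \<in> carrier V1" "y \<in> carrier W1" "t \<in> carrier (tensor V2 W2)" for x y t
    using linear_mapD(1)[OF h_lin] that by blast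
  have h_bil: "bilinear_map V1 W1 (tensor V W) (\<lambda>x y. h x y t)" if t: "t \<in> carrier (tensor V2 W2)" for t
  proof (intro bilinear_mapI linear_mapI)
    show "h (x \<oplus>\<^bsub>V1\<^esub> x') y t = h x y t \<oplus>\<^bsub>tensor V W\<^esub> h x' y t"
      if "y \<in> carrier W1" "x \<in> carrier V1" "x' \<in> carrier V1" for x x' y
      by (rule T2.linear_eq_on_pure[OF h_lin linear_map_add[OF h_lin h_lin T.tensor_space] _ t])
        (use that in \<open>auto simp: h_pure fl fr gl gr pure\<close>)
    show "h (c \<odot>\<^bsub>V1\<^esub> x) y t = c \<odot>\<^bsub>tensor V W\<^esub> h x y t" if "y \<in> carrier W1" "x \<in> carrier V1" for c x y
      by (rule T2.linear_eq_on_pure[OF h_lin linear_map_smult[OF h_lin T.tensor_space] _ t])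
        (use that in \<open>auto simp: h_pure fl fr gl gr pure\<close>)
    show "h x (y \<oplus>\<^bsub>W1\<^esub> y') t = h x y t \<oplus>\<^bsub>tensor V W\<^esub> h x y' t"
      if "x \<in> carrier V1" "y \<in> carrier W1" "y' \<in> carrier W1" for x y y'
      by (rule T2.linear_eq_on_pure[OF h_lin linear_map_add[OF h_lin h_lin T.tensor_space] _ t])
        (use that in \<open>auto simp: h_pure fl fr gl gr pure\<close>)
    show "h x (c \<odot>\<^bsub>W1\<^esub> y) t = c \<odot>\<^bsub>tensor V W\<^esub> h x y t" if "x \<in> carrier V1" "y \<in> carrier W1" for c x y
      by (rule T2.linear_eq_on_pure[OF h_lin linear_map_smult[OF h_lin T.tensor_space] _ t])
        (use that in \<open>auto simp: h_pure fl fr gl gr pure\<close>)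
  qed (use t h_closed in auto)
  have map2: "tensor_map2 V W f g s t = induced_map (tensor V W) (\<lambda>(x, y). h x y t) s" for s t
    by (simp add: tensor_map2_def h_def)
  have lin1: "linear_map (tensor V1 W1) (tensor V W) (\<lambda>s. tensor_map2 V W f g s t)"
    if "t \<in> carrier (tensor V2 W2)" for t
    unfolding map2 by (rule T1.lift_linear[OF T.tensor_space h_bil[OF that]])
  have pure1: "tensor_map2 V W f g (pure_tensor V1 W1 x y) t = h x y t"
    if "x \<in> carrier V1" "y \<in> carrier W1" "t \<in> carrier (tensor V2 W2)" for x y t
    unfolding map2 by (rule T1.lift_pure[OF T.tensor_space h_bil[OF that(3)] that(1,2)])
  \<comment> \<open>The outer lift gives linearity in s only. Linearity in the second argument holds
    for pure s and is preserved by sums of such s.\<close>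
  have lin2: "linear_map (tensor V2 W2) (tensor V W) (tensor_map2 V W f g s)"
    if "s \<in> carrier (tensor V1 W1)" for s
    using that
  proof (induct rule: T1.tensor_induct)
    case (pure x y)
    show ?case
      by (rule linear_map_cong[OF h_lin[OF pure] _ T2.tensor_space]) (simp add: pure1 pure)
  next
    case (add s s')
    show ?case
      by (rule linear_map_cong[OF linear_map_add[OF add(3,4) T.tensor_space] _ T2.tensor_space])
        (simp add: linear_mapD(2)[OF lin1] add(1,2))
  qed
  show "bilinear_map (tensor V1 W1) (tensor V2 W2) (tensor V W) (tensor_map2 V W f g)"
    by (intro bilinear_mapI lin1 lin2)
  show "tensor_map2 V W f g (pure_tensor V1 W1 x y) (pure_tensor V2 W2 x' y')
        = pure_tensor V W (f x x') (g y y')"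
    if "x \<in> carrier V1" "y \<in> carrier W1" "x' \<in> carrier V2" "y' \<in> carrier W2" for x y x' y'
    using that by (simp add: pure1 h_pure)
qed

text \<open>Again a lift inside a lift: linearity in the third factor is tested on pure tensors of
  the first two.\<close>

lemma
  assumes sp: "complex_space U" "complex_space V" "complex_space W"
  shows tensor_assoc_linear:
      "linear_map (tensor (tensor U V) W) (tensor U (tensor V W)) (tensor_assoc U V W)"
    and tensor_assoc_pure: "\<And>x y z. x \<in> carrier U \<Longrightarrow> y \<in> carrier V \<Longrightarrow> z \<in> carrier W
      \<Longrightarrow> tensor_assoc U V W (pure_tensor (tensor U V) W (pure_tensor U V x y) z)
        = pure_tensor U (tensor V W) x (pure_tensor V W y z)"
proof -
  interpret UV: tensor_product U V by (rule tensor_productI) fact+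
  interpret VW: tensor_product V W by (rule tensor_productI) fact+
  interpret UVW: tensor_product "tensor U V" W by (rule tensor_productI[OF UV.tensor_space]) fact
  interpret UVW': tensor_product U "tensor V W" by (rule tensor_productI[OF _ VW.tensor_space]) fact
  let ?T = "tensor U (tensor V W)"
  note pure = UVW'.pure_add_left UVW'.pure_add_right UVW'.pure_smult_left UVW'.pure_smult_right
    VW.pure_add_left VW.pure_add_right VW.pure_smult_left VW.pure_smult_right
  define h where "h t z = induced_map ?T
    (\<lambda>(x, y). pure_tensor U (tensor V W) x (pure_tensor V W y z)) t" for t z
  have b: "bilinear_map U V ?T (\<lambda>x y. pure_tensor U (tensor V W) x (pure_tensor V W y z))"
    if "z \<in> carrier W" for z
    by (intro bilinear_mapI linear_mapI) (use that in \<open>auto simp: pure\<close>)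
  have h_lin: "linear_map (tensor U V) ?T (\<lambda>t. h t z)" if "z \<in> carrier W" for z
    unfolding h_def by (rule UV.lift_linear[OF UVW'.tensor_space b[OF that]])
  have h_pure: "h (pure_tensor U V x y) z = pure_tensor U (tensor V W) x (pure_tensor V W y z)"
    if "x \<in> carrier U" "y \<in> carrier V" "z \<in> carrier W" for x y z
    unfolding h_def by (rule UV.lift_pure[OF UVW'.tensor_space b[OF that(3)] that(1,2)])
  have h_bil: "bilinear_map (tensor U V) W ?T h"
  proof (intro bilinear_mapI h_lin linear_mapI)
    fix t assume t: "t \<in> carrier (tensor U V)"
    show "h t z \<in> carrier ?T" if "z \<in> carrier W" for z
      using linear_mapD(1)[OF h_lin[OF that] t] .
    show "h t (z \<oplus>\<^bsub>W\<^esub> z') = h t z \<oplus>\<^bsub>?T\<^esub> h t z'" if "z \<in> carrier W" "z' \<in> carrier W" for z z'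
      by (rule UV.linear_eq_on_pure[OF h_lin linear_map_add[OF h_lin h_lin UVW'.tensor_space] _ t])
        (use that in \<open>auto simp: h_pure pure\<close>)
    show "h t (c \<odot>\<^bsub>W\<^esub> z) = c \<odot>\<^bsub>?T\<^esub> h t z" if "z \<in> carrier W" for c z
      by (rule UV.linear_eq_on_pure[OF h_lin linear_map_smult[OF h_lin UVW'.tensor_space] _ t])
        (use that in \<open>auto simp: h_pure pure\<close>)
  qed
  have assoc: "tensor_assoc U V W = induced_map ?T (\<lambda>(t, z). h t z)"
    by (simp add: tensor_assoc_def h_def)
  show "linear_map (tensor (tensor U V) W) ?T (tensor_assoc U V W)"
    unfolding assoc by (rule UVW.lift_linear[OF UVW'.tensor_space h_bil])
  show "tensor_assoc U V W (pure_tensor (tensor U V) W (pure_tensor U V x y) z)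
        = pure_tensor U (tensor V W) x (pure_tensor V W y z)"
    if "x \<in> carrier U" "y \<in> carrier V" "z \<in> carrier W" for x y z
    unfolding assoc
    using UVW.lift_pure[OF UVW'.tensor_space h_bil UV.pure_closed[OF that(1,2)] that(3)] h_pure[OF that]
    by simp
qed

text \<open>The point is that the span of the relators is a two-sided ideal of the free algebra on
  pairs. Multiplication by one pair, followed by the passage to cosets, extends a bilinear map and
  therefore annihilates that span.\<close>

lemma
  assumes "complex_algebra V" "complex_algebra W"
  shows tensor_algebra: "complex_algebra (tensor V W)"
    and tensor_mult_pure: "\<And>x y x' y'. x \<in> carrier V \<Longrightarrow> y \<in> carrier W \<Longrightarrow> x' \<in> carrier V
      \<Longrightarrow> y' \<in> carrier W \<Longrightarrow> pure_tensor V W x y \<otimes>\<^bsub>tensor V W\<^esub> pure_tensor V W x' y'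
        = pure_tensor V W (x \<otimes>\<^bsub>V\<^esub> x') (y \<otimes>\<^bsub>W\<^esub> y')"
    and tensor_one: "\<one>\<^bsub>tensor V W\<^esub> = pure_tensor V W \<one>\<^bsub>V\<^esub> \<one>\<^bsub>W\<^esub>"
proof -
  interpret V: complex_algebra V by fact
  interpret W: complex_algebra W by fact
  interpret T: tensor_product V W by (rule tensor_productI) (rule V.complex_space W.complex_space)+
  let ?F = "free_pairs V W" and ?N = "tensor_null V W"
  have F: "complex_algebra ?F"
    unfolding free_pairs_def
    by (rule monoid_algebra_algebra) (auto simp: V.m_assoc W.m_assoc)
  interpret F: complex_algebra ?F by (rule F)
  have mult: "single (x, y) c \<otimes>\<^bsub>?F\<^esub> single (x', y') d
      = single (x \<otimes>\<^bsub>V\<^esub> x', y \<otimes>\<^bsub>W\<^esub> y') (c * d)" for x y x' y' c d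
    by (simp add: free_pairs_def)
  let ?T = "tensor V W" and ?C = "\<lambda>u. ?N +>\<^bsub>?F\<^esub> u"
  have C: "linear_map ?F ?T ?C" unfolding tensor_def by (rule T.Q.coset_linear)
  have single_null: "single (p, s) c \<otimes>\<^bsub>?F\<^esub> n \<in> ?N \<and> n \<otimes>\<^bsub>?F\<^esub> single (p, s) c \<in> ?N"
    if n: "n \<in> ?N" and p: "p \<in> carrier V" "s \<in> carrier W" for n p s c
  proof -
    let ?l = "\<lambda>x y. c \<odot>\<^bsub>?T\<^esub> pure_tensor V W (p \<otimes>\<^bsub>V\<^esub> x) (s \<otimes>\<^bsub>W\<^esub> y)"
      and ?r = "\<lambda>x y. c \<odot>\<^bsub>?T\<^esub> pure_tensor V W (x \<otimes>\<^bsub>V\<^esub> p) (y \<otimes>\<^bsub>W\<^esub> s)"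
    note lin = V.l_distr V.r_distr W.l_distr W.r_distr V.smult_mult_left V.smult_mult_right
      W.smult_mult_left W.smult_mult_right T.pure_add_left T.pure_add_right
      T.pure_smult_left T.pure_smult_right T.T.smult_add mult.commute
    have b: "bilinear_map V W ?T ?l" "bilinear_map V W ?T ?r"
      by (intro bilinear_mapI linear_mapI; use p in \<open>simp add: lin\<close>)+
    have nF: "n \<in> carrier ?F" and sF: "single (p, s) c \<in> carrier ?F"
      using n T.Q.N_sub p by (auto intro: single_in_free_pairs)
    have E: "linear_map ?F ?T (linear_extension ?T (\<lambda>(x, y). h x y))" if "bilinear_map V W ?T h" for h
      unfolding free_pairs_def
      by (rule linear_extension_linear[OF T.tensor_space])
        (use linear_mapD(1)[OF bilinear_mapD(1)[OF that]] in auto)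
    have M: "linear_map ?F ?F (\<lambda>u. single (p, s) c \<otimes>\<^bsub>?F\<^esub> u)" "linear_map ?F ?F (\<lambda>u. u \<otimes>\<^bsub>?F\<^esub> single (p, s) c)"
      by (intro linear_mapI; use sF in \<open>simp add: F.l_distr F.r_distr F.smult_mult_left F.smult_mult_right\<close>)+
    note eq = linear_map_eq_on_singles[OF T.tensor_space _ _ _ nF[unfolded free_pairs_def],
        folded free_pairs_def]
    note ext = linear_extension_single[OF T.tensor_space]
    \<comment> \<open>Both sides are linear in n and agree on single pairs. The right-hand side
      vanishes for n in the null space by \<open>lift_null\<close>.\<close>
    have "?C (single (p, s) c \<otimes>\<^bsub>?F\<^esub> n) = linear_extension ?T (\<lambda>(x, y). ?l x y) n"
      by (rule eq[OF linear_map_comp[OF M(1) C] E[OF b(1)]])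
        (use p in \<open>auto simp: mult T.coset_single ext mult.commute\<close>)
    moreover have "?C (n \<otimes>\<^bsub>?F\<^esub> single (p, s) c) = linear_extension ?T (\<lambda>(x, y). ?r x y) n"
      by (rule eq[OF linear_map_comp[OF M(2) C] E[OF b(2)]])
        (use p in \<open>auto simp: mult T.coset_single ext mult.commute\<close>)
    ultimately show ?thesis
      using T.lift_null[OF T.tensor_space b(1) n] T.lift_null[OF T.tensor_space b(2) n]
        T.Q.coset_eq_zero_iff[OF F.m_closed[OF sF nF]] T.Q.coset_eq_zero_iff[OF F.m_closed[OF nF sF]]
      by (simp add: tensor_def)
  qed
  \<comment> \<open>Arbitrary multipliers are sums of single pairs, and the null space is closed
    under addition.\<close>
  have null: "u \<otimes>\<^bsub>?F\<^esub> n \<in> ?N \<and> n \<otimes>\<^bsub>?F\<^esub> u \<in> ?N" if n: "n \<in> ?N" and u: "u \<in> carrier ?F" for n u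
    using u unfolding free_pairs_def
  proof (induct rule: monoid_algebra_induct)
    case zero
    then show ?case using T.Q.N_zero by (simp add: free_pairs_def monoid_algebra_simps)
  next
    case (single x c)
    then show ?case using single_null[OF n] by (auto simp: free_pairs_def)
  next
    case (add u v)
    then show ?case
      using T.Q.N_add[of "n \<otimes>\<^bsub>?F\<^esub> u" "n \<otimes>\<^bsub>?F\<^esub> v"] T.Q.N_add[of "u \<otimes>\<^bsub>?F\<^esub> n" "v \<otimes>\<^bsub>?F\<^esub> n"]
      by (simp add: free_pairs_def monoid_algebra_simps monoid_algebra_add_mult monoid_algebra_mult_add)
  qed
  have N: "ideal ?N ?F"
    by (rule idealI[OF F.ring_axioms submodule.axioms(1)[OF T.null_subspace]]) (use null in auto)
  note Q = quotient_algebra[OF F N T.null_subspace]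
  show "complex_algebra (tensor V W)" unfolding tensor_def by (rule Q(1))
  show "\<one>\<^bsub>tensor V W\<^esub> = pure_tensor V W \<one>\<^bsub>V\<^esub> \<one>\<^bsub>W\<^esub>"
    unfolding tensor_def pure_tensor_def Q(3) by (simp add: free_pairs_def monoid_algebra_simps)
  show "pure_tensor V W x y \<otimes>\<^bsub>tensor V W\<^esub> pure_tensor V W x' y'
        = pure_tensor V W (x \<otimes>\<^bsub>V\<^esub> x') (y \<otimes>\<^bsub>W\<^esub> y')"
    if "x \<in> carrier V" "y \<in> carrier W" "x' \<in> carrier V" "y' \<in> carrier W" for x y x' y'
    unfolding tensor_def pure_tensor_def
    using Q(2)[OF single_in_free_pairs single_in_free_pairs, OF that(1,2,3,4)] by (simp add: mult)
qed

section \<open>Comparing linear combinations by their coefficients\<close>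

text \<open>Coefficients point to vectors by position, and a position may recur. A list can thus
  record an expression literally as normal ordering leaves it, before like terms are
  collected.\<close>

definition (in complex_space) lincomb :: "'a list \<Rightarrow> (complex \<times> nat) list \<Rightarrow> 'a"
  where "lincomb xs l = foldr (\<lambda>(c, i) s. c \<odot> xs ! i \<oplus> s) l \<zero>"

context complex_space
begin

lemma lincomb_simps [simp]:
  "lincomb xs [] = \<zero>" "lincomb xs ((c, i) # l) = c \<odot> xs ! i \<oplus> lincomb xs l"
  by (simp_all add: lincomb_def)

text \<open>Both combinations are images, under one linear extension, of finitely supported
  functions on positions; these functions agree if the total coefficients do. Independence of the
  vectors is not involved.\<close>

lemma lincomb_eqI:
  assumes xs: "set xs \<subseteq> carrier V"
    and l: "snd ` set l \<subseteq> {..<length xs}" and r: "snd ` set r \<subseteq> {..<length xs}"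
    and eq: "\<And>i. i < length xs \<Longrightarrow>
      (\<Sum>(c, j)\<leftarrow>l. if j = i then c else 0) = (\<Sum>(c, j)\<leftarrow>r. if j = i then c else 0)"
  shows "lincomb xs l = lincomb xs r"
proof -
  let ?S = "{..<length xs}" and ?g = "\<lambda>i. xs ! i"
  let ?p = "\<lambda>l :: (complex \<times> nat) list. \<Sum>(c, j)\<leftarrow>l. single j c"
  have V: "complex_space V" by (rule complex_space_axioms)
  have g: "?g \<in> ?S \<rightarrow> carrier V" using xs by auto
  note lin = linear_extension_linear[OF V g, of undefined undefined]
  have keys: "keys (?p l) \<subseteq> ?S" if "snd ` set l \<subseteq> ?S" for l
    using that
  proof (induct l)
    case (Cons a l)
    obtain c j where a: "a = (c, j)" by (cases a)
    have "keys (?p (a # l)) \<subseteq> keys (single j c) \<union> keys (?p l)"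
      using keys_add[of "single j c" "?p l"] unfolding a by simp
    then show ?case using Cons a by (auto split: if_splits)
  qed simp
  have ext: "lincomb xs l = linear_extension V ?g (?p l)" if "snd ` set l \<subseteq> ?S" for l
    using that
  proof (induct l)
    case Nil
    then show ?case
      using linear_map_zero[OF monoid_algebra_space V lin] by (simp add: monoid_algebra_simps)
  next
    case (Cons a l)
    obtain c j where a: "a = (c, j)" by (cases a)
    have j: "j \<in> ?S" using Cons.prems a by auto
    have "linear_extension V ?g (single j c + ?p l)
        = linear_extension V ?g (single j c) \<oplus> linear_extension V ?g (?p l)"
      using linear_mapD(2)[OF lin, of "single j c" "?p l"] j keys[of l] Cons.prems
      by (simp add: monoid_algebra_simps)
    moreover have "linear_extension V ?g (single j c) = c \<odot> xs ! j"
      by (rule linear_extension_single[OF V]) (use g j in auto)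
    ultimately show ?case using Cons a by simp
  qed
  have look: "lookup (?p l) i = (\<Sum>(c, j)\<leftarrow>l. if j = i then c else 0)" for l i
    by (induct l) (auto simp: lookup_add lookup_single when_def)
  have out: "lookup (?p l) i = 0" if "snd ` set l \<subseteq> ?S" "\<not> i < length xs" for l i
    using keys[OF that(1)] that(2) by (auto simp: in_keys_iff)
  have "?p l = ?p r"
  proof (rule poly_mapping_eqI)
    show "lookup (?p l) i = lookup (?p r) i" for i
      using eq[of i] look[of l i] look[of r i] out[OF l, of i] out[OF r, of i]
      by (cases "i < length xs") (simp_all only: not_False_eq_True simp_thms)
  qed
  then show ?thesis using ext[OF l] ext[OF r] by simp
qed

end

text \<open>Scaling by c is multiplication by the element c \<odot> 1, so an ideal absorbs
  it.\<close>

lemma (in complex_algebra) ideal_subspace: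
  assumes "ideal N A"
  shows "submodule N complex_ring A"
proof -
  interpret N: ideal N A by fact
  show ?thesis
  proof (rule space.subspaceI)
    show "c \<odot> x \<in> N" if "x \<in> N" for c x
    proof -
      have x: "x \<in> carrier A" using that N.a_Hcarr by auto
      have "c \<odot> x = (c \<odot> \<one>) \<otimes> x" using x by (simp add: smult_mult_left)
      then show ?thesis using N.I_l_closed[OF that, of "c \<odot> \<one>"] by simp
    qed
  qed (auto simp: N.a_Hcarr)
qed

section \<open>The quantum group\<close>

lemma free_algebra_algebra: "complex_algebra free_algebra"
  unfolding free_algebra_def by (rule monoid_algebra_algebra) auto

lemma free_algebra_simps:
  "carrier free_algebra = UNIV"
  "x \<oplus>\<^bsub>free_algebra\<^esub> y = x + y"
  "\<zero>\<^bsub>free_algebra\<^esub> = 0"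
  "\<one>\<^bsub>free_algebra\<^esub> = single [] 1"
  "c \<odot>\<^bsub>free_algebra\<^esub> x = scale c x"
  "single u c \<otimes>\<^bsub>free_algebra\<^esub> single v e = single (u @ v) (c * e)"
  by (simp_all add: free_algebra_def monoid_algebra_simps)

text \<open>The surrounding words u and v are quantified because the map need not be multiplicative:
  the differential and the projections to homogeneous components are not.\<close>

definition SL2_compatible :: "complex \<Rightarrow> (complex, 'w, 'n) module_scheme \<Rightarrow> (gen list \<Rightarrow> 'w) \<Rightarrow> bool"
  where "SL2_compatible q W g \<longleftrightarrow> (\<forall>u v.
    g (u @ [gb, ga] @ v) = q \<odot>\<^bsub>W\<^esub> g (u @ [ga, gb] @ v) \<and>
    g (u @ [gc, ga] @ v) = q \<odot>\<^bsub>W\<^esub> g (u @ [ga, gc] @ v) \<and>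
    g (u @ [gd, gb] @ v) = q \<odot>\<^bsub>W\<^esub> g (u @ [gb, gd] @ v) \<and>
    g (u @ [gd, gc] @ v) = q \<odot>\<^bsub>W\<^esub> g (u @ [gc, gd] @ v) \<and>
    g (u @ [gb, gc] @ v) = g (u @ [gc, gb] @ v) \<and>
    g (u @ [ga, gd] @ v) = g (u @ v) \<oplus>\<^bsub>W\<^esub> inverse q \<odot>\<^bsub>W\<^esub> g (u @ [gb, gc] @ v) \<and>
    g (u @ [gd, ga] @ v) = g (u @ v) \<oplus>\<^bsub>W\<^esub> q \<odot>\<^bsub>W\<^esub> g (u @ [gb, gc] @ v))"

lemma compatible_null:
  assumes W: "complex_space W" and g: "\<And>w. g w \<in> carrier W" and compat: "SL2_compatible q W g"
    and n: "n \<in> SL2_ideal q"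
  shows "linear_extension W g n = \<zero>\<^bsub>W\<^esub>"
proof -
  interpret W: complex_space W by fact
  interpret F: complex_algebra free_algebra by (rule free_algebra_algebra)
  let ?m = "monoid.mult free_algebra" and ?E = "linear_extension W g"
  have F [simp]: "x \<in> carrier free_algebra" for x by (simp add: free_algebra_simps)
  have lin: "linear_map free_algebra W ?E"
    unfolding free_algebra_def by (rule linear_extension_linear[OF W]) (use g in auto)
  note E = linear_mapD[OF lin F] linear_mapD(2)[OF lin F F]
  have E0: "?E 0 = \<zero>\<^bsub>W\<^esub>"
    using linear_map_zero[OF F.complex_space W lin] by (simp add: free_algebra_simps)
  have E_add: "?E (x + y) = ?E x \<oplus>\<^bsub>W\<^esub> ?E y" for x y
    using E(4)[of x y] by (simp add: free_algebra_simps)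
  have E_diff: "?E (x - y) = ?E x \<ominus>\<^bsub>W\<^esub> ?E y" for x y
    by (rule linear_extension_diff[OF W, of _ UNIV]) (use g in auto)
  have E_single: "?E (single w c) = c \<odot>\<^bsub>W\<^esub> g w" for w c
    by (rule linear_extension_single[where g = g, OF W g])
  \<comment> \<open>K is the largest two-sided ideal inside the kernel of the linear extension. By
    minimality of the generated ideal it is enough that the relators belong to K.\<close>
  define K where "K = {n. \<forall>x y. ?E (?m (?m x n) y) = \<zero>\<^bsub>W\<^esub>}"
  have "submodule K complex_ring free_algebra"
    by (rule F.space.subspaceI)
      (auto simp: K_def F.l_distr F.r_distr F.smult_mult_left F.smult_mult_right E E0 free_algebra_simps(3)[symmetric]
        linear_map_zero[OF F.complex_space W lin])
  then have "ideal K free_algebra"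
  proof (intro idealI F.ring_axioms submodule.axioms(1))
    show "?m a n \<in> K" if "n \<in> K" for n a using that by (simp add: K_def flip: F.m_assoc)
    show "?m n a \<in> K" if "n \<in> K" for n a using that by (simp add: K_def F.m_assoc)
  qed
  moreover have "r \<in> K" if r: "r \<in> SL2_relations q" for r
  proof -
    have cancel: "x \<in> carrier W \<Longrightarrow> y \<in> carrier W \<Longrightarrow> (x \<oplus>\<^bsub>W\<^esub> y) \<ominus>\<^bsub>W\<^esub> x \<ominus>\<^bsub>W\<^esub> y = \<zero>\<^bsub>W\<^esub>"
      "x \<in> carrier W \<Longrightarrow> x \<ominus>\<^bsub>W\<^esub> x = \<zero>\<^bsub>W\<^esub>" for x y
      by (simp_all add: a_minus_def W.a_assoc W.a_comm[of x] W.r_neg W.r_neg1)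
    \<comment> \<open>Between two scaled words a relator turns into an instance of
      \<open>SL2_compatible\<close>; general factors x and y follow by additivity.\<close>
    have word: "?E (?m (?m (single u c) r) (single v e)) = \<zero>\<^bsub>W\<^esub>" for u v c e
      using r
      by (auto simp: SL2_relations_def free_algebra_simps(6) E_diff E_single g W.smult_add mult_ac
          monoid_algebra_mult_diff[where S = UNIV and f = "(@)" and e = "[] :: gen list", folded free_algebra_def]
          compat[unfolded SL2_compatible_def, rule_format, simplified] cancel)
    have x: "x \<in> carrier (monoid_algebra UNIV (@) [])" for x by (simp add: monoid_algebra_simps)
    have "?E (?m (?m x r) y) = \<zero>\<^bsub>W\<^esub>" for x y
      using x[of x]
    proof (induct rule: monoid_algebra_induct)
      case (single u c)
      show ?case using x[of y]
        by (induct rule: monoid_algebra_induct)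
          (simp_all add: word[unfolded free_algebra_def] E0 E_add monoid_algebra_mult_add free_algebra_def)
    qed (simp_all add: E0 E_add monoid_algebra_add_mult free_algebra_def)
    then show ?thesis by (simp add: K_def)
  qed
  ultimately have "SL2_ideal q \<subseteq> K"
    unfolding SL2_ideal_def by (intro F.genideal_minimal) auto
  then have "?E (?m (?m \<one>\<^bsub>free_algebra\<^esub> n) \<one>\<^bsub>free_algebra\<^esub>) = \<zero>\<^bsub>W\<^esub>"
    using n unfolding K_def by blast
  then show ?thesis by simp
qed

locale quantum_SL2 =
  fixes q :: complex
  assumes q_nonzero [simp]: "q \<noteq> 0"
begin

abbreviation "A \<equiv> SL2 q"
abbreviation zero_A (\<open>\<zero>\<^sub>A\<close>) where "\<zero>\<^sub>A \<equiv> \<zero>\<^bsub>A\<^esub>"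
abbreviation one_A (\<open>\<one>\<^sub>A\<close>) where "\<one>\<^sub>A \<equiv> \<one>\<^bsub>A\<^esub>"
abbreviation mult_A (infixl \<open>\<cdot>\<close> 70) where "x \<cdot> y \<equiv> x \<otimes>\<^bsub>A\<^esub> y"
abbreviation add_A (infixl \<open>\<oplus>\<^sub>A\<close> 65) where "x \<oplus>\<^sub>A y \<equiv> x \<oplus>\<^bsub>A\<^esub> y"
abbreviation smult_A (infixl \<open>\<bullet>\<close> 70) where "c \<bullet> x \<equiv> c \<odot>\<^bsub>A\<^esub> x"
abbreviation "cl \<equiv> word_class q"

lemma ideal_SL2: "ideal (SL2_ideal q) free_algebra"
proof -
  interpret F: complex_algebra free_algebra by (rule free_algebra_algebra)
  show ?thesis
    unfolding SL2_ideal_def by (rule F.genideal_ideal) (simp add: free_algebra_simps)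
qed

lemma ideal_SL2_subspace: "submodule (SL2_ideal q) complex_ring free_algebra"
  by (rule complex_algebra.ideal_subspace[OF free_algebra_algebra ideal_SL2])

lemma SL2_algebra: "complex_algebra A"
  unfolding SL2_def by (rule quotient_algebra(1)[OF free_algebra_algebra ideal_SL2 ideal_SL2_subspace])

sublocale A: complex_algebra A
  by (rule SL2_algebra)

sublocale Q: complex_quotient free_algebra "SL2_ideal q"
  by (rule complex_quotientI[OF complex_algebra.complex_space[OF free_algebra_algebra] ideal_SL2_subspace])

lemma word_closed [simp, intro]: "cl w \<in> carrier A"
  unfolding word_class_def SL2_def by (rule Q.coset_closed) (simp add: free_algebra_simps)

lemma word_mult: "cl u \<cdot> cl v = cl (u @ v)"
  unfolding word_class_def SL2_def
  by (subst quotient_algebra(2)[OF free_algebra_algebra ideal_SL2 ideal_SL2_subspace])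
    (simp_all add: free_algebra_simps)

lemma word_Nil: "cl [] = \<one>\<^sub>A"
  unfolding word_class_def SL2_def
  by (subst quotient_algebra(3)[OF free_algebra_algebra ideal_SL2 ideal_SL2_subspace])
    (simp_all add: free_algebra_simps)

lemma word_Cons: "cl (g # w) = cl [g] \<cdot> cl w"
  by (simp add: word_mult)

lemma coset_single_word: "SL2_ideal q +>\<^bsub>free_algebra\<^esub> single w c = c \<bullet> cl w"
proof -
  have "single w c = c \<odot>\<^bsub>free_algebra\<^esub> single w 1"
    by (simp add: free_algebra_simps)
  then show ?thesis
    unfolding word_class_def SL2_def using Q.quotient_smult[of "single w 1" c]
    by (simp add: free_algebra_simps(1))
qed

text \<open>One induction serves the whole algebra and each homogeneous component, according to
  which words S admits in a representative.\<close>

lemma graded_induct: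
  assumes u: "keys u \<subseteq> S" and x: "x = SL2_ideal q +>\<^bsub>free_algebra\<^esub> u"
    and "P \<zero>\<^sub>A" "\<And>w c. w \<in> S \<Longrightarrow> P (c \<bullet> cl w)"
    and add: "\<And>x y. x \<in> carrier A \<Longrightarrow> y \<in> carrier A \<Longrightarrow> P x \<Longrightarrow> P y \<Longrightarrow> P (x \<oplus>\<^sub>A y)"
  shows "P x"
proof -
  let ?C = "\<lambda>u. SL2_ideal q +>\<^bsub>free_algebra\<^esub> u"
  have C: "?C u \<in> carrier A" for u
    unfolding SL2_def by (rule Q.coset_closed) (simp add: free_algebra_simps)
  have "u \<in> carrier (monoid_algebra S undefined undefined)"
    using u by (simp add: monoid_algebra_simps)
  then have "P (?C u)"
  proof (induct rule: monoid_algebra_induct)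
    case zero
    have "?C 0 = \<zero>\<^sub>A" using Q.quotient_zero by (simp add: SL2_def free_algebra_simps)
    then show ?case using assms(3) by simp
  next
    case (single w c)
    then show ?case using assms(4) by (simp add: coset_single_word)
  next
    case (add u v)
    have "?C (u + v) = ?C u \<oplus>\<^sub>A ?C v"
      using Q.quotient_add[of u v] by (simp add: SL2_def free_algebra_simps)
    then show ?case using assms(5)[OF C C add(3,4)] by simp
  qed
  then show ?thesis using x by simp
qed

lemma SL2_induct [consumes 1, case_names word add]:
  assumes x: "x \<in> carrier A" and word: "\<And>w c. P (c \<bullet> cl w)"
    and add: "\<And>x y. x \<in> carrier A \<Longrightarrow> y \<in> carrier A \<Longrightarrow> P x \<Longrightarrow> P y \<Longrightarrow> P (x \<oplus>\<^sub>A y)"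
  shows "P x"
proof -
  obtain u where "x = SL2_ideal q +>\<^bsub>free_algebra\<^esub> u"
    using x unfolding SL2_def by (elim Q.carrier_quotientE)
  moreover have "P \<zero>\<^sub>A" using word[of 0 "[]"] by simp
  ultimately show ?thesis
    using graded_induct[of u UNIV x P] word add by auto
qed

lemma linear_eq_on_words:
  assumes "linear_map A W f" "linear_map A W g" "\<And>w. f (cl w) = g (cl w)" "x \<in> carrier A"
  shows "f x = g x"
  using assms(4)
  by (induct rule: SL2_induct)
    (simp_all add: linear_mapD(2,3)[OF assms(1)] linear_mapD(2,3)[OF assms(2)] assms(3))

lemma
  assumes W: "complex_space W" and g: "\<And>w. g w \<in> carrier W" and resp: "SL2_compatible q W g"
  shows induced_linear: "linear_map A W (induced_map W g)"
    and induced_word: "induced_map W g (cl w) = g w"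
proof -
  interpret W: complex_space W by fact
  have g': "g \<in> UNIV \<rightarrow> carrier W" using g by auto
  note null = compatible_null[OF W g resp]
  show "linear_map A W (induced_map W g)"
    unfolding SL2_def free_algebra_def
    by (rule induced_map_linear[OF W g' ideal_SL2_subspace[unfolded free_algebra_def] null])
  show "induced_map W g (cl w) = g w"
    unfolding word_class_def free_algebra_def
    by (subst induced_map_coset[OF W g' ideal_SL2_subspace[unfolded free_algebra_def] null])
      (simp_all add: linear_extension_single[where g=g, OF W g] g)
qed

text \<open>For a multiplicative map the context factors out on both sides, so only the bare
  relations in the target remain to be checked.\<close>

lemma hom_compatible:
  assumes W: "complex_algebra W" and g: "\<And>w. g w \<in> carrier W"
    and mult: "\<And>u v. g (u @ v) = g u \<otimes>\<^bsub>W\<^esub> g v"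
    and rels: "g [gb, ga] = q \<odot>\<^bsub>W\<^esub> g [ga, gb]" "g [gc, ga] = q \<odot>\<^bsub>W\<^esub> g [ga, gc]"
      "g [gd, gb] = q \<odot>\<^bsub>W\<^esub> g [gb, gd]" "g [gd, gc] = q \<odot>\<^bsub>W\<^esub> g [gc, gd]"
      "g [gb, gc] = g [gc, gb]"
      "g [ga, gd] = \<one>\<^bsub>W\<^esub> \<oplus>\<^bsub>W\<^esub> inverse q \<odot>\<^bsub>W\<^esub> g [gb, gc]"
      "g [gd, ga] = \<one>\<^bsub>W\<^esub> \<oplus>\<^bsub>W\<^esub> q \<odot>\<^bsub>W\<^esub> g [gb, gc]"
  shows "SL2_compatible q W g"
proof -
  interpret W: complex_algebra W by fact
  have e: "g (u @ v @ w) = g u \<otimes>\<^bsub>W\<^esub> (g v \<otimes>\<^bsub>W\<^esub> g w)" for u v w by (simp add: mult)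
  show ?thesis
    unfolding SL2_compatible_def e mult[of _ "_ :: gen list"] rels
    by (simp add: g W.smult_mult_left W.smult_mult_right W.l_distr W.r_distr)
qed

lemma induced_hom:
  assumes W: "complex_algebra W" and g: "\<And>w. g w \<in> carrier W"
    and mult: "\<And>u v. g (u @ v) = g u \<otimes>\<^bsub>W\<^esub> g v" and resp: "SL2_compatible q W g"
    and x: "x \<in> carrier A" and y: "y \<in> carrier A"
  shows "induced_map W g (x \<cdot> y) = induced_map W g x \<otimes>\<^bsub>W\<^esub> induced_map W g y"
proof -
  interpret W: complex_algebra W by fact
  note lin = linear_mapD[OF induced_linear[OF W.complex_space g resp]]
  note word = induced_word[OF W.complex_space g resp]
  show ?thesis using x
  proof (induct rule: SL2_induct)
    case (word w c)
    show ?case using y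
    proof (induct rule: SL2_induct)
      case (word v e)
      show ?case
        by (simp add: A.smult_mult_left A.smult_mult_right W.smult_mult_left W.smult_mult_right
            word_mult lin \<open>\<And>w. induced_map W g (cl w) = g w\<close> mult g)
    next
      case (add x y)
      then show ?case by (simp add: A.r_distr W.r_distr lin)
    qed
  next
    case (add x x')
    then show ?case using y by (simp add: A.l_distr W.l_distr lin)
  qed
qed

section \<open>Generators, relations and normal ordering\<close>

abbreviation "xa \<equiv> cl [ga]"
abbreviation "xb \<equiv> cl [gb]"
abbreviation "xc \<equiv> cl [gc]"
abbreviation "xd \<equiv> cl [gd]"

lemma coset_relation:
  assumes "r \<in> SL2_relations q"
  shows "SL2_ideal q +>\<^bsub>free_algebra\<^esub> r = \<zero>\<^sub>A"
proof -
  interpret F: complex_algebra free_algebra by (rule free_algebra_algebra)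
  have "r \<in> SL2_ideal q"
    unfolding SL2_ideal_def using F.genideal_self[of "SL2_relations q"] assms
    by (auto simp: free_algebra_simps)
  then show ?thesis
    unfolding SL2_def using Q.coset_eq_zero_iff[of r] by (simp add: free_algebra_simps)
qed

lemma coset_diff:
  "SL2_ideal q +>\<^bsub>free_algebra\<^esub> (u - v)
    = (SL2_ideal q +>\<^bsub>free_algebra\<^esub> u) \<ominus>\<^bsub>A\<^esub> (SL2_ideal q +>\<^bsub>free_algebra\<^esub> v)"
  using linear_map_minus[OF Q.complex_space_axioms Q.quotient_space Q.coset_linear, of u v]
    monoid_algebra_minus[of u UNIV "(@)" "[]" v]
  unfolding SL2_def by (simp add: free_algebra_simps free_algebra_def[symmetric] monoid_algebra_simps)

lemma word_relations:
  "cl [gb, ga] = q \<bullet> cl [ga, gb]" "cl [gc, ga] = q \<bullet> cl [ga, gc]"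
  "cl [gd, gb] = q \<bullet> cl [gb, gd]" "cl [gd, gc] = q \<bullet> cl [gc, gd]"
  "cl [gb, gc] = cl [gc, gb]"
  "cl [ga, gd] = \<one>\<^sub>A \<oplus>\<^sub>A inverse q \<bullet> cl [gb, gc]"
  "cl [gd, ga] = \<one>\<^sub>A \<oplus>\<^sub>A q \<bullet> cl [gb, gc]"
proof -
  \<comment> \<open>The relators are iterated differences; moving one subtrahend at a time to the
    other side gives the relations in their usual form.\<close>
  have diff: "x \<ominus>\<^bsub>A\<^esub> y = z \<longleftrightarrow> x = y \<oplus>\<^sub>A z"
    if "x \<in> carrier A" "y \<in> carrier A" "z \<in> carrier A" for x y z
    using that by (auto simp: a_minus_def A.a_comm[of y] A.a_assoc A.l_neg A.r_neg)
  have "\<forall>r\<in>SL2_relations q. SL2_ideal q +>\<^bsub>free_algebra\<^esub> r = \<zero>\<^sub>A"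
    using coset_relation by blast
  note rel = this[unfolded SL2_relations_def]
  show "cl [gb, ga] = q \<bullet> cl [ga, gb]" "cl [gc, ga] = q \<bullet> cl [ga, gc]"
    "cl [gd, gb] = q \<bullet> cl [gb, gd]" "cl [gd, gc] = q \<bullet> cl [gc, gd]" "cl [gb, gc] = cl [gc, gb]"
    "cl [ga, gd] = \<one>\<^sub>A \<oplus>\<^sub>A inverse q \<bullet> cl [gb, gc]" "cl [gd, ga] = \<one>\<^sub>A \<oplus>\<^sub>A q \<bullet> cl [gb, gc]"
    using rel by (simp_all add: coset_diff coset_single_word word_Nil diff A.r_right_minus_eq)
qed

text \<open>The relations oriented as rewrite rules: b precedes c, both precede a and d, and a next
  to d is eliminated. Every word becomes a combination of words b^i c^j a^k and b^i c^j d^k.\<close>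

lemma swaps:
  "xa \<cdot> xb = inverse q \<bullet> (xb \<cdot> xa)"
  "xa \<cdot> xc = inverse q \<bullet> (xc \<cdot> xa)"
  "xd \<cdot> xb = q \<bullet> (xb \<cdot> xd)"
  "xd \<cdot> xc = q \<bullet> (xc \<cdot> xd)"
  "xc \<cdot> xb = xb \<cdot> xc"
  "xa \<cdot> xd = \<one>\<^sub>A \<oplus>\<^sub>A inverse q \<bullet> (xb \<cdot> xc)"
  "xd \<cdot> xa = \<one>\<^sub>A \<oplus>\<^sub>A q \<bullet> (xb \<cdot> xc)"
  using word_relations by (simp_all add: word_mult)

text \<open>The same rules with a tail, since products are kept nested to the right and two
  neighbouring letters are then not a subterm.\<close>

lemma swaps_left:
  assumes x: "x \<in> carrier A"
  shows "xa \<cdot> (xb \<cdot> x) = inverse q \<bullet> (xb \<cdot> (xa \<cdot> x))"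
    "xa \<cdot> (xc \<cdot> x) = inverse q \<bullet> (xc \<cdot> (xa \<cdot> x))"
    "xd \<cdot> (xb \<cdot> x) = q \<bullet> (xb \<cdot> (xd \<cdot> x))"
    "xd \<cdot> (xc \<cdot> x) = q \<bullet> (xc \<cdot> (xd \<cdot> x))"
    "xc \<cdot> (xb \<cdot> x) = xb \<cdot> (xc \<cdot> x)"
    "xa \<cdot> (xd \<cdot> x) = x \<oplus>\<^sub>A inverse q \<bullet> (xb \<cdot> (xc \<cdot> x))"
    "xd \<cdot> (xa \<cdot> x) = x \<oplus>\<^sub>A q \<bullet> (xb \<cdot> (xc \<cdot> x))"
  using x by (simp_all add: swaps A.smult_mult_left A.l_distr flip: A.m_assoc)

end

text \<open>Arranged for use as a rule on an equation: expanding and ordering both sides, and adding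
  up coefficients, become premises left to simplification.\<close>

lemma (in complex_space) lincomb_cong:
  assumes "set xs \<subseteq> carrier V"
    and "snd ` set l \<subseteq> {..<length xs}" "snd ` set r \<subseteq> {..<length xs}"
    and "\<forall>i<length xs. (\<Sum>(c, j)\<leftarrow>l. if j = i then c else 0) = (\<Sum>(c, j)\<leftarrow>r. if j = i then c else 0)"
    and "x = lincomb xs l" "y = lincomb xs r"
  shows "x = y"
  using lincomb_eqI[OF assms(1-3)] assms(4-6) by simp

section \<open>Functoriality, multiplicativity and associativity of tensor products\<close>

lemma tensor_map_comp:
  assumes "complex_space V" "complex_space W" "complex_space V'" "complex_space W'"
    "complex_space V''" "complex_space W''"
    and "linear_map V V' f" "linear_map W W' g" "linear_map V' V'' f'" "linear_map W' W'' g'"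
    and t: "t \<in> carrier (tensor V W)"
  shows "tensor_map V'' W'' f' g' (tensor_map V' W' f g t)
    = tensor_map V'' W'' (\<lambda>x. f' (f x)) (\<lambda>y. g' (g y)) t"
proof -
  interpret T: tensor_product V W by (rule tensor_productI) fact+
  note lin = linear_map_comp[OF assms(7,9)] linear_map_comp[OF assms(8,10)]
  show ?thesis
    by (rule T.linear_eq_on_pure[OF linear_map_comp[OF tensor_map_linear[OF assms(1-4,7,8)]
            tensor_map_linear[OF assms(3-6,9,10)]] tensor_map_linear[OF assms(1,2,5,6) lin] _ t])
      (simp add: tensor_map_pure[OF assms(1-4,7,8)] tensor_map_pure[OF assms(3-6,9,10)]
        tensor_map_pure[OF assms(1,2,5,6) lin] linear_mapD(1)[OF assms(7)] linear_mapD(1)[OF assms(8)])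
qed

lemma tensor_map_mult:
  assumes V: "complex_algebra V" and W: "complex_algebra W" and V': "complex_algebra V'"
    and W': "complex_algebra W'" and f: "linear_map V V' f" and g: "linear_map W W' g"
    and fm: "\<And>x y. x \<in> carrier V \<Longrightarrow> y \<in> carrier V \<Longrightarrow> f (x \<otimes>\<^bsub>V\<^esub> y) = f x \<otimes>\<^bsub>V'\<^esub> f y"
    and gm: "\<And>x y. x \<in> carrier W \<Longrightarrow> y \<in> carrier W \<Longrightarrow> g (x \<otimes>\<^bsub>W\<^esub> y) = g x \<otimes>\<^bsub>W'\<^esub> g y"
    and s: "s \<in> carrier (tensor V W)" and t: "t \<in> carrier (tensor V W)"
  shows "tensor_map V' W' f g (s \<otimes>\<^bsub>tensor V W\<^esub> t)
    = tensor_map V' W' f g s \<otimes>\<^bsub>tensor V' W'\<^esub> tensor_map V' W' f g t"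
proof -
  interpret V: complex_algebra V by fact
  interpret W: complex_algebra W by fact
  interpret V': complex_algebra V' by fact
  interpret W': complex_algebra W' by fact
  interpret TA: complex_algebra "tensor V W" by (rule tensor_algebra[OF V W])
  interpret TA': complex_algebra "tensor V' W'" by (rule tensor_algebra[OF V' W'])
  interpret T: tensor_product V W by (rule tensor_productI) (rule V.complex_space W.complex_space)+
  interpret T': tensor_product V' W' by (rule tensor_productI) (rule V'.complex_space W'.complex_space)+
  note lin = linear_mapD[OF tensor_map_linear[OF V.complex_space W.complex_space V'.complex_space W'.complex_space f g]]
  note fc = linear_mapD(1)[OF f] and gc = linear_mapD(1)[OF g]
  show ?thesis using s
  proof (induct rule: T.tensor_induct)
    case (pure x y)
    show ?case using t
    proof (induct rule: T.tensor_induct)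
      case (pure x' y')
      then show ?case using \<open>x \<in> carrier V\<close> \<open>y \<in> carrier W\<close>
        by (simp add: tensor_mult_pure[OF V W] tensor_mult_pure[OF V' W']
            tensor_map_pure[OF V.complex_space W.complex_space V'.complex_space W'.complex_space f g] fm gm fc gc)
    next
      case (add t t')
      then show ?case using \<open>x \<in> carrier V\<close> \<open>y \<in> carrier W\<close> by (simp add: TA.r_distr TA'.r_distr lin)
    qed
  next
    case (add s s')
    then show ?case using t by (simp add: TA.l_distr TA'.l_distr lin)
  qed
qed

lemma tensor_map_id_pure:
  assumes "complex_space V" "complex_space W" "complex_space W'" "linear_map W W' g"
    and "x \<in> carrier V" "y \<in> carrier W"
  shows "tensor_map V W' id g (pure_tensor V W x y) = pure_tensor V W' x (g y)"
  using tensor_map_pure[OF assms(1,2,1,3) linear_map_id assms(4-6)] by simp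

lemma tensor_map_id_linear:
  assumes "complex_space V" "complex_space W" "complex_space W'" "linear_map W W' g"
  shows "linear_map (tensor V W) (tensor V W') (tensor_map V W' id g)"
  by (rule tensor_map_linear[OF assms(1,2,1,3) linear_map_id assms(4)])

lemma triple_tensor_induct:
  assumes sp: "complex_space U" "complex_space V" "complex_space W"
    and s: "s \<in> carrier (tensor (tensor U V) W)"
    and p: "\<And>x y z. x \<in> carrier U \<Longrightarrow> y \<in> carrier V \<Longrightarrow> z \<in> carrier W \<Longrightarrow>
      P (pure_tensor (tensor U V) W (pure_tensor U V x y) z)"
    and a: "\<And>s t. s \<in> carrier (tensor (tensor U V) W) \<Longrightarrow> t \<in> carrier (tensor (tensor U V) W)
      \<Longrightarrow> P s \<Longrightarrow> P t \<Longrightarrow> P (s \<oplus>\<^bsub>tensor (tensor U V) W\<^esub> t)"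
  shows "P s"
proof -
  interpret UV: tensor_product U V by (rule tensor_productI) fact+
  interpret S: tensor_product "tensor U V" W by (rule tensor_productI[OF UV.tensor_space]) fact
  show ?thesis using s
  proof (induct rule: S.tensor_induct)
    case (pure x z)
    then show ?case
    proof (induct rule: UV.tensor_induct)
      case (pure x y)
      then show ?case using p by simp
    next
      case (add s t)
      then show ?case using a by (simp add: S.pure_add_left)
    qed
  qed (use a in auto)
qed

text \<open>Needed to carry coassociativity from the quantum group over to the forms: a map on the
  last leg can be applied after rebracketing.\<close>

lemma tensor_assoc_natural:
  assumes sp: "complex_space U" "complex_space V" "complex_space W" "complex_space W'"
    and g: "linear_map W W' g" and s: "s \<in> carrier (tensor (tensor U V) W)"
  shows "tensor_assoc U V W' (tensor_map (tensor U V) W' id g s)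
    = tensor_map U (tensor V W') id (tensor_map V W' id g) (tensor_assoc U V W s)"
proof -
  interpret UV: tensor_product U V by (rule tensor_productI) fact+
  interpret VW: tensor_product V W by (rule tensor_productI) fact+
  interpret VW': tensor_product V W' by (rule tensor_productI) fact+
  note sp1 = UV.tensor_space sp(3) UV.tensor_space sp(4)
  note sp2 = sp(2,3,2,4) and sp3 = sp(1) VW.tensor_space sp(1) VW'.tensor_space
  note l2 = tensor_map_linear[OF sp2 linear_map_id g]
  note lin = linear_mapD[OF tensor_map_linear[OF sp1 linear_map_id g]]
    linear_mapD[OF tensor_map_linear[OF sp3 linear_map_id l2]]
    linear_mapD[OF tensor_assoc_linear[OF sp(1-3)]] linear_mapD[OF tensor_assoc_linear[OF sp(1,2,4)]]
  note pure = tensor_map_id_pure[OF sp1(1,2,4) g] tensor_map_id_pure[OF sp3(1,2,4) l2]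
    tensor_map_id_pure[OF sp2(1,2,4) g]
    tensor_assoc_pure[OF sp(1-3)] tensor_assoc_pure[OF sp(1,2,4)]
  show ?thesis
    by (rule triple_tensor_induct[OF sp(1-3) s])
      (simp_all add: pure lin linear_mapD(1)[OF g] del: id_apply)
qed

text \<open>Makes both sides of coassociativity algebra maps, so that the generators decide the
  question.\<close>

lemma tensor_assoc_mult:
  assumes U: "complex_algebra U" and V: "complex_algebra V" and W: "complex_algebra W"
    and s: "s \<in> carrier (tensor (tensor U V) W)" and t: "t \<in> carrier (tensor (tensor U V) W)"
  shows "tensor_assoc U V W (s \<otimes>\<^bsub>tensor (tensor U V) W\<^esub> t)
    = tensor_assoc U V W s \<otimes>\<^bsub>tensor U (tensor V W)\<^esub> tensor_assoc U V W t"
proof -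
  interpret U: complex_algebra U by fact
  interpret V: complex_algebra V by fact
  interpret W: complex_algebra W by fact
  note UV = tensor_algebra[OF U V] and VW = tensor_algebra[OF V W]
  interpret UVa: complex_algebra "tensor U V" by (rule UV)
  interpret VWa: complex_algebra "tensor V W" by (rule VW)
  note UVW = tensor_algebra[OF UV W] and UVW' = tensor_algebra[OF U VW]
  interpret S: complex_algebra "tensor (tensor U V) W" by (rule UVW)
  interpret T: complex_algebra "tensor U (tensor V W)" by (rule UVW')
  interpret UVt: tensor_product U V by (rule tensor_productI) (rule U.complex_space V.complex_space)+
  interpret VWt: tensor_product V W by (rule tensor_productI) (rule V.complex_space W.complex_space)+
  interpret St: tensor_product "tensor U V" W by (rule tensor_productI) (rule UVa.complex_space W.complex_space)+
  interpret Tt: tensor_product U "tensor V W" by (rule tensor_productI) (rule VWa.complex_space U.complex_space)+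
  note sp = U.complex_space V.complex_space W.complex_space
  note lin = linear_mapD[OF tensor_assoc_linear[OF sp]]
  note pure = tensor_assoc_pure[OF sp]
  note ind = triple_tensor_induct[OF sp]
  show ?thesis using s
  proof (rule ind)
    fix x y z assume xyz: "x \<in> carrier U" "y \<in> carrier V" "z \<in> carrier W"
    let ?p = "pure_tensor (tensor U V) W (pure_tensor U V x y) z"
    show "tensor_assoc U V W (?p \<otimes>\<^bsub>tensor (tensor U V) W\<^esub> t)
      = tensor_assoc U V W ?p \<otimes>\<^bsub>tensor U (tensor V W)\<^esub> tensor_assoc U V W t"
      using t
    proof (rule ind)
      show "tensor_assoc U V W (?p \<otimes>\<^bsub>tensor (tensor U V) W\<^esub> (pure_tensor (tensor U V) W (pure_tensor U V x' y') z'))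
      = tensor_assoc U V W ?p \<otimes>\<^bsub>tensor U (tensor V W)\<^esub> tensor_assoc U V W (pure_tensor (tensor U V) W (pure_tensor U V x' y') z')"
        if "x' \<in> carrier U" "y' \<in> carrier V" "z' \<in> carrier W" for x' y' z'
        using that xyz
        by (simp add: tensor_mult_pure[OF UV W] tensor_mult_pure[OF U VW] tensor_mult_pure[OF U V]
            tensor_mult_pure[OF V W] pure)
    qed (use xyz in \<open>simp add: S.r_distr T.r_distr lin\<close>)
  qed (use t in \<open>simp add: S.l_distr T.l_distr lin\<close>)
qed

lemma complex_line_simps [simp]:
  "carrier complex_line = UNIV" "x \<oplus>\<^bsub>complex_line\<^esub> y = x + y" "x \<otimes>\<^bsub>complex_line\<^esub> y = x * y"
  "\<zero>\<^bsub>complex_line\<^esub> = 0" "\<one>\<^bsub>complex_line\<^esub> = 1" "x \<odot>\<^bsub>complex_line\<^esub> y = x * y"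
  by (simp_all add: complex_line_def ring.defs module.defs ring_of_type_algebra_def)

lemma complex_line_algebra: "complex_algebra complex_line"
proof (rule complex_algebraI)
  show V: "complex_space complex_line"
    by (rule complex_spaceI) (auto simp: algebra_simps)
  interpret V: complex_space complex_line by (rule V)
  show "ring complex_line"
    by (rule ringI) (auto intro!: monoidI simp: algebra_simps V.abelian_group_axioms)
qed (auto simp: algebra_simps)

context quantum_SL2
begin

section \<open>Counit and coproduct\<close>

abbreviation "AA \<equiv> tensor A A"
abbreviation "pt \<equiv> pure_tensor A A"
abbreviation "\<epsilon> \<equiv> SL2_counit q"
abbreviation "\<Delta> \<equiv> SL2_coproduct q"

lemmas A_space = A.complex_space

lemma AA_algebra: "complex_algebra AA"
  by (rule tensor_algebra[OF SL2_algebra SL2_algebra])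

sublocale AA: complex_algebra AA
  by (rule AA_algebra)

lemmas AA_space = AA.complex_space

sublocale T: tensor_product A A
  by (rule tensor_productI[OF A_space A_space])

lemmas pt_mult = tensor_mult_pure[OF SL2_algebra SL2_algebra]
lemmas pt_one = tensor_one[OF SL2_algebra SL2_algebra]
lemmas pt_linear = T.pure_add_left T.pure_add_right T.pure_smult_left T.pure_smult_right
lemmas A_normal = swaps swaps_left A.m_assoc A.l_distr A.r_distr A.smult_mult_left A.smult_mult_right
  A.space.smult_add

lemma counit_compatible: "SL2_compatible q complex_line (\<lambda>w. prod_list (map gen_counit w))"
  by (rule hom_compatible[OF complex_line_algebra]) auto

lemma counit_linear: "linear_map A complex_line \<epsilon>"
  unfolding SL2_counit_def
  by (rule induced_linear[OF complex_algebra.complex_space[OF complex_line_algebra] _ counit_compatible]) simp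

lemma counit_word: "\<epsilon> (cl w) = prod_list (map gen_counit w)"
  unfolding SL2_counit_def
  by (rule induced_word[OF complex_algebra.complex_space[OF complex_line_algebra] _ counit_compatible]) simp

lemma counit_mult: "x \<in> carrier A \<Longrightarrow> y \<in> carrier A \<Longrightarrow> \<epsilon> (x \<cdot> y) = \<epsilon> x * \<epsilon> y"
  unfolding SL2_counit_def
  using induced_hom[OF complex_line_algebra _ _ counit_compatible, of x y] by simp

lemma gen_coproduct_closed [simp]: "gen_coproduct q g \<in> carrier AA"
  by (cases g) simp_all

abbreviation "word_coproduct w \<equiv> foldr (\<lambda>g t. gen_coproduct q g \<otimes>\<^bsub>AA\<^esub> t) w \<one>\<^bsub>AA\<^esub>"

lemma word_coproduct_closed [simp]: "word_coproduct w \<in> carrier AA"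
  by (induct w) simp_all

lemma word_coproduct_append: "word_coproduct (u @ v) = word_coproduct u \<otimes>\<^bsub>AA\<^esub> word_coproduct v"
  by (induct u) (simp_all add: AA.m_assoc)

text \<open>The generator matrix has a coproduct that is again a matrix product, and the relations
  survive it. Each is verified by putting both legs of the expanded tensors into normal
  order.\<close>

lemma coproduct_compatible: "SL2_compatible q AA word_coproduct"
proof (rule hom_compatible[OF AA_algebra word_coproduct_closed word_coproduct_append])
  note s = AA.l_distr AA.r_distr AA.smult_mult_left AA.smult_mult_right AA.a_ac AA.space.smult_add
    pt_mult pt_linear pt_one A_normal
  note cong = AA.space.lincomb_cong and coef = All_less_Suc field_simps
  \<comment> \<open>In each case the first list names the ordered pure tensors that occur; the other
    two are the coefficients of the left and the right side in the sequence in which simplification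
    produces them.\<close>
  show "word_coproduct [gb, ga] = q \<odot>\<^bsub>AA\<^esub> word_coproduct [ga, gb]"
    by (rule cong[of "[pt (xa \<cdot> xa) (xb \<cdot> xa),
            pt (xb \<cdot> xa) (xb \<cdot> xc),
            pt (xb \<cdot> xa) \<one>\<^sub>A,
            pt (xb \<cdot> xb) (xc \<cdot> xd)]"
          "[(1, 0), (inverse q, 1), (1, 2), (q, 1), (q, 3)]"
          "[(1, 0), (1, 2), (inverse q, 1), (q, 1), (q, 3)]"])
      (simp_all add: s coef)
  show "word_coproduct [gc, ga] = q \<odot>\<^bsub>AA\<^esub> word_coproduct [ga, gc]"
    by (rule cong[of "[pt (xc \<cdot> xa) (xa \<cdot> xa),
            pt (xb \<cdot> xc) (xc \<cdot> xa),
            pt \<one>\<^sub>A (xc \<cdot> xa),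
            pt (xb \<cdot> xd) (xc \<cdot> xc)]"
          "[(1, 0), (inverse q, 1), (1, 2), (q, 1), (q, 3)]"
          "[(1, 0), (1, 2), (inverse q, 1), (q, 1), (q, 3)]"])
      (simp_all add: s coef)
  show "word_coproduct [gd, gb] = q \<odot>\<^bsub>AA\<^esub> word_coproduct [gb, gd]"
    by (rule cong[of "[pt (xc \<cdot> xa) (xb \<cdot> xb),
            pt (xb \<cdot> xc) (xb \<cdot> xd),
            pt \<one>\<^sub>A (xb \<cdot> xd),
            pt (xb \<cdot> xd) (xd \<cdot> xd)]"
          "[(1, 0), (1, 1), (q, 2), (q * q, 1), (q, 3)]"
          "[(1, 0), (q, 2), (1, 1), (q * q, 1), (q, 3)]"])
      (simp_all add: s coef)
  show "word_coproduct [gd, gc] = q \<odot>\<^bsub>AA\<^esub> word_coproduct [gc, gd]"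
    by (rule cong[of "[pt (xc \<cdot> xc) (xb \<cdot> xa),
            pt (xc \<cdot> xd) (xb \<cdot> xc),
            pt (xc \<cdot> xd) \<one>\<^sub>A,
            pt (xd \<cdot> xd) (xc \<cdot> xd)]"
          "[(1, 0), (1, 1), (q, 2), (q * q, 1), (q, 3)]"
          "[(1, 0), (q, 2), (1, 1), (q * q, 1), (q, 3)]"])
      (simp_all add: s coef)
  show "word_coproduct [gb, gc] = word_coproduct [gc, gb]"
    by (rule cong[of "[pt (xc \<cdot> xa) (xb \<cdot> xa),
            pt \<one>\<^sub>A (xb \<cdot> xc),
            pt (xb \<cdot> xc) (xb \<cdot> xc),
            pt (xb \<cdot> xc) \<one>\<^sub>A,
            pt (xb \<cdot> xd) (xc \<cdot> xd)]"
          "[(inverse q, 0), (1, 1), (inverse q, 2), (1, 3), (q, 2), (q, 4)]"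
          "[(inverse q, 0), (1, 3), (inverse q, 2), (1, 1), (q, 2), (q, 4)]"])
      (simp_all add: s coef)
  show "word_coproduct [ga, gd] = \<one>\<^bsub>AA\<^esub> \<oplus>\<^bsub>AA\<^esub> inverse q \<odot>\<^bsub>AA\<^esub> word_coproduct [gb, gc]"
    by (rule cong[of "[pt (xc \<cdot> xa) (xb \<cdot> xa),
            pt \<one>\<^sub>A \<one>\<^sub>A,
            pt \<one>\<^sub>A (xb \<cdot> xc),
            pt (xb \<cdot> xc) \<one>\<^sub>A,
            pt (xb \<cdot> xc) (xb \<cdot> xc),
            pt (xb \<cdot> xd) (xc \<cdot> xd)]"
          "[(inverse q * inverse q, 0), (1, 1), (inverse q, 2), (inverse q, 3), (inverse q * inverse q, 4), (1, 4), (1, 5)]"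
          "[(1, 1), (inverse q * inverse q, 0), (inverse q, 2), (inverse q * inverse q, 4), (inverse q, 3), (1, 4), (1, 5)]"])
      (simp_all add: s coef)
  show "word_coproduct [gd, ga] = \<one>\<^bsub>AA\<^esub> \<oplus>\<^bsub>AA\<^esub> q \<odot>\<^bsub>AA\<^esub> word_coproduct [gb, gc]"
    by (rule cong[of "[pt (xc \<cdot> xa) (xb \<cdot> xa),
            pt \<one>\<^sub>A \<one>\<^sub>A,
            pt \<one>\<^sub>A (xb \<cdot> xc),
            pt (xb \<cdot> xc) \<one>\<^sub>A,
            pt (xb \<cdot> xc) (xb \<cdot> xc),
            pt (xb \<cdot> xd) (xc \<cdot> xd)]"
          "[(1, 0), (1, 4), (1, 1), (q, 2), (q, 3), (q * q, 4), (q * q, 5)]"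
          "[(1, 1), (1, 0), (q, 2), (1, 4), (q, 3), (q * q, 4), (q * q, 5)]"])
      (simp_all add: s coef)
qed

lemma coproduct_linear: "linear_map A AA \<Delta>"
  unfolding SL2_coproduct_def
  by (rule induced_linear[OF AA_space word_coproduct_closed coproduct_compatible])

lemma coproduct_word: "\<Delta> (cl w) = word_coproduct w"
  unfolding SL2_coproduct_def
  by (rule induced_word[OF AA_space word_coproduct_closed coproduct_compatible])

lemma coproduct_mult:
  "x \<in> carrier A \<Longrightarrow> y \<in> carrier A \<Longrightarrow> \<Delta> (x \<cdot> y) = \<Delta> x \<otimes>\<^bsub>AA\<^esub> \<Delta> y"
  unfolding SL2_coproduct_def
  by (rule induced_hom[OF AA_algebra word_coproduct_closed word_coproduct_append coproduct_compatible])

lemma coproduct_closed [simp]: "x \<in> carrier A \<Longrightarrow> \<Delta> x \<in> carrier AA"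
  by (rule linear_mapD(1)[OF coproduct_linear])

lemma coproduct_one: "\<Delta> \<one>\<^sub>A = \<one>\<^bsub>AA\<^esub>"
  using coproduct_word[of "[]"] by (simp add: word_Nil)

lemma coproduct_gen:
  "\<Delta> xa = pt xa xa \<oplus>\<^bsub>AA\<^esub> pt xb xc" "\<Delta> xb = pt xa xb \<oplus>\<^bsub>AA\<^esub> pt xb xd"
  "\<Delta> xc = pt xc xa \<oplus>\<^bsub>AA\<^esub> pt xd xc" "\<Delta> xd = pt xc xb \<oplus>\<^bsub>AA\<^esub> pt xd xd"
  by (simp_all add: coproduct_word)

lemma hom_eq_on_generators:
  assumes W: "complex_algebra W" and f: "linear_map A W f" and g: "linear_map A W g"
    and fm: "\<And>x y. x \<in> carrier A \<Longrightarrow> y \<in> carrier A \<Longrightarrow> f (x \<cdot> y) = f x \<otimes>\<^bsub>W\<^esub> f y"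
    and gm: "\<And>x y. x \<in> carrier A \<Longrightarrow> y \<in> carrier A \<Longrightarrow> g (x \<cdot> y) = g x \<otimes>\<^bsub>W\<^esub> g y"
    and one: "f \<one>\<^sub>A = g \<one>\<^sub>A" and gen: "\<And>x. f (cl [x]) = g (cl [x])"
    and x: "x \<in> carrier A"
  shows "f x = g x"
proof (rule linear_eq_on_words[OF f g _ x])
  show "f (cl w) = g (cl w)" for w
  proof (induct w)
    case Nil
    then show ?case using one by (simp add: word_Nil)
  next
    case (Cons a w)
    then show ?case using fm[of "cl [a]" "cl w"] gm[of "cl [a]" "cl w"] gen by (simp add: word_mult)
  qed
qed

text \<open>Both sides are algebra homomorphisms, so the generators suffice; there the claim is
  associativity of the matrix product.\<close>

lemma coassociative:
  assumes x: "x \<in> carrier A"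
  shows "tensor_assoc A A A (tensor_map AA A \<Delta> id (\<Delta> x)) = tensor_map A AA id \<Delta> (\<Delta> x)"
proof (rule hom_eq_on_generators[OF _ _ _ _ _ _ _ x])
  note AAA = tensor_algebra[OF SL2_algebra AA_algebra]
  interpret R: complex_algebra "tensor A AA" by (rule AAA)
  interpret St: tensor_product AA A by (rule tensor_productI[OF AA_space A_space])
  interpret Rt: tensor_product A AA by (rule tensor_productI[OF A_space AA_space])
  note sp1 = A_space A_space AA_space A_space and sp2 = A_space A_space A_space AA_space
  note l1 = tensor_map_linear[OF sp1 coproduct_linear linear_map_id]
  note l2 = tensor_map_linear[OF sp2 linear_map_id coproduct_linear]
  note l3 = tensor_assoc_linear[OF A_space A_space A_space]
  note p = tensor_map_pure[OF sp1 coproduct_linear linear_map_id]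
    tensor_map_pure[OF sp2 linear_map_id coproduct_linear]
    tensor_assoc_pure[OF A_space A_space A_space]
  show "complex_algebra (tensor A AA)" by (rule AAA)
  show "linear_map A (tensor A AA) (\<lambda>x. tensor_assoc A A A (tensor_map AA A \<Delta> id (\<Delta> x)))"
    by (rule linear_map_comp[OF linear_map_comp[OF coproduct_linear l1] l3])
  show "linear_map A (tensor A AA) (\<lambda>x. tensor_map A AA id \<Delta> (\<Delta> x))"
    by (rule linear_map_comp[OF coproduct_linear l2])
  show "tensor_assoc A A A (tensor_map AA A \<Delta> id (\<Delta> (x \<cdot> y)))
    = tensor_assoc A A A (tensor_map AA A \<Delta> id (\<Delta> x)) \<otimes>\<^bsub>tensor A AA\<^esub> tensor_assoc A A A (tensor_map AA A \<Delta> id (\<Delta> y))"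
    if "x \<in> carrier A" "y \<in> carrier A" for x y
    using that
    by (simp add: coproduct_mult linear_mapD(1)[OF l1]
        tensor_map_mult[OF SL2_algebra SL2_algebra AA_algebra SL2_algebra coproduct_linear linear_map_id]
        tensor_assoc_mult[OF SL2_algebra SL2_algebra SL2_algebra])
  show "tensor_map A AA id \<Delta> (\<Delta> (x \<cdot> y))
    = tensor_map A AA id \<Delta> (\<Delta> x) \<otimes>\<^bsub>tensor A AA\<^esub> tensor_map A AA id \<Delta> (\<Delta> y)"
    if "x \<in> carrier A" "y \<in> carrier A" for x y
    using that
    by (simp add: coproduct_mult
        tensor_map_mult[OF SL2_algebra SL2_algebra SL2_algebra AA_algebra linear_map_id coproduct_linear])
  show "tensor_assoc A A A (tensor_map AA A \<Delta> id (\<Delta> \<one>\<^sub>A)) = tensor_map A AA id \<Delta> (\<Delta> \<one>\<^sub>A)"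
    by (simp add: coproduct_one pt_one p)
  show "tensor_assoc A A A (tensor_map AA A \<Delta> id (\<Delta> (cl [g]))) = tensor_map A AA id \<Delta> (\<Delta> (cl [g]))" for g
    by (cases g)
      (simp_all add: coproduct_gen p linear_mapD[OF l1] linear_mapD[OF l2] linear_mapD[OF l3]
        St.pure_add_left Rt.pure_add_right R.a_ac)
qed

lemma counit_smult_bilinear:
  assumes "complex_space W"
  shows "bilinear_map A W W (\<lambda>h w. \<epsilon> h \<odot>\<^bsub>W\<^esub> w)"
proof -
  interpret W: complex_space W by fact
  show ?thesis
    by (intro bilinear_mapI linear_mapI)
      (simp_all add: linear_mapD(2,3)[OF counit_linear] W.smult_add_scalar W.smult_add mult.commute)
qed

lemma counital:
  assumes x: "x \<in> carrier A"
  shows "induced_map A (\<lambda>(h, w). \<epsilon> h \<bullet> w) (\<Delta> x) = x" (is "?\<kappa> (\<Delta> x) = x")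
proof -
  note l = T.lift_linear[OF A_space counit_smult_bilinear[OF A_space]]
  note p = T.lift_pure[OF A_space counit_smult_bilinear[OF A_space]]
  \<comment> \<open>Contracting the left leg with the multiplicative counit only produces scalars,
    which commute with the right leg. The composite with the coproduct is therefore an algebra map
    and can be tested on generators.\<close>
  have mult: "?\<kappa> (s \<otimes>\<^bsub>AA\<^esub> t) = ?\<kappa> s \<cdot> ?\<kappa> t" if s: "s \<in> carrier AA" and t: "t \<in> carrier AA" for s t
    using s
  proof (induct rule: T.tensor_induct)
    case (pure x y)
    show ?case using t
    proof (induct rule: T.tensor_induct)
      case (pure x' y')
      then show ?case using \<open>x \<in> carrier A\<close> \<open>y \<in> carrier A\<close>
        by (simp add: pt_mult p counit_mult A.smult_mult_left A.smult_mult_right mult.commute)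
    next
      case (add t t')
      then show ?case using \<open>x \<in> carrier A\<close> \<open>y \<in> carrier A\<close>
        by (simp add: AA.r_distr linear_mapD[OF l] A.r_distr)
    qed
  next
    case (add s s')
    then show ?case using t by (simp add: AA.l_distr linear_mapD[OF l] A.l_distr)
  qed
  have "?\<kappa> (\<Delta> x) = id x"
  proof (rule hom_eq_on_generators[OF SL2_algebra linear_map_comp[OF coproduct_linear l] linear_map_id _ _ _ _ x])
    show "?\<kappa> (\<Delta> (x \<cdot> y)) = ?\<kappa> (\<Delta> x) \<cdot> ?\<kappa> (\<Delta> y)" if "x \<in> carrier A" "y \<in> carrier A" for x y
      using that by (simp add: coproduct_mult mult)
    show "?\<kappa> (\<Delta> \<one>\<^sub>A) = id \<one>\<^sub>A"
      using counit_word[of "[]"] by (simp add: coproduct_one pt_one p word_Nil)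
    show "?\<kappa> (\<Delta> (cl [g])) = id (cl [g])" for g
      by (cases g) (simp_all add: coproduct_gen linear_mapD[OF l] p counit_word)
  qed simp_all
  then show ?thesis by simp
qed

section \<open>The grading\<close>

abbreviation "Gr \<equiv> SL2_component q"

lemma word_degree_simps [simp]:
  "word_degree [] = 0" "word_degree (g # w) = gen_degree g + word_degree w"
  "word_degree (u @ v) = word_degree u + word_degree v"
  by (simp_all add: word_degree_def)

lemma word_component: "cl w \<in> Gr (word_degree w)"
  unfolding SL2_component_def word_class_def by auto

lemma component_induct [consumes 1, case_names zero word add]:
  assumes x: "x \<in> Gr n" and "P \<zero>\<^sub>A" "\<And>w c. word_degree w = n \<Longrightarrow> P (c \<bullet> cl w)"
    and "\<And>x y. x \<in> carrier A \<Longrightarrow> y \<in> carrier A \<Longrightarrow> P x \<Longrightarrow> P y \<Longrightarrow> P (x \<oplus>\<^sub>A y)"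
  shows "P x"
proof -
  obtain u where u: "\<forall>w\<in>keys u. word_degree w = n"
    "x = SL2_ideal q +>\<^bsub>free_algebra\<^esub> u"
    using x by (auto simp: SL2_component_def)
  show ?thesis
    by (rule graded_induct[of u "{w. word_degree w = n}" x P]) (use u assms in auto)
qed

lemma component_subspace: "submodule (Gr n) complex_ring A"
proof (rule A.space.subspaceI)
  let ?C = "\<lambda>u. SL2_ideal q +>\<^bsub>free_algebra\<^esub> u"
  have C: "?C u \<in> carrier A" for u
    unfolding SL2_def by (rule Q.coset_closed) (simp add: free_algebra_simps)
  show "Gr n \<subseteq> carrier A"
    by (auto simp: SL2_component_def C)
  have "\<zero>\<^sub>A = ?C 0"
    using Q.quotient_zero by (simp add: SL2_def free_algebra_simps)
  then show "\<zero>\<^sub>A \<in> Gr n"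
    unfolding SL2_component_def by (intro CollectI exI[of _ 0]) simp
  show "x \<oplus>\<^sub>A y \<in> Gr n" if x: "x \<in> Gr n" and y: "y \<in> Gr n" for x y
  proof -
    obtain u v where u: "\<forall>w\<in>keys u. word_degree w = n" "x = ?C u"
      and v: "\<forall>w\<in>keys v. word_degree w = n" "y = ?C v"
      using x y by (auto simp: SL2_component_def)
    have "x \<oplus>\<^sub>A y = ?C (u + v)"
      using Q.quotient_add[of u v] u v by (simp add: SL2_def free_algebra_simps)
    then show ?thesis
      using keys_add[of u v] u v unfolding SL2_component_def by blast
  qed
  show "c \<bullet> x \<in> Gr n" if x: "x \<in> Gr n" for c x
  proof -
    obtain u where u: "\<forall>w\<in>keys u. word_degree w = n" "x = ?C u"
      using x by (auto simp: SL2_component_def)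
    have "c \<bullet> x = ?C (scale c u)"
      using Q.quotient_smult[of u c] u by (simp add: SL2_def free_algebra_simps)
    then show ?thesis
      using keys_map_scale[of c u] u unfolding SL2_component_def by blast
  qed
qed

lemma component_closed [intro]: "x \<in> Gr n \<Longrightarrow> x \<in> carrier A"
  using A.space.subspaceD(1)[OF component_subspace] by auto

lemmas component_ops [simp, intro] =
  A.space.subspaceD(2)[OF component_subspace] A.space.subspaceD(3)[OF component_subspace]
  A.space.subspaceD(4)[OF component_subspace]

lemma component_mult:
  assumes x: "x \<in> Gr m" and y: "y \<in> Gr n"
  shows "x \<cdot> y \<in> Gr (m + n)"
proof -
  note yc = component_closed[OF y]
  show ?thesis using x
  proof (induct rule: component_induct)
    case (word w c)
    show ?case using y
    proof (induct rule: component_induct)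
      case (word v e)
      then show ?case
        using word_component[of "w @ v"] \<open>word_degree w = m\<close>
        by (simp add: A.smult_mult_left A.smult_mult_right word_mult)
    qed (simp_all add: A.r_distr)
  qed (simp_all add: A.l_distr yc)
qed

definition proj :: "int \<Rightarrow> (gen list \<Rightarrow>\<^sub>0 complex) set \<Rightarrow> (gen list \<Rightarrow>\<^sub>0 complex) set"
  where "proj n = induced_map A (\<lambda>w. if word_degree w = n then cl w else \<zero>\<^sub>A)"

lemma word_compatible: "SL2_compatible q A cl"
  by (rule hom_compatible[OF SL2_algebra])
    (use word_relations in \<open>simp_all add: word_mult word_Nil\<close>)

lemmas word_relations_context =
  word_compatible[unfolded SL2_compatible_def, rule_format, simplified]

text \<open>All relations are homogeneous, with 1, ad, da and bc in degree 0, so any rescaling by a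
  function of the degree respects them. Indicator functions give the projections and powers of q the
  twists.\<close>

lemma graded_compatible:
  fixes f :: "int \<Rightarrow> complex"
  shows "SL2_compatible q A (\<lambda>w. f (word_degree w) \<bullet> cl w)"
  unfolding SL2_compatible_def
  by (simp add: word_relations_context A.space.smult_add mult.commute)

lemma
  shows proj_linear: "linear_map A A (proj n)"
    and proj_word: "proj n (cl w) = (if word_degree w = n then cl w else \<zero>\<^sub>A)"
proof -
  have e: "(\<lambda>w. if word_degree w = n then cl w else \<zero>\<^sub>A)
      = (\<lambda>w. (if word_degree w = n then 1 else 0) \<bullet> cl w)"
    by (rule ext) simp
  have r: "SL2_compatible q A (\<lambda>w. if word_degree w = n then cl w else \<zero>\<^sub>A)"
    unfolding e by (rule graded_compatible)
  show "linear_map A A (proj n)" unfolding proj_def by (rule induced_linear[OF A_space _ r]) simp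
  show "proj n (cl w) = (if word_degree w = n then cl w else \<zero>\<^sub>A)"
    unfolding proj_def by (rule induced_word[OF A_space _ r]) simp
qed

lemma proj_component [simp]: "x \<in> Gr n \<Longrightarrow> proj n x = x"
  by (induct rule: component_induct)
    (simp_all add: linear_mapD[OF proj_linear] linear_map_zero[OF A_space A_space proj_linear] proj_word)

lemma proj_closed: "x \<in> carrier A \<Longrightarrow> proj n x \<in> Gr n"
proof (induct rule: SL2_induct)
  case (word w c)
  then show ?case using word_component[of w] by (auto simp: linear_mapD[OF proj_linear] proj_word)
qed (simp add: linear_mapD[OF proj_linear])

abbreviation "twist \<equiv> degree_twist q"

lemma
  shows twist_linear: "linear_map A A (twist k)"
    and twist_word: "twist k (cl w) = (q powi (k * word_degree w)) \<bullet> cl w"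
proof -
  note r = graded_compatible[of "\<lambda>n. q powi (k * n)"]
  show "linear_map A A (twist k)" unfolding degree_twist_def by (rule induced_linear[OF A_space _ r]) simp
  show "twist k (cl w) = (q powi (k * word_degree w)) \<bullet> cl w"
    unfolding degree_twist_def by (rule induced_word[OF A_space _ r]) simp
qed

lemma twist_component: "x \<in> Gr n \<Longrightarrow> twist k x = (q powi (k * n)) \<bullet> x"
  by (induct rule: component_induct)
    (simp_all add: linear_mapD[OF twist_linear] linear_map_zero[OF A_space A_space twist_linear]
      twist_word A.space.smult_add mult.commute)

lemma twist_closed [simp]: "x \<in> carrier A \<Longrightarrow> twist k x \<in> carrier A"
  by (rule linear_mapD(1)[OF twist_linear])

lemma twist_mult:
  assumes x: "x \<in> carrier A" and y: "y \<in> carrier A"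
  shows "twist k (x \<cdot> y) = twist k x \<cdot> twist k y"
proof -
  have p: "q powi (k * (i + j)) = q powi (k * i) * q powi (k * j)" for i j
    by (simp add: distrib_left power_int_add)
  note r = graded_compatible[of "\<lambda>n. q powi (k * n)"]
  show ?thesis
    unfolding degree_twist_def
    by (rule induced_hom[OF SL2_algebra _ _ r x y])
      (simp_all add: A.smult_mult_left A.smult_mult_right word_mult p mult.commute)
qed

lemma twist_one: "twist k \<one>\<^sub>A = \<one>\<^sub>A"
  using twist_word[of k "[]"] by (simp add: word_Nil)

section \<open>Tensors whose right leg is homogeneous\<close>

text \<open>The image of A \<otimes> A_n inside A \<otimes> A. Working in this subspace keeps
  products and coproducts in one space instead of one tensor product for each degree.\<close>

definition right_comp :: "int \<Rightarrow> _ set"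
  where "right_comp n = cspan AA {pt x y | x y. x \<in> carrier A \<and> y \<in> Gr n}"

lemma right_comp_gens: "{pt x y | x y. x \<in> carrier A \<and> y \<in> Gr n} \<subseteq> carrier AA"
  by auto

lemma right_comp_closed: "t \<in> right_comp n \<Longrightarrow> t \<in> carrier AA"
  unfolding right_comp_def using AA.space.cspan_carrier[OF right_comp_gens] by auto

lemma right_comp_pure: "x \<in> carrier A \<Longrightarrow> y \<in> Gr n \<Longrightarrow> pt x y \<in> right_comp n"
  unfolding right_comp_def by (rule AA.space.cspan_incl) auto

lemmas right_comp_ops = AA.space.subspaceD(2-4)[OF AA.space.cspan_subspace[OF right_comp_gens],
    folded right_comp_def]

lemma right_comp_induct [consumes 1, case_names pure add]:
  assumes t: "t \<in> right_comp n" and pure: "\<And>x y. x \<in> carrier A \<Longrightarrow> y \<in> Gr n \<Longrightarrow> P (pt x y)"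
    and add: "\<And>s t. s \<in> carrier AA \<Longrightarrow> t \<in> carrier AA \<Longrightarrow> P s \<Longrightarrow> P t \<Longrightarrow> P (s \<oplus>\<^bsub>AA\<^esub> t)"
  shows "P t"
proof -
  \<comment> \<open>Quantifying over all multiples makes the scalar case of span induction trivial;
    on generators the scalar is absorbed in the left leg.\<close>
  have "\<forall>c. P (c \<odot>\<^bsub>AA\<^esub> t)"
    using t[unfolded right_comp_def] right_comp_gens
  proof (induct rule: AA.space.cspan_induct)
    case zero
    then show ?case
      using pure[of "\<zero>\<^sub>A" "\<zero>\<^sub>A"] T.pure_zero_right[of "\<zero>\<^sub>A"] by simp
  next
    case (incl x)
    then obtain y z where x: "x = pt y z" "y \<in> carrier A" "z \<in> Gr n" by auto
    show ?case
    proof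
      show "P (c \<odot>\<^bsub>AA\<^esub> x)" for c
        using pure[of "c \<bullet> y" z] x by (simp add: T.pure_smult_left component_closed)
    qed
  next
    case (add x y)
    then show ?case using assms(3) by (simp add: AA.space.smult_add)
  next
    case (smult c x)
    then show ?case by simp
  qed
  then have "P (1 \<odot>\<^bsub>AA\<^esub> t)" by blast
  then show ?thesis using right_comp_closed[OF t] by simp
qed

lemma right_comp_mult:
  assumes s: "s \<in> right_comp m" and t: "t \<in> right_comp n"
  shows "s \<otimes>\<^bsub>AA\<^esub> t \<in> right_comp (m + n)"
  using s
proof (induct rule: right_comp_induct)
  case (pure x y)
  show ?case using t
  proof (induct rule: right_comp_induct)
    case (pure x' y')
    then show ?case using \<open>x \<in> carrier A\<close> \<open>y \<in> Gr m\<close>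
      by (simp add: pt_mult component_closed right_comp_pure component_mult)
  next
    case (add t t')
    then show ?case using \<open>x \<in> carrier A\<close> \<open>y \<in> Gr m\<close>
      by (simp add: AA.r_distr component_closed right_comp_ops)
  qed
next
  case (add s s')
  then show ?case using right_comp_closed[OF t] by (simp add: AA.l_distr right_comp_ops)
qed

text \<open>The coproduct of a generator has right legs from its own column of the matrix, and the
  degree is constant along columns: 1 for a and c, -1 for b and d.\<close>

lemma word_coproduct_right_comp: "\<Delta> (cl w) \<in> right_comp (word_degree w)"
proof (induct w)
  case Nil
  have "\<one>\<^sub>A \<in> Gr 0" using word_component[of "[]"] by (simp add: word_Nil)
  then show ?case by (simp add: coproduct_word pt_one right_comp_pure)
next
  case (Cons g w)
  have "gen_coproduct q g \<in> right_comp (gen_degree g)"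
    by (cases g) (use word_component[of "[ga]"] word_component[of "[gb]"] word_component[of "[gc]"]
        word_component[of "[gd]"] in \<open>auto intro!: right_comp_ops right_comp_pure\<close>)
  then show ?case using right_comp_mult Cons by (simp add: coproduct_word)
qed

lemma coproduct_right_comp: "x \<in> Gr n \<Longrightarrow> \<Delta> x \<in> right_comp n"
  by (induct rule: component_induct)
    (use word_coproduct_right_comp in \<open>auto simp: linear_mapD[OF coproduct_linear]
      linear_map_zero[OF A_space AA_space coproduct_linear] intro!: right_comp_ops\<close>)

lemma right_comp_eqI:
  assumes "complex_space W" "linear_map AA W f" "linear_map AA W g"
    and "\<And>x y. x \<in> carrier A \<Longrightarrow> y \<in> Gr n \<Longrightarrow> f (pt x y) = g (pt x y)" "t \<in> right_comp n"
  shows "f t = g t"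
  using assms(5)
  by (induct rule: right_comp_induct)
    (simp_all add: assms(4) linear_mapD(2)[OF assms(2)] linear_mapD(2)[OF assms(3)])

section \<open>The quantum sphere\<close>

abbreviation "B \<equiv> S2 q"

lemma carrier_B [simp]: "carrier B = Gr 0"
  and B_ops [simp]: "x \<oplus>\<^bsub>B\<^esub> y = x \<oplus>\<^sub>A y" "x \<otimes>\<^bsub>B\<^esub> y = x \<cdot> y" "c \<odot>\<^bsub>B\<^esub> x = c \<bullet> x"
    "\<zero>\<^bsub>B\<^esub> = \<zero>\<^sub>A" "\<one>\<^bsub>B\<^esub> = \<one>\<^sub>A"
  by (simp_all add: S2_def)

lemma one_component [simp]: "\<one>\<^sub>A \<in> Gr 0"
  using word_component[of "[]"] by (simp add: word_Nil)

lemma component_mult_zero [simp]: "x \<in> Gr 0 \<Longrightarrow> y \<in> Gr n \<Longrightarrow> x \<cdot> y \<in> Gr n"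
  "x \<in> Gr n \<Longrightarrow> y \<in> Gr 0 \<Longrightarrow> x \<cdot> y \<in> Gr n"
  using component_mult[of x 0 y n] component_mult[of x n y 0] by simp_all

lemma B_space: "complex_space B"
  unfolding S2_def by (rule A.space.subspace_space[OF component_subspace])

lemma B_algebra: "complex_algebra B"
proof (rule complex_algebraI[OF B_space])
  interpret B: complex_space B by (rule B_space)
  show "ring B"
  proof (rule ringI)
    show "abelian_group B" by (rule B.abelian_group_axioms)
    show "monoid B" by (rule monoidI) (auto simp: component_closed A.m_assoc)
  qed (auto simp: component_closed A.l_distr A.r_distr)
qed (auto simp: component_closed A.smult_mult_left A.smult_mult_right)

lemma proj_linear_B: "linear_map A B (proj 0)"
  using linear_mapD(2,3)[OF proj_linear] proj_closed by (intro linear_mapI) simp_all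

lemma incl_linear_B: "linear_map B A id"
  by (intro linear_mapI) (auto simp: component_closed)

abbreviation "AB \<equiv> tensor A B"

lemma coaction_S2_eq:
  assumes x: "x \<in> Gr 0"
  shows "coaction_S2 q x = tensor_map A B id (proj 0) (\<Delta> x)"
  unfolding coaction_S2_def
proof (rule the_equality)
  interpret AB: tensor_product A B by (rule tensor_productI[OF A_space B_space])
  note sp = A_space A_space A_space B_space and sp' = A_space B_space A_space A_space
  note l = tensor_map_linear[OF sp linear_map_id proj_linear_B]
    and p = tensor_map_pure[OF sp linear_map_id proj_linear_B]
  note l' = tensor_map_linear[OF sp' linear_map_id incl_linear_B]
    and p' = tensor_map_pure[OF sp' linear_map_id incl_linear_B]
  have D: "\<Delta> x \<in> right_comp 0" "\<Delta> x \<in> carrier AA"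
    using coproduct_right_comp[OF x] coproduct_closed[OF component_closed[OF x]] by auto
  \<comment> \<open>Existence: all right legs of the coproduct of x have degree 0, where the
    projection changes nothing.\<close>
  have "tensor_map A A id id (tensor_map A B id (proj 0) (\<Delta> x)) = id (\<Delta> x)"
    by (rule right_comp_eqI[OF AA_space linear_map_comp[OF l l'] linear_map_id _ D(1)])
      (simp add: p p' component_closed)
  then show "tensor_map A B id (proj 0) (\<Delta> x) \<in> carrier AB
      \<and> tensor_map A A id id (tensor_map A B id (proj 0) (\<Delta> x)) = \<Delta> x"
    using linear_mapD(1)[OF l D(2)] by simp
  show "t = tensor_map A B id (proj 0) (\<Delta> x)"
    if t: "t \<in> carrier AB \<and> tensor_map A A id id t = \<Delta> x" for t
  proof -
    \<comment> \<open>Uniqueness: the projection is a left inverse of the inclusion, hence also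
      after tensoring.\<close>
    have "tensor_map A B id (proj 0) (tensor_map A A id id t) = id t"
      by (rule AB.linear_eq_on_pure[OF linear_map_comp[OF l' l] linear_map_id])
        (use t in \<open>simp_all add: p p' component_closed\<close>)
    then show ?thesis using t by simp
  qed
qed

end

section \<open>Restriction of bimodules and cancellation rules\<close>

text \<open>Algebra and module shrink at the same time, because the lines of forms in question are
  claimed to be stable only under the sphere. Stability is the one condition beyond inherited
  laws.\<close>

lemma sub_bimodule:
  fixes B' :: "(complex, 'b, 'm) module_scheme" and \<Omega> :: "(complex, 'b, 'w) bimodule"
  assumes bim: "algebra_bimodule B \<Omega>" and B': "complex_algebra B'"
    and sub: "carrier B' \<subseteq> carrier B" "\<And>x y. x \<oplus>\<^bsub>B'\<^esub> y = x \<oplus>\<^bsub>B\<^esub> y"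
      "\<And>x y. x \<otimes>\<^bsub>B'\<^esub> y = x \<otimes>\<^bsub>B\<^esub> y" "\<And>c x. c \<odot>\<^bsub>B'\<^esub> x = c \<odot>\<^bsub>B\<^esub> x" "\<one>\<^bsub>B'\<^esub> = \<one>\<^bsub>B\<^esub>"
    and M: "submodule M complex_ring \<Omega>"
    and stable: "\<And>x w. x \<in> carrier B' \<Longrightarrow> w \<in> M \<Longrightarrow> x \<triangleright>\<^bsub>\<Omega>\<^esub> w \<in> M"
      "\<And>x w. x \<in> carrier B' \<Longrightarrow> w \<in> M \<Longrightarrow> w \<triangleleft>\<^bsub>\<Omega>\<^esub> x \<in> M"
  shows "algebra_bimodule B' (\<Omega>\<lparr>carrier := M\<rparr>)"
proof -
  interpret bim: algebra_bimodule B \<Omega> by (rule bim)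
  interpret \<Omega>: complex_space \<Omega> unfolding complex_space_def by (rule bim.\<Omega>.module_axioms)
  note lacts = linear_mapD[OF bim.lact_linear] linear_mapD[OF bim.lact_linear_left]
  note racts = linear_mapD[OF bim.ract_linear] linear_mapD[OF bim.ract_linear_right]
  have M_sub: "w \<in> carrier \<Omega>" if "w \<in> M" for w
    using \<Omega>.subspaceD(1)[OF M] that by auto
  have B_sub: "x \<in> carrier B" if "x \<in> carrier B'" for x
    using sub(1) that by auto
  show ?thesis
  proof (unfold algebra_bimodule_def, intro conjI)
    show "complex_algebra B'" by (rule B')
    show "module complex_ring (\<Omega>\<lparr>carrier := M\<rparr>)"
      using \<Omega>.subspace_space[OF M] by (simp add: complex_space_def)
    show "algebra_bimodule_axioms B' (\<Omega>\<lparr>carrier := M\<rparr>)"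
      by unfold_locales
        (auto intro!: linear_mapI stable simp: sub(2-5) M_sub B_sub lacts racts
          bim.lact_one bim.ract_one bim.lact_mult bim.ract_mult bim.lact_ract)
  qed
qed

context complex_space
begin

text \<open>Subtraction is written as scaling by - 1 and sums are sorted and nested to the right;
  these are the cancellation patterns that arise in that shape.\<close>

lemma smult_cancel:
  "x \<in> carrier V \<Longrightarrow> c \<odot> x \<oplus> (- c) \<odot> x = \<zero>"
  "x \<in> carrier V \<Longrightarrow> x \<oplus> (- 1) \<odot> x = \<zero>"
  "x \<in> carrier V \<Longrightarrow> (- 1) \<odot> x \<oplus> x = \<zero>"
  "x \<in> carrier V \<Longrightarrow> y \<in> carrier V \<Longrightarrow> c \<odot> x \<oplus> ((- c) \<odot> x \<oplus> y) = y"
  "x \<in> carrier V \<Longrightarrow> y \<in> carrier V \<Longrightarrow> x \<oplus> ((- 1) \<odot> x \<oplus> y) = y"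
  "x \<in> carrier V \<Longrightarrow> y \<in> carrier V \<Longrightarrow> z \<in> carrier V
    \<Longrightarrow> x \<oplus> (y \<oplus> ((- 1) \<odot> x \<oplus> z)) = y \<oplus> z"
proof -
  show c: "x \<in> carrier V \<Longrightarrow> c \<odot> x \<oplus> (- c) \<odot> x = \<zero>" for c x
    by (simp flip: smult_add_scalar)
  show i: "x \<in> carrier V \<Longrightarrow> x \<oplus> (- 1) \<odot> x = \<zero>" for x using c[of x 1] by simp
  then show "x \<in> carrier V \<Longrightarrow> (- 1) \<odot> x \<oplus> x = \<zero>" by (simp add: a_comm)
  show "x \<in> carrier V \<Longrightarrow> y \<in> carrier V \<Longrightarrow> c \<odot> x \<oplus> ((- c) \<odot> x \<oplus> y) = y"
    by (simp add: c flip: a_assoc)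
  show e: "x \<in> carrier V \<Longrightarrow> y \<in> carrier V \<Longrightarrow> x \<oplus> ((- 1) \<odot> x \<oplus> y) = y" for x y
    by (simp add: i flip: a_assoc)
  show "x \<in> carrier V \<Longrightarrow> y \<in> carrier V \<Longrightarrow> z \<in> carrier V
    \<Longrightarrow> x \<oplus> (y \<oplus> ((- 1) \<odot> x \<oplus> z)) = y \<oplus> z"
    by (simp add: e a_lcomm[of y])
qed

end

context quantum_SL2
begin

section \<open>The bimodule of forms on the quantum group\<close>

abbreviation "\<Omega> \<equiv> SL2_forms q"
abbreviation lact_\<Omega> (infixr \<open>\<rightharpoonup>\<close> 72) where "f \<rightharpoonup> w \<equiv> f \<triangleright>\<^bsub>\<Omega>\<^esub> w"
abbreviation ract_\<Omega> (infixl \<open>\<leftharpoonup>\<close> 72) where "w \<leftharpoonup> f \<equiv> w \<triangleleft>\<^bsub>\<Omega>\<^esub> f"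

lemma forms_simps [simp]:
  "carrier \<Omega> = carrier A \<times> carrier A \<times> carrier A"
  "\<zero>\<^bsub>\<Omega>\<^esub> = (\<zero>\<^sub>A, \<zero>\<^sub>A, \<zero>\<^sub>A)"
  "(x, y, z) \<oplus>\<^bsub>\<Omega>\<^esub> (x', y', z') = (x \<oplus>\<^sub>A x', y \<oplus>\<^sub>A y', z \<oplus>\<^sub>A z')"
  "c \<odot>\<^bsub>\<Omega>\<^esub> (x, y, z) = (c \<bullet> x, c \<bullet> y, c \<bullet> z)"
  "f \<rightharpoonup> (x, y, z) = (f \<cdot> x, f \<cdot> y, f \<cdot> z)"
  "(x, y, z) \<leftharpoonup> f = (x \<cdot> twist 1 f, y \<cdot> twist 1 f, z \<cdot> twist 2 f)"
  by (simp_all add: SL2_forms_def)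

lemma forms_space: "complex_space \<Omega>"
  by (rule complex_spaceI)
    (auto simp: A.a_ac A.space.smult_add A.space.smult_add_scalar A.space.minus_one_smult A.l_neg A.r_neg)

sublocale Om: complex_space \<Omega>
  by (rule forms_space)

text \<open>The right action is multiplication after a twist in each slot. It is unital and
  associative because the twists are algebra endomorphisms.\<close>

lemma forms_bimodule: "algebra_bimodule A \<Omega>"
proof (unfold algebra_bimodule_def, intro conjI)
  show "complex_algebra A" by (rule SL2_algebra)
  show "module complex_ring \<Omega>" using forms_space by (simp add: complex_space_def)
  show "algebra_bimodule_axioms A \<Omega>"
    by unfold_locales
      (auto intro!: linear_mapI simp: A.l_distr A.r_distr A.smult_mult_left A.smult_mult_right
        linear_mapD[OF twist_linear] twist_one twist_mult A.m_assoc)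
qed

sublocale \<Omega>: algebra_bimodule A \<Omega>
  by (rule forms_bimodule)

lemmas lact_ops = linear_mapD[OF \<Omega>.lact_linear] linear_mapD[OF \<Omega>.lact_linear_left]
lemmas ract_ops = linear_mapD[OF \<Omega>.ract_linear] linear_mapD[OF \<Omega>.ract_linear_right]

section \<open>The differential\<close>

lemma d_gen_closed: "d_gen q g \<in> carrier \<Omega>"
  by (cases g) auto

lemma d_word_closed: "d_word q w \<in> carrier \<Omega>"
proof (induct w)
  case (Cons g w)
  show ?case
    unfolding d_word.simps
    by (rule Om.a_closed[OF ract_ops(1)[OF _ d_gen_closed] lact_ops(1)[OF _ Cons]]) simp_all
qed simp

text \<open>\<open>d_word\<close> splits off one letter at a time; the Leibniz rule at an arbitrary
  cut is what the check of the relations in context requires.\<close>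

lemma d_word_append:
  "d_word q (u @ v) = d_word q u \<leftharpoonup> cl v \<oplus>\<^bsub>\<Omega>\<^esub> cl u \<rightharpoonup> d_word q v"
proof (induct u)
  case Nil
  obtain x y z where "d_word q v = (x, y, z)" by (cases "d_word q v")
  then show ?case using d_word_closed[of v] by (simp add: word_Nil)
next
  case (Cons g u)
  have cl: "cl (g # u @ v) = cl [g] \<cdot> (cl u \<cdot> cl v)" "cl (g # u) = cl [g] \<cdot> cl u"
    "cl (u @ v) = cl u \<cdot> cl v"
    by (simp_all add: word_mult)
  note c = d_gen_closed[of g] d_word_closed[of u] d_word_closed[of v]
    ract_ops(1) lact_ops(1)
  show ?case
    unfolding append_Cons d_word.simps Cons cl
    using c by (simp del: forms_simps add: lact_ops ract_ops \<Omega>.lact_mult \<Omega>.ract_mult \<Omega>.lact_ract Om.a_assoc)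
qed

text \<open>By the Leibniz rule the differential of u w v depends on w only through the class of w
  and its differential, linearly in both. The term with w0 accommodates the constant in ad and da;
  its coefficient is 0 for the other relations.\<close>

lemma d_word_context:
  assumes w: "cl w1 = c0 \<bullet> cl w0 \<oplus>\<^sub>A c \<bullet> cl w2"
    and d: "d_word q w1 = c0 \<odot>\<^bsub>\<Omega>\<^esub> d_word q w0 \<oplus>\<^bsub>\<Omega>\<^esub> c \<odot>\<^bsub>\<Omega>\<^esub> d_word q w2"
  shows "d_word q (u @ w1 @ v) = c0 \<odot>\<^bsub>\<Omega>\<^esub> d_word q (u @ w0 @ v) \<oplus>\<^bsub>\<Omega>\<^esub> c \<odot>\<^bsub>\<Omega>\<^esub> d_word q (u @ w2 @ v)"
proof -
  note cl = word_mult[symmetric]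
  note c = d_word_closed ract_ops(1) lact_ops(1)
  show ?thesis
    unfolding d_word_append cl w d
    by (simp del: forms_simps add: c lact_ops ract_ops A.smult_mult_left A.l_distr Om.smult_add Om.a_ac)
qed

lemma d_word_compatible: "SL2_compatible q \<Omega> (d_word q)"
proof -
  have p: "q powi (- 2) = inverse q * inverse q"
    by (simp add: power_int_minus power2_eq_square)
  note s = word_Cons[of _ "[_]"] word_Nil twist_word twist_one A_normal A.a_ac
  have two: "d_word q (u @ w1 @ v) = c \<odot>\<^bsub>\<Omega>\<^esub> d_word q (u @ w2 @ v)"
    if "cl w1 = c \<bullet> cl w2" "d_word q w1 = c \<odot>\<^bsub>\<Omega>\<^esub> d_word q w2" for u v w1 w2 c
    using d_word_context[of w1 0 "[]" c w2 u v] that d_word_closed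
    by (simp del: forms_simps d_word.simps)
  have three: "d_word q (u @ w1 @ v) = d_word q (u @ v) \<oplus>\<^bsub>\<Omega>\<^esub> c \<odot>\<^bsub>\<Omega>\<^esub> d_word q (u @ w2 @ v)"
    if "cl w1 = \<one>\<^sub>A \<oplus>\<^sub>A c \<bullet> cl w2" "d_word q w1 = c \<odot>\<^bsub>\<Omega>\<^esub> d_word q w2" for u v w1 w2 c
    using d_word_context[of w1 1 "[]" c w2 u v] that d_word_closed d_word.simps(1)[of q]
    by (simp del: forms_simps d_word.simps add: word_Nil)
  \<comment> \<open>Bare relations, compared slot by slot in normal order. The last two have no
    constant term because the differential of the empty word is zero.\<close>
  have d: "d_word q [gb, ga] = q \<odot>\<^bsub>\<Omega>\<^esub> d_word q [ga, gb]"
    "d_word q [gc, ga] = q \<odot>\<^bsub>\<Omega>\<^esub> d_word q [ga, gc]"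
    "d_word q [gd, gb] = q \<odot>\<^bsub>\<Omega>\<^esub> d_word q [gb, gd]"
    "d_word q [gd, gc] = q \<odot>\<^bsub>\<Omega>\<^esub> d_word q [gc, gd]"
    "d_word q [gb, gc] = 1 \<odot>\<^bsub>\<Omega>\<^esub> d_word q [gc, gb]"
    "d_word q [ga, gd] = inverse q \<odot>\<^bsub>\<Omega>\<^esub> d_word q [gb, gc]"
    "d_word q [gd, ga] = q \<odot>\<^bsub>\<Omega>\<^esub> d_word q [gb, gc]"
    by (simp_all add: s p A.space.smult_cancel field_simps power2_eq_square)
  show ?thesis
    unfolding SL2_compatible_def
    using two[OF word_relations(1) d(1)] two[OF word_relations(2) d(2)] two[OF word_relations(3) d(3)]
      two[OF word_relations(4) d(4)] two[OF _ d(5)] three[OF word_relations(6) d(6)]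
      three[OF word_relations(7) d(7)] word_relations(5)
    by (auto simp del: forms_simps d_word.simps simp: d_word_closed)
qed

abbreviation "d \<equiv> ext_d q"

lemma ext_d_linear: "linear_map A \<Omega> d"
  unfolding ext_d_def by (rule induced_linear[OF forms_space d_word_closed d_word_compatible])

lemma ext_d_word: "d (cl w) = d_word q w"
  unfolding ext_d_def by (rule induced_word[OF forms_space d_word_closed d_word_compatible])

lemma ext_d_closed: "x \<in> carrier A \<Longrightarrow> d x \<in> carrier \<Omega>"
  by (rule linear_mapD(1)[OF ext_d_linear])

lemma ext_d_mult:
  assumes x: "x \<in> carrier A" and y: "y \<in> carrier A"
  shows "d (x \<cdot> y) = d x \<leftharpoonup> y \<oplus>\<^bsub>\<Omega>\<^esub> x \<rightharpoonup> d y"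
proof -
  note c = ext_d_closed lact_ops ract_ops linear_mapD(2,3)[OF ext_d_linear]
  show ?thesis using x
  proof (induct rule: SL2_induct)
    case (word w e)
    show ?case using y
    proof (induct rule: SL2_induct)
      case (word v e')
      have "d (cl w \<cdot> cl v) = d (cl w) \<leftharpoonup> cl v \<oplus>\<^bsub>\<Omega>\<^esub> cl w \<rightharpoonup> d (cl v)"
        by (simp only: word_mult ext_d_word d_word_append)
      then show ?case
        by (simp del: forms_simps add: c A.smult_mult_left A.smult_mult_right Om.smult_add mult.commute)
    next
      case (add y y')
      then show ?case
        by (simp del: forms_simps add: c A.r_distr Om.a_ac)
    qed
  next
    case (add x x')
    then show ?case using y
      by (simp del: forms_simps add: c A.l_distr Om.a_ac)
  qed
qed

abbreviation "d_plus x \<equiv> fst (d x)"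
abbreviation "d_minus x \<equiv> fst (snd (d x))"
abbreviation "d_zero x \<equiv> snd (snd (d x))"

lemma forms_components:
  assumes "w \<in> carrier \<Omega>" "w' \<in> carrier \<Omega>"
  shows "fst (w \<oplus>\<^bsub>\<Omega>\<^esub> w') = fst w \<oplus>\<^sub>A fst w'"
    "fst (snd (w \<oplus>\<^bsub>\<Omega>\<^esub> w')) = fst (snd w) \<oplus>\<^sub>A fst (snd w')"
    "snd (snd (w \<oplus>\<^bsub>\<Omega>\<^esub> w')) = snd (snd w) \<oplus>\<^sub>A snd (snd w')"
    "fst (c \<odot>\<^bsub>\<Omega>\<^esub> w) = c \<bullet> fst w"
    "fst (snd (c \<odot>\<^bsub>\<Omega>\<^esub> w)) = c \<bullet> fst (snd w)"
    "snd (snd (c \<odot>\<^bsub>\<Omega>\<^esub> w)) = c \<bullet> snd (snd w)"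
    "fst (x \<rightharpoonup> w) = x \<cdot> fst w"
    "fst (snd (x \<rightharpoonup> w)) = x \<cdot> fst (snd w)"
    "snd (snd (x \<rightharpoonup> w)) = x \<cdot> snd (snd w)"
    "fst (w \<leftharpoonup> x) = fst w \<cdot> twist 1 x"
    "fst (snd (w \<leftharpoonup> x)) = fst (snd w) \<cdot> twist 1 x"
    "snd (snd (w \<leftharpoonup> x)) = snd (snd w) \<cdot> twist 2 x"
    "fst w \<in> carrier A" "fst (snd w) \<in> carrier A" "snd (snd w) \<in> carrier A"
  using assms by (cases w; cases w'; simp)+

lemma fst_linear: "linear_map \<Omega> A fst"
  by (rule linear_mapI) (simp_all del: forms_simps add: forms_components)

lemma fst_snd_linear: "linear_map \<Omega> A (\<lambda>w. fst (snd w))"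
  by (rule linear_mapI) (simp_all del: forms_simps add: forms_components)

lemma snd_snd_linear: "linear_map \<Omega> A (\<lambda>w. snd (snd w))"
  by (rule linear_mapI) (simp_all del: forms_simps add: forms_components)

lemmas d_plus_linear = linear_map_comp[OF ext_d_linear fst_linear]
lemmas d_minus_linear = linear_map_comp[OF ext_d_linear fst_snd_linear]
lemmas d_zero_linear = linear_map_comp[OF ext_d_linear snd_snd_linear]

lemma d_components_mult:
  assumes "x \<in> carrier A" "y \<in> carrier A"
  shows "d_plus (x \<cdot> y) = d_plus x \<cdot> twist 1 y \<oplus>\<^sub>A x \<cdot> d_plus y"
    "d_minus (x \<cdot> y) = d_minus x \<cdot> twist 1 y \<oplus>\<^sub>A x \<cdot> d_minus y"
    "d_zero (x \<cdot> y) = d_zero x \<cdot> twist 2 y \<oplus>\<^sub>A x \<cdot> d_zero y"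
  using assms ext_d_closed[OF assms(1)] ext_d_closed[OF assms(2)]
  by (simp_all del: forms_simps add: ext_d_mult forms_components lact_ops(1) ract_ops(1))

lemma ext_d_gen: "d (cl [g]) = d_gen q g"
  by (cases g) (simp_all add: ext_d_word word_Nil twist_one)

text \<open>The scalar depends only on the degree of the word: the second clause determines it unless
  \<open>q\<^sup>2 = 1\<close>, when the third one does.\<close>

lemma d_zero_word:
  "\<exists>c. d_zero (cl w) = c \<bullet> cl w \<and> c * (q ^ 2 - 1) = q powi (2 * word_degree w) - 1 \<and>
    (q ^ 2 = 1 \<longrightarrow> c = of_int (word_degree w))"
proof (induct w)
  case Nil
  then show ?case by (intro exI[of _ 0]) (simp add: ext_d_word)
next
  case (Cons g w)
  then obtain c where c: "d_zero (cl w) = c \<bullet> cl w" "c * (q ^ 2 - 1) = q powi (2 * word_degree w) - 1"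
    "q ^ 2 = 1 \<longrightarrow> c = of_int (word_degree w)" by auto
  \<comment> \<open>The e^0 coefficient of the differential of a generator: 1 on a and c, - q^-2 on
    b and d, the q^2-integers of 1 and -1.\<close>
  define e where "e = (if gen_degree g = 1 then 1 else - (q powi (- 2)))"
  have e: "d_zero (cl [g]) = e \<bullet> cl [g]"
    by (cases g) (simp_all add: ext_d_gen e_def)
  have p: "q powi (2 * (i + j)) = q powi (2 * i) * q powi (2 * j)" for i j
    by (simp add: distrib_left power_int_add)
  have e': "e * (q ^ 2 - 1) = q powi (2 * gen_degree g) - 1" "q ^ 2 = 1 \<longrightarrow> e = of_int (gen_degree g)"
    by (cases g; simp add: e_def power_int_minus field_simps)+
  \<comment> \<open>Leibniz rule for the first letter: moving e^0 past w costs q^(2 deg w). This is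
    the addition law of q^2-integers, and for q^2 = 1 it becomes the addition of degrees.\<close>
  let ?c = "e * q powi (2 * word_degree w) + c"
  have q2: "q powi (2 * i) = 1" if "q ^ 2 = 1" for i
    using that by (simp add: power_int_mult)
  have "d_zero (cl (g # w)) = ?c \<bullet> cl (g # w)"
    using d_components_mult(3)[of "cl [g]" "cl w"] c(1) e twist_word[of 2 w]
    by (simp add: word_mult A.smult_mult_left A.smult_mult_right A.space.smult_add_scalar mult.commute)
  moreover have "?c * (q ^ 2 - 1) = q powi (2 * word_degree (g # w)) - 1"
  proof -
    have "?c * (q ^ 2 - 1) = (e * (q ^ 2 - 1)) * q powi (2 * word_degree w) + c * (q ^ 2 - 1)"
      by (simp add: algebra_simps)
    also have "\<dots> = q powi (2 * word_degree (g # w)) - 1"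
      unfolding c(2) e'(1) word_degree_simps p by (simp add: left_diff_distrib)
    finally show ?thesis .
  qed
  moreover have "q ^ 2 = 1 \<longrightarrow> ?c = of_int (word_degree (g # w))"
    using c(3) e'(2) q2 by auto
  ultimately show ?case by blast
qed

text \<open>In degree 0 the scalar c obeys c (q^2 - 1) = 0, so it vanishes unless q^2 = 1, and then
  it equals the degree. Only e^+ and e^- remain on the sphere.\<close>

lemma d_zero_component:
  assumes "x \<in> Gr 0"
  shows "d_zero x = \<zero>\<^sub>A"
  using assms
proof (induct rule: component_induct)
  case zero
  then show ?case using linear_map_zero[OF A_space A_space d_zero_linear] .
next
  case (word w c)
  obtain e where e: "d_zero (cl w) = e \<bullet> cl w" "e * (q ^ 2 - 1) = q powi (2 * word_degree w) - 1"
    "q ^ 2 = 1 \<longrightarrow> e = of_int (word_degree w)" using d_zero_word by blast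
  have "e = 0" using e(2,3) word by (cases "q ^ 2 = 1") auto
  then show ?case using e(1) by (simp add: linear_mapD(3)[OF d_zero_linear])
qed (simp add: linear_mapD(2)[OF d_zero_linear])

text \<open>With e^+ counted in degree 2 and e^- in degree -2 the differential preserves the total
  degree, on generators by inspection and on words by the Leibniz rule.\<close>

lemma d_components_word:
  "d_plus (cl w) \<in> Gr (word_degree w - 2) \<and> d_minus (cl w) \<in> Gr (word_degree w + 2)"
proof (induct w)
  case Nil
  then show ?case by (simp add: ext_d_word)
next
  case (Cons g w)
  have g: "d_plus (cl [g]) \<in> Gr (gen_degree g - 2) \<and> d_minus (cl [g]) \<in> Gr (gen_degree g + 2)"
    by (cases g) (use word_component[of "[ga]"] word_component[of "[gb]"] word_component[of "[gc]"]
        word_component[of "[gd]"] in \<open>auto simp: ext_d_gen\<close>)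
  have t: "twist 1 (cl w) \<in> Gr (word_degree w)"
    using word_component[of w] by (simp add: twist_word)
  have cg: "cl [g] \<in> Gr (gen_degree g)" using word_component[of "[g]"] by simp
  have "d_plus (cl [g]) \<cdot> twist 1 (cl w) \<in> Gr (word_degree (g # w) - 2)"
    "cl [g] \<cdot> d_plus (cl w) \<in> Gr (word_degree (g # w) - 2)"
    "d_minus (cl [g]) \<cdot> twist 1 (cl w) \<in> Gr (word_degree (g # w) + 2)"
    "cl [g] \<cdot> d_minus (cl w) \<in> Gr (word_degree (g # w) + 2)"
    using component_mult[OF conjunct1[OF g] t] component_mult[OF cg conjunct1[OF Cons]]
      component_mult[OF conjunct2[OF g] t] component_mult[OF cg conjunct2[OF Cons]]
    by (simp_all add: algebra_simps)
  then show ?case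
    using d_components_mult(1,2)[of "cl [g]" "cl w"] by (simp add: word_mult)
qed

lemma d_plus_component: "x \<in> Gr m \<Longrightarrow> d_plus x \<in> Gr (m + - 2)"
  by (induct rule: component_induct)
    (use d_components_word in \<open>auto simp: linear_mapD[OF d_plus_linear]
      linear_map_zero[OF A_space A_space d_plus_linear]\<close>)

lemma d_minus_component: "x \<in> Gr m \<Longrightarrow> d_minus x \<in> Gr (m + 2)"
  by (induct rule: component_induct)
    (use d_components_word in \<open>auto simp: linear_mapD[OF d_minus_linear]
      linear_map_zero[OF A_space A_space d_minus_linear]\<close>)

abbreviation "right_map E \<equiv> tensor_map A A id E"

text \<open>On the generator matrix \<open>d_plus\<close> replaces the first column by q times the
  second and kills the second. The coproduct acts on rows, so the two commute. For
  \<open>d_minus\<close> the second column is replaced by the first, and the first is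
  killed.\<close>

lemma d_plus_gen: "\<Delta> (d_plus (cl [g])) = right_map d_plus (\<Delta> (cl [g]))"
proof -
  note l = tensor_map_id_linear[OF A_space A_space A_space d_plus_linear]
    and p = tensor_map_pure[OF A_space A_space A_space A_space linear_map_id d_plus_linear]
  show ?thesis
    by (cases g)
      (simp_all add: coproduct_gen linear_mapD[OF l] p ext_d_gen linear_mapD(3)[OF coproduct_linear]
        T.pure_smult_right AA.space.smult_add T.pure_zero_right
        linear_map_zero[OF A_space AA_space coproduct_linear])
qed

lemma d_minus_gen: "\<Delta> (d_minus (cl [g])) = right_map d_minus (\<Delta> (cl [g]))"
proof -
  note l = tensor_map_id_linear[OF A_space A_space A_space d_minus_linear]
    and p = tensor_map_pure[OF A_space A_space A_space A_space linear_map_id d_minus_linear]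
  show ?thesis
    by (cases g)
      (simp_all add: coproduct_gen linear_mapD[OF l] p ext_d_gen T.pure_zero_right
        linear_map_zero[OF A_space AA_space coproduct_linear])
qed

end

section \<open>Homogeneous line subcalculi\<close>

text \<open>\<open>J\<close> is \<open>x \<mapsto> x e\<^sup>\<plusminus>\<close>, \<open>P\<close> reads off the coefficient of \<open>e\<^sup>\<plusminus>\<close>, and \<open>E\<close> is that
  coefficient of the differential.\<close>

locale line_calculus = quantum_SL2 q for q +
  fixes n :: int and J P E
  assumes J_linear: "linear_map A \<Omega> J" and P_linear: "linear_map \<Omega> A P"
    and P_J [simp]: "x \<in> carrier A \<Longrightarrow> P (J x) = x"
    and lact_J: "f \<in> carrier A \<Longrightarrow> x \<in> carrier A \<Longrightarrow> f \<rightharpoonup> J x = J (f \<cdot> x)"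
    and ract_J: "f \<in> carrier A \<Longrightarrow> x \<in> carrier A \<Longrightarrow> J x \<leftharpoonup> f = J (x \<cdot> twist 1 f)"
    and E_linear: "linear_map A A E"
    and E_mult: "x \<in> carrier A \<Longrightarrow> y \<in> carrier A
      \<Longrightarrow> E (x \<cdot> y) = E x \<cdot> twist 1 y \<oplus>\<^sub>A x \<cdot> E y"
    and E_component: "x \<in> Gr m \<Longrightarrow> E x \<in> Gr (m + n)"
    and E_gen: "\<Delta> (E (cl [g])) = right_map E (\<Delta> (cl [g]))"
    and E_span: "\<exists>s\<^sub>1 s\<^sub>2 s\<^sub>3 t\<^sub>1 t\<^sub>2 t\<^sub>3. {s\<^sub>1, s\<^sub>2, s\<^sub>3} \<subseteq> Gr (- n) \<and> {t\<^sub>1, t\<^sub>2, t\<^sub>3} \<subseteq> Gr 0 \<and>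
      s\<^sub>1 \<cdot> E t\<^sub>1 \<oplus>\<^sub>A (s\<^sub>2 \<cdot> E t\<^sub>2 \<oplus>\<^sub>A s\<^sub>3 \<cdot> E t\<^sub>3) = \<one>\<^sub>A"
begin

abbreviation "L \<equiv> \<Omega>\<lparr>carrier := J ` Gr n\<rparr>"
abbreviation "\<delta> f \<equiv> J (E f)"

lemma L_subspace: "submodule (J ` Gr n) complex_ring \<Omega>"
proof (rule Om.subspaceI)
  show "J ` Gr n \<subseteq> carrier \<Omega>" using linear_mapD(1)[OF J_linear] component_closed by blast
  show "\<zero>\<^bsub>\<Omega>\<^esub> \<in> J ` Gr n"
    using linear_map_zero[OF A_space forms_space J_linear] component_ops(1) by (metis imageI)
  show "x \<oplus>\<^bsub>\<Omega>\<^esub> y \<in> J ` Gr n" if "x \<in> J ` Gr n" "y \<in> J ` Gr n" for x y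
  proof -
    from that(1) obtain x' where x: "x = J x'" "x' \<in> Gr n" by (rule imageE)
    from that(2) obtain y' where "y = J y'" "y' \<in> Gr n" by (rule imageE)
    with x have "x \<oplus>\<^bsub>\<Omega>\<^esub> y = J (x' \<oplus>\<^sub>A y')" "x' \<oplus>\<^sub>A y' \<in> Gr n"
      by (simp_all only: linear_mapD(2)[OF J_linear component_closed component_closed] component_ops)
    then show ?thesis by blast
  qed
  show "c \<odot>\<^bsub>\<Omega>\<^esub> x \<in> J ` Gr n" if "x \<in> J ` Gr n" for c x
  proof -
    from that obtain x' where "x = J x'" "x' \<in> Gr n" by (rule imageE)
    then have "c \<odot>\<^bsub>\<Omega>\<^esub> x = J (c \<bullet> x')" "c \<bullet> x' \<in> Gr n"
      by (simp_all only: linear_mapD(3)[OF J_linear component_closed] component_ops)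
    then show ?thesis by blast
  qed
qed

lemma L_space: "complex_space L"
  by (rule Om.subspace_space[OF L_subspace])

lemma twist_B [simp]: "f \<in> Gr 0 \<Longrightarrow> twist k f = f"
  by (simp add: twist_component component_closed)

lemma L_bimodule: "algebra_bimodule B L"
  by (rule sub_bimodule[OF forms_bimodule B_algebra _ _ _ _ _ L_subspace])
    (auto simp: component_closed lact_J ract_J)

lemma E_closed [simp]: "x \<in> carrier A \<Longrightarrow> E x \<in> carrier A"
  by (rule linear_mapD(1)[OF E_linear])

lemma E_B [simp]: "x \<in> Gr 0 \<Longrightarrow> E x \<in> Gr n"
  using E_component[of x 0] by simp

lemma delta_linear: "linear_map B L \<delta>"
  by (rule linear_mapI)
    (auto simp: component_closed linear_mapD[OF E_linear] linear_mapD[OF J_linear])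

lemma calculus: "first_order_calculus B L \<delta>"
proof (unfold first_order_calculus_def, intro conjI L_bimodule, unfold_locales)
  interpret L: complex_space L by (rule L_space)
  show "linear_map B L \<delta>" by (rule delta_linear)
  show "\<delta> (x \<otimes>\<^bsub>B\<^esub> y) = \<delta> x \<triangleleft>\<^bsub>L\<^esub> y \<oplus>\<^bsub>L\<^esub> x \<triangleright>\<^bsub>L\<^esub> \<delta> y" if "x \<in> carrier B" "y \<in> carrier B" for x y
    using that
    by (simp add: component_closed E_mult lact_J ract_J linear_mapD[OF J_linear])
  let ?S = "{x \<triangleright>\<^bsub>L\<^esub> \<delta> y | x y. x \<in> carrier B \<and> y \<in> carrier B}"
  have S: "?S \<subseteq> carrier L"
    by (auto simp: component_closed lact_J)
  have "w \<in> cspan L ?S" if "w \<in> carrier L" for w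
  proof -
    from that have "w \<in> J ` Gr n" by simp
    then obtain x where x: "w = J x" "x \<in> Gr n" by (rule imageE)
    obtain s1 s2 s3 t1 t2 t3 where s: "s1 \<in> Gr (- n)" "s2 \<in> Gr (- n)" "s3 \<in> Gr (- n)"
      and t: "t1 \<in> Gr 0" "t2 \<in> Gr 0" "t3 \<in> Gr 0"
      and one: "s1 \<cdot> E t1 \<oplus>\<^sub>A (s2 \<cdot> E t2 \<oplus>\<^sub>A s3 \<cdot> E t3) = \<one>\<^sub>A"
      using E_span by auto
    have xs: "x \<cdot> s1 \<in> Gr 0" "x \<cdot> s2 \<in> Gr 0" "x \<cdot> s3 \<in> Gr 0"
      using component_mult[OF x(2) s(1)] component_mult[OF x(2) s(2)] component_mult[OF x(2) s(3)] by simp_all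
    note c = component_closed[OF x(2)] component_closed[OF s(1)] component_closed[OF s(2)]
      component_closed[OF s(3)] component_closed[OF t(1)] component_closed[OF t(2)] component_closed[OF t(3)]
    \<comment> \<open>Multiplying the partition of unity by x of degree n brings the left factors to
      degree 0, that is, into the sphere.\<close>
    have "x = x \<cdot> (s1 \<cdot> E t1 \<oplus>\<^sub>A (s2 \<cdot> E t2 \<oplus>\<^sub>A s3 \<cdot> E t3))"
      unfolding one using c by simp
    also have "\<dots> = (x \<cdot> s1) \<cdot> E t1 \<oplus>\<^sub>A ((x \<cdot> s2) \<cdot> E t2 \<oplus>\<^sub>A (x \<cdot> s3) \<cdot> E t3)"
      using c by (simp add: A.r_distr A.m_assoc)
    finally have xe: "x = (x \<cdot> s1) \<cdot> E t1 \<oplus>\<^sub>A ((x \<cdot> s2) \<cdot> E t2 \<oplus>\<^sub>A (x \<cdot> s3) \<cdot> E t3)" .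
    have "w = (x \<cdot> s1) \<triangleright>\<^bsub>L\<^esub> \<delta> t1 \<oplus>\<^bsub>L\<^esub> ((x \<cdot> s2) \<triangleright>\<^bsub>L\<^esub> \<delta> t2 \<oplus>\<^bsub>L\<^esub> (x \<cdot> s3) \<triangleright>\<^bsub>L\<^esub> \<delta> t3)"
      unfolding x(1) by (subst xe) (use c in \<open>simp add: lact_J linear_mapD[OF J_linear]\<close>)
    moreover have "(x \<cdot> s1) \<triangleright>\<^bsub>L\<^esub> \<delta> t1 \<in> cspan L ?S" "(x \<cdot> s2) \<triangleright>\<^bsub>L\<^esub> \<delta> t2 \<in> cspan L ?S"
      "(x \<cdot> s3) \<triangleright>\<^bsub>L\<^esub> \<delta> t3 \<in> cspan L ?S"
      using xs t by (auto intro!: L.cspan_incl)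
    ultimately show ?thesis
      using L.subspaceD(3)[OF L.cspan_subspace[OF S]] by simp
  qed
  then show "carrier L = cspan L ?S"
    using L.cspan_carrier[OF S] by blast
qed

end

text \<open>The simplifier would replace an unapplied \<open>id\<close> by \<open>\<lambda>x. x\<close>, and the rules for
  \<open>tensor_map A W id\<close> would no longer apply.\<close>

declare id_apply [simp del]

context line_calculus
begin

section \<open>The coaction on the line of forms\<close>

text \<open>J lands in L only on degree n. Projecting first gives a linear map on all of A, so that
  it can be tensored and applied to any element of A \<otimes> A.\<close>

definition Jn where "Jn y = J (proj n y)"

lemma Jn_linear: "linear_map A L Jn"
  by (intro linear_mapI)
    (simp_all add: Jn_def proj_closed linear_mapD(2,3)[OF proj_linear] linear_mapD(2,3)[OF J_linear]
      component_closed[OF proj_closed])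

lemma Jn_component [simp]: "y \<in> Gr n \<Longrightarrow> Jn y = J y"
  by (simp add: Jn_def)

abbreviation "right_J \<equiv> tensor_map A L id Jn"

lemmas right_J_linear = tensor_map_id_linear[OF A_space A_space L_space Jn_linear]
lemmas right_J_pure = tensor_map_id_pure[OF A_space A_space L_space Jn_linear]

definition \<rho> where "\<rho> w = right_J (\<Delta> (P w))"

lemma P_linear_L: "linear_map L A P"
proof -
  have "w \<in> carrier \<Omega>" if "w \<in> carrier L" for w
    by (rule subsetD[OF Om.subspaceD(1)[OF L_subspace]]) (use that in simp)
  then show ?thesis
    by (intro linear_mapI) (simp_all del: forms_simps add: linear_mapD[OF P_linear])
qed

lemma \<rho>_linear: "linear_map L (tensor A L) \<rho>"
  unfolding \<rho>_def
  by (rule linear_map_comp[OF linear_map_comp[OF P_linear_L coproduct_linear] right_J_linear])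

lemma \<rho>_J: "y \<in> Gr n \<Longrightarrow> \<rho> (J y) = right_J (\<Delta> y)"
  by (simp add: \<rho>_def component_closed)

lemma L_elim:
  assumes "w \<in> carrier L"
  obtains y where "w = J y" "y \<in> Gr n"
proof -
  from assms have "w \<in> J ` Gr n" by simp
  then show thesis by (rule imageE) (rule that)
qed

lemma coaction: "left_coaction A \<Delta> \<epsilon> L \<rho>"
  unfolding left_coaction_def
proof (intro conjI ballI \<rho>_linear)
  interpret AL: tensor_product A L by (rule tensor_productI[OF A_space L_space])
  interpret L: complex_space L by (rule L_space)
  fix v assume "v \<in> carrier L"
  then obtain y where v: "v = J y" and y: "y \<in> Gr n" by (rule L_elim)
  note yc = component_closed[OF y]
  show "tensor_assoc A A L (tensor_map AA L \<Delta> id (\<rho> v)) = tensor_map A (tensor A L) id \<rho> (\<rho> v)"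
  proof -
    \<comment> \<open>The coproduct acts on the left leg and \<open>Jn\<close> on the right one, so
      their order is immaterial; naturality of rebracketing then reduces the claim to
      coassociativity in A.\<close>
    have "tensor_map AA L \<Delta> id (right_J (\<Delta> y)) = tensor_map AA L id Jn (tensor_map AA A \<Delta> id (\<Delta> y))"
      using tensor_map_comp[OF A_space A_space A_space L_space AA_space L_space
          linear_map_id Jn_linear coproduct_linear linear_map_id coproduct_closed[OF yc]]
        tensor_map_comp[OF A_space A_space AA_space A_space AA_space L_space
          coproduct_linear linear_map_id linear_map_id Jn_linear coproduct_closed[OF yc]]
      by (simp add: id_apply)
    moreover have "tensor_assoc A A L (tensor_map AA L id Jn (tensor_map AA A \<Delta> id (\<Delta> y)))
        = tensor_map A (tensor A L) id right_J (tensor_assoc A A A (tensor_map AA A \<Delta> id (\<Delta> y)))"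
      by (rule tensor_assoc_natural[OF A_space A_space A_space L_space Jn_linear])
        (rule linear_mapD(1)[OF tensor_map_linear[OF A_space A_space AA_space A_space
              coproduct_linear linear_map_id] coproduct_closed[OF yc]])
    moreover have "\<dots> = tensor_map A (tensor A L) id right_J (tensor_map A AA id \<Delta> (\<Delta> y))"
      by (simp only: coassociative[OF yc])
    \<comment> \<open>Here the degree matters: \<rho>(J z) is computed from the coproduct of z only
      for z in degree n, and the right legs of the coproduct of y have this degree.\<close>
    moreover have "\<dots> = tensor_map A (tensor A L) id \<rho> (right_J (\<Delta> y))"
    proof (rule right_comp_eqI[OF _ _ _ _ coproduct_right_comp[OF y]])
      note AL_space = AL.tensor_space
      interpret ALL: tensor_product A "tensor A L" by (rule tensor_productI[OF A_space AL_space])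
      note l1 = tensor_map_id_linear[OF A_space A_space AA_space coproduct_linear]
        and p1 = tensor_map_id_pure[OF A_space A_space AA_space coproduct_linear]
      note l2 = tensor_map_id_linear[OF A_space AA_space AL_space right_J_linear]
        and p2 = tensor_map_id_pure[OF A_space AA_space AL_space right_J_linear]
      note l3 = tensor_map_id_linear[OF A_space L_space AL_space \<rho>_linear]
        and p3 = tensor_map_id_pure[OF A_space L_space AL_space \<rho>_linear]
      show "complex_space (tensor A (tensor A L))" by (rule ALL.tensor_space)
      show "linear_map AA (tensor A (tensor A L)) (\<lambda>t. tensor_map A (tensor A L) id right_J (tensor_map A AA id \<Delta> t))"
        by (rule linear_map_comp[OF l1 l2])
      show "linear_map AA (tensor A (tensor A L)) (\<lambda>t. tensor_map A (tensor A L) id \<rho> (right_J t))"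
        by (rule linear_map_comp[OF right_J_linear l3])
      show "tensor_map A (tensor A L) id right_J (tensor_map A AA id \<Delta> (pt x z))
        = tensor_map A (tensor A L) id \<rho> (right_J (pt x z))" if "x \<in> carrier A" "z \<in> Gr n" for x z
      proof -
        have z: "z \<in> carrier A" "J z \<in> carrier L" using that component_closed by auto
        show ?thesis
          unfolding p1[OF that(1) z(1)] p2[OF that(1) coproduct_closed[OF z(1)]]
            right_J_pure[OF that(1) z(1)] Jn_component[OF that(2)] p3[OF that(1) z(2)] \<rho>_J[OF that(2)] ..
      qed
    qed
    ultimately show ?thesis using \<rho>_J[OF y] v by simp
  qed
  let ?\<kappa> = "induced_map A (\<lambda>(h, w). \<epsilon> h \<bullet> w)" and ?\<kappa>L = "induced_map L (\<lambda>(h, w). \<epsilon> h \<odot>\<^bsub>L\<^esub> w)"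
  note b = counit_smult_bilinear[OF L_space] and b' = counit_smult_bilinear[OF A_space]
  have "?\<kappa>L (right_J (\<Delta> y)) = Jn (?\<kappa> (\<Delta> y))"
  proof (rule T.linear_eq_on_pure[OF _ _ _ coproduct_closed[OF yc]])
    show "linear_map AA L (\<lambda>t. ?\<kappa>L (right_J t))"
      by (rule linear_map_comp[OF right_J_linear AL.lift_linear[OF L_space b]])
    show "linear_map AA L (\<lambda>t. Jn (?\<kappa> t))"
      by (rule linear_map_comp[OF T.lift_linear[OF A_space b'] Jn_linear])
    show "?\<kappa>L (right_J (pt x z)) = Jn (?\<kappa> (pt x z))" if "x \<in> carrier A" "z \<in> carrier A" for x z
      unfolding right_J_pure[OF that] AL.lift_pure[OF L_space b that(1) linear_mapD(1)[OF Jn_linear that(2)]]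
        T.lift_pure[OF A_space b' that] linear_mapD(3)[OF Jn_linear that(2)] ..
  qed
  then show "?\<kappa>L (\<rho> v) = v"
    unfolding v \<rho>_J[OF y] counital[OF yc] Jn_component[OF y] .
qed

section \<open>Left invariance of the differential\<close>

text \<open>A word and all right legs of its coproduct have the same degree, so both twists are
  multiplication by one scalar.\<close>

lemma coproduct_twist: "\<Delta> (twist k (cl w)) = right_map (twist k) (\<Delta> (cl w))"
proof -
  note l = tensor_map_id_linear[OF A_space A_space A_space twist_linear]
    and p = tensor_map_id_pure[OF A_space A_space A_space twist_linear]
  let ?c = "q powi (k * word_degree w)"
  have "right_map (twist k) (\<Delta> (cl w)) = ?c \<odot>\<^bsub>AA\<^esub> id (\<Delta> (cl w))"
    by (rule right_comp_eqI[OF AA_space l linear_map_smult[OF linear_map_id AA_space] _ word_coproduct_right_comp])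
      (simp add: p component_closed twist_component T.pure_smult_right id_apply)
  then show ?thesis by (simp add: twist_word linear_mapD(3)[OF coproduct_linear] id_apply)
qed

lemma right_E_mult:
  assumes s: "s \<in> carrier AA" and t: "t \<in> carrier AA"
  shows "right_map E (s \<otimes>\<^bsub>AA\<^esub> t)
    = right_map E s \<otimes>\<^bsub>AA\<^esub> right_map (twist 1) t \<oplus>\<^bsub>AA\<^esub> s \<otimes>\<^bsub>AA\<^esub> right_map E t"
proof -
  note l = tensor_map_id_linear[OF A_space A_space A_space E_linear]
    and p = tensor_map_id_pure[OF A_space A_space A_space E_linear]
  note l' = tensor_map_id_linear[OF A_space A_space A_space twist_linear]
    and p' = tensor_map_id_pure[OF A_space A_space A_space twist_linear]
  show ?thesis using s
  proof (induct rule: T.tensor_induct)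
    case (pure x y)
    show ?case using t
    proof (induct rule: T.tensor_induct)
      case (pure x' y')
      then show ?case using \<open>x \<in> carrier A\<close> \<open>y \<in> carrier A\<close>
        by (simp add: pt_mult p p' E_mult T.pure_add_right)
    next
      case (add t t')
      then show ?case using \<open>x \<in> carrier A\<close> \<open>y \<in> carrier A\<close>
        by (simp add: AA.r_distr linear_mapD[OF l] linear_mapD[OF l'] AA.a_ac p)
    qed
  next
    case (add s s')
    then show ?case using t
      by (simp add: AA.l_distr linear_mapD[OF l] linear_mapD[OF l'] AA.a_ac)
  qed
qed

text \<open>Both sides obey the same twisted Leibniz rule over the coproduct, so agreement spreads
  from generators to words.\<close>

lemma coproduct_E_word: "\<Delta> (E (cl w)) = right_map E (\<Delta> (cl w))"
proof (induct w)
  case Nil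
  note p = tensor_map_id_pure[OF A_space A_space A_space E_linear]
  \<comment> \<open>The Leibniz rule for 1 = 1 \<cdot> 1 shows that E kills the unit.\<close>
  have "E \<one>\<^sub>A = E \<one>\<^sub>A \<oplus>\<^sub>A E \<one>\<^sub>A"
    using E_mult[of "\<one>\<^sub>A" "\<one>\<^sub>A"] by (simp add: twist_one)
  then have "E \<one>\<^sub>A = \<zero>\<^sub>A"
    by (metis A.add.l_cancel_one' A.one_closed E_closed)
  then show ?case
    by (simp add: word_Nil coproduct_one pt_one p T.pure_zero_right
        linear_map_zero[OF A_space AA_space coproduct_linear])
next
  case (Cons g w)
  have "\<Delta> (E (cl [g] \<cdot> cl w))
      = \<Delta> (E (cl [g])) \<otimes>\<^bsub>AA\<^esub> \<Delta> (twist 1 (cl w)) \<oplus>\<^bsub>AA\<^esub> \<Delta> (cl [g]) \<otimes>\<^bsub>AA\<^esub> \<Delta> (E (cl w))"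
    by (simp add: E_mult linear_mapD(2)[OF coproduct_linear] coproduct_mult)
  also have "\<dots> = right_map E (\<Delta> (cl [g]) \<otimes>\<^bsub>AA\<^esub> \<Delta> (cl w))"
    unfolding E_gen Cons coproduct_twist by (rule right_E_mult[symmetric]) simp_all
  also have "\<dots> = right_map E (\<Delta> (cl [g] \<cdot> cl w))"
    by (simp add: coproduct_mult)
  finally show ?case by (simp only: word_mult append_Cons append_Nil)
qed

lemma coproduct_E:
  assumes "x \<in> carrier A"
  shows "\<Delta> (E x) = right_map E (\<Delta> x)"
  by (rule linear_eq_on_words[OF linear_map_comp[OF E_linear coproduct_linear]
        linear_map_comp[OF coproduct_linear tensor_map_id_linear[OF A_space A_space A_space E_linear]]
        coproduct_E_word assms])

section \<open>Compatibility of the coaction with both module structures\<close>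

abbreviation "right_B \<equiv> tensor_map A B id (proj 0)"

lemmas right_B_linear = tensor_map_id_linear[OF A_space A_space B_space proj_linear_B]
lemmas right_B_pure = tensor_map_id_pure[OF A_space A_space B_space proj_linear_B]

lemma mult_bilinear: "bilinear_map A A A (monoid.mult A)"
  by (intro bilinear_mapI linear_mapI)
    (simp_all add: A.l_distr A.r_distr A.smult_mult_left A.smult_mult_right)

lemma lact_bilinear: "bilinear_map B L L (lact L)"
proof -
  interpret L: algebra_bimodule B L by (rule L_bimodule)
  show ?thesis by (intro bilinear_mapI L.lact_linear_left L.lact_linear)
qed

lemma ract_bilinear: "bilinear_map L B L (ract L)"
proof -
  interpret L: algebra_bimodule B L by (rule L_bimodule)
  show ?thesis by (intro bilinear_mapI L.ract_linear_right L.ract_linear)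
qed

text \<open>Translates multiplicativity of the coproduct into compatibility with the left action.
  The degrees 0 and n of the right legs ensure that neither projection alters anything.\<close>

lemma right_J_mult_left:
  assumes s: "s \<in> right_comp 0" and t: "t \<in> right_comp n"
  shows "right_J (s \<otimes>\<^bsub>AA\<^esub> t) = tensor_map2 A L (monoid.mult A) (lact L) (right_B s) (right_J t)"
proof -
  note sp = A_space B_space A_space L_space A_space L_space
  note b = tensor_map2_bilinear[OF sp mult_bilinear lact_bilinear]
  \<comment> \<open>L differs from \<Omega> only in its carrier, and simplification rewrites its
    action to that of \<Omega>; the facts on \<open>tensor_map2\<close> must be put in the same
    form.\<close>
  have act: "lact L = lact \<Omega>" by simp
  note bl = linear_mapD[OF bilinear_mapD(1)[OF b], unfolded act]
    and br = linear_mapD[OF bilinear_mapD(2)[OF b], unfolded act]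
  note p = tensor_map2_pure[OF sp mult_bilinear lact_bilinear]
  note jl = linear_mapD[OF right_J_linear] and Bl = linear_mapD[OF right_B_linear]
  interpret AB: tensor_product A B by (rule tensor_productI[OF A_space B_space])
  note tc = right_comp_closed[OF t]
  show ?thesis using s
  proof (induct rule: right_comp_induct)
    case xy: (pure x y)
    note yc = component_closed[OF xy(2)]
    have pB: "pure_tensor A B x y \<in> carrier AB" using xy by (intro AB.pure_closed) simp_all
    show ?case using t
    proof (induct rule: right_comp_induct)
      case (pure x' y')
      note y'c = component_closed[OF pure(2)]
      have J: "J y' \<in> carrier L" and y: "y \<in> carrier B" using pure xy by simp_all
      have m: "y \<cdot> y' \<in> Gr n" using xy pure by simp
      show ?case
        unfolding pt_mult[OF xy(1) yc pure(1) y'c] right_B_pure[OF xy(1) yc] right_J_pure[OF pure(1) y'c]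
          right_J_pure[OF A.m_closed[OF xy(1) pure(1)] A.m_closed[OF yc y'c]] proj_component[OF xy(2)]
          Jn_component[OF pure(2)] Jn_component[OF m] p[OF xy(1) y pure(1) J]
        by (simp add: lact_J yc y'c)
    next
      case (add t t')
      then show ?case
        using xy(1) yc pB jl(1)
        by (simp add: AA.r_distr jl(2) br(2) right_B_pure xy(2))
    qed
  next
    case (add s s')
    then show ?case
      using tc jl(1)[OF tc] Bl(1) by (simp add: AA.l_distr jl(2) Bl(2) bl(2))
  qed
qed

text \<open>The mirror image works without extra scalars because the twist in the right action is
  the identity in degree 0.\<close>

lemma right_J_mult_right:
  assumes s: "s \<in> right_comp 0" and t: "t \<in> right_comp n"
  shows "right_J (t \<otimes>\<^bsub>AA\<^esub> s) = tensor_map2 A L (monoid.mult A) (ract L) (right_J t) (right_B s)"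
proof -
  note sp = A_space L_space A_space B_space A_space L_space
  note b = tensor_map2_bilinear[OF sp mult_bilinear ract_bilinear]
  have act: "ract L = ract \<Omega>" by simp
  note bl = linear_mapD[OF bilinear_mapD(1)[OF b], unfolded act]
    and br = linear_mapD[OF bilinear_mapD(2)[OF b], unfolded act]
  note p = tensor_map2_pure[OF sp mult_bilinear ract_bilinear]
  note jl = linear_mapD[OF right_J_linear] and Bl = linear_mapD[OF right_B_linear]
  interpret AB: tensor_product A B by (rule tensor_productI[OF A_space B_space])
  note tc = right_comp_closed[OF t]
  show ?thesis using s
  proof (induct rule: right_comp_induct)
    case xy: (pure x y)
    note yc = component_closed[OF xy(2)]
    have pB: "pure_tensor A B x y \<in> carrier AB" using xy by (intro AB.pure_closed) simp_all
    show ?case using t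
    proof (induct rule: right_comp_induct)
      case (pure x' y')
      note y'c = component_closed[OF pure(2)]
      have J: "J y' \<in> carrier L" and y: "y \<in> carrier B" using pure xy by simp_all
      have m: "y' \<cdot> y \<in> Gr n" using xy pure by simp
      show ?case
        unfolding pt_mult[OF pure(1) y'c xy(1) yc] right_B_pure[OF xy(1) yc] right_J_pure[OF pure(1) y'c]
          right_J_pure[OF A.m_closed[OF pure(1) xy(1)] A.m_closed[OF y'c yc]] proj_component[OF xy(2)]
          Jn_component[OF pure(2)] Jn_component[OF m] p[OF pure(1) J xy(1) y]
        by (simp add: ract_J yc y'c xy(2))
    next
      case (add t t')
      then show ?case
        using xy(1) yc pB jl(1)
        by (simp add: AA.l_distr jl(2) bl(2) right_B_pure xy(2))
    qed
  next
    case (add s s')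
    then show ?case
      using tc jl(1)[OF tc] Bl(1) by (simp add: AA.r_distr jl(2) Bl(2) br(2))
  qed
qed

text \<open>Compatibility with the actions is multiplicativity of the coproduct; the intertwining
  property is \<open>coproduct_E\<close> read on tensors with right leg in degree 0.\<close>

lemma covariant: "left_covariant A \<Delta> \<epsilon> B (coaction_S2 q) L \<delta>"
  unfolding left_covariant_def
proof (intro exI[of _ \<rho>] conjI ballI coaction)
  fix x assume "x \<in> carrier B"
  then have x: "x \<in> Gr 0" by simp
  note xc = component_closed[OF x] and xr = coproduct_right_comp[OF x]
  show "\<rho> (\<delta> x) = tensor_map A L id \<delta> (coaction_S2 q x)"
  proof -
    note sp = A_space B_space A_space L_space and spE = A_space A_space A_space A_space
    have "\<rho> (\<delta> x) = right_J (right_map E (\<Delta> x))"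
      using \<rho>_J[of "E x"] coproduct_E[OF xc] x by simp
    also have "\<dots> = tensor_map A L id \<delta> (right_B (\<Delta> x))"
    proof (rule right_comp_eqI[OF _ _ _ _ xr])
      interpret AL: tensor_product A L by (rule tensor_productI[OF A_space L_space])
      show "complex_space (tensor A L)" by (rule AL.tensor_space)
      show "linear_map AA (tensor A L) (\<lambda>t. right_J (right_map E t))"
        by (rule linear_map_comp[OF tensor_map_linear[OF spE linear_map_id E_linear] right_J_linear])
      show "linear_map AA (tensor A L) (\<lambda>t. tensor_map A L id \<delta> (right_B t))"
        by (rule linear_map_comp[OF right_B_linear tensor_map_linear[OF sp linear_map_id delta_linear]])
      show "right_J (right_map E (pt u y)) = tensor_map A L id \<delta> (right_B (pt u y))"
        if u: "u \<in> carrier A" and y: "y \<in> Gr 0" for u y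
        unfolding tensor_map_id_pure[OF A_space A_space A_space E_linear u component_closed[OF y]]
          right_J_pure[OF u E_closed[OF component_closed[OF y]]] Jn_component[OF E_B[OF y]]
          right_B_pure[OF u component_closed[OF y]] proj_component[OF y]
        by (rule tensor_map_id_pure[OF A_space B_space L_space delta_linear u, symmetric]) (simp add: y)
    qed
    finally show ?thesis unfolding coaction_S2_eq[OF x] .
  qed
  fix w assume "w \<in> carrier L"
  then obtain y where w: "w = J y" and y: "y \<in> Gr n" by (rule L_elim)
  note yc = component_closed[OF y] and yr = coproduct_right_comp[OF y]
  have xw: "x \<triangleright>\<^bsub>L\<^esub> w = J (x \<cdot> y)" "w \<triangleleft>\<^bsub>L\<^esub> x = J (y \<cdot> x)"
    using w x xc yc lact_J ract_J by simp_all
  have xy: "x \<cdot> y \<in> Gr n" "y \<cdot> x \<in> Gr n" using x y by simp_all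
  show "\<rho> (x \<triangleright>\<^bsub>L\<^esub> w) = tensor_map2 A L (monoid.mult A) (lact L) (coaction_S2 q x) (\<rho> w)"
    unfolding coaction_S2_eq[OF x] xw unfolding w \<rho>_J[OF y] \<rho>_J[OF xy(1)] coproduct_mult[OF xc yc]
    by (rule right_J_mult_left[OF xr yr])
  show "\<rho> (w \<triangleleft>\<^bsub>L\<^esub> x) = tensor_map2 A L (monoid.mult A) (ract L) (\<rho> w) (coaction_S2 q x)"
    unfolding coaction_S2_eq[OF x] xw unfolding w \<rho>_J[OF y] \<rho>_J[OF xy(2)] coproduct_mult[OF yc xc]
    by (rule right_J_mult_right[OF xr yr])
qed

end

context quantum_SL2
begin

section \<open>The sphere generators and the two partitions of unity\<close>

lemma b_products: "b_minus q = xa \<cdot> xb" "b_zero q = xb \<cdot> xc" "b_plus q = xc \<cdot> xd"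
  by (simp_all add: b_minus_def b_zero_def b_plus_def word_mult)

lemma b_components [simp]: "b_minus q \<in> Gr 0" "b_zero q \<in> Gr 0" "b_plus q \<in> Gr 0"
  using word_component[of "[ga, gb]"] word_component[of "[gb, gc]"] word_component[of "[gc, gd]"]
  by (simp_all add: b_minus_def b_zero_def b_plus_def)

lemma power_int_eqs:
  "q powi 2 = q * q" "q powi 4 = q * q * q * q" "q powi 3 = q * q * q"
  "q powi (- 2) = inverse q * inverse q"
  "q powi (- 3) = inverse q * inverse q * inverse q"
  "q powi (- 4) = inverse q * inverse q * inverse q * inverse q"
  by (simp_all add: power_int_minus power2_eq_square power3_eq_cube power4_eq_xxxx)

lemma d_b:
  "d (b_minus q) = (xb \<cdot> xb, xa \<cdot> xa, \<zero>\<^sub>A)"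
  "d (b_zero q) = (xd \<cdot> xb, xc \<cdot> xa, \<zero>\<^sub>A)"
  "d (b_plus q) = (xd \<cdot> xd, xc \<cdot> xc, \<zero>\<^sub>A)"
  unfolding b_minus_def b_zero_def b_plus_def ext_d_word
  by (simp_all add: word_Nil twist_word twist_one A_normal A.a_ac power_int_eqs A.space.smult_cancel
      field_simps power2_eq_square)

text \<open>With the antipode a -> d, b -> - q b, c -> - q^-1 c, d -> a, the left factors are the
  antipodes of those in the coproduct d^2 -> c^2 \<otimes> b^2 + (q + q^-1) cd \<otimes> db + d^2
  \<otimes> d^2. The coproduct of c^2 has the same left factors with right factors a^2, ca, c^2; the
  counit is 1 on d^2 and 0 on c^2.\<close>

lemma plus_span:
  defines "s \<equiv> xa \<cdot> xa" and "s' \<equiv> (- (inverse q + inverse q ^ 3)) \<bullet> (xc \<cdot> xa)"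
    and "s'' \<equiv> (inverse q ^ 2) \<bullet> (xc \<cdot> xc)"
  shows "s \<cdot> d_plus (b_plus q) \<oplus>\<^sub>A (s' \<cdot> d_plus (b_zero q) \<oplus>\<^sub>A s'' \<cdot> d_plus (b_minus q)) = \<one>\<^sub>A"
    "s \<cdot> d_minus (b_plus q) \<oplus>\<^sub>A (s' \<cdot> d_minus (b_zero q) \<oplus>\<^sub>A s'' \<cdot> d_minus (b_minus q)) = \<zero>\<^sub>A"
    "s \<in> Gr 2" "s' \<in> Gr 2" "s'' \<in> Gr 2"
proof -
  show "s \<cdot> d_plus (b_plus q) \<oplus>\<^sub>A (s' \<cdot> d_plus (b_zero q) \<oplus>\<^sub>A s'' \<cdot> d_plus (b_minus q)) = \<one>\<^sub>A"
    by (rule A.space.lincomb_cong[of "[\<one>\<^sub>A, xb \<cdot> xc, xb \<cdot> (xb \<cdot> (xc \<cdot> xc))]"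
          "[(1, 0), (inverse q, 1), (inverse q * (inverse q * inverse q), 1), (q * ((- inverse q - inverse q ^ 3) * inverse q), 1), ((inverse q)^2, 2), (inverse q * (inverse q * (inverse q * inverse q)), 2), (q * ((- inverse q - inverse q ^ 3) * (inverse q * inverse q)), 2)]"
          "[(1, 0)]"])
      (simp_all add: assms d_b A_normal A.a_ac All_less_Suc,
        (simp add: field_simps power2_eq_square power3_eq_cube)?)
  show "s \<cdot> d_minus (b_plus q) \<oplus>\<^sub>A (s' \<cdot> d_minus (b_zero q) \<oplus>\<^sub>A s'' \<cdot> d_minus (b_minus q)) = \<zero>\<^sub>A"
    by (rule A.space.lincomb_cong[of "[xc \<cdot> (xc \<cdot> (xa \<cdot> xa))]"
          "[((inverse q)^2, 0), (inverse q * inverse q * (inverse q * inverse q), 0), ((- inverse q - inverse q ^ 3) * inverse q, 0)]"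
          "[]"])
      (simp_all add: assms d_b A_normal A.a_ac,
        (simp add: field_simps power2_eq_square power3_eq_cube)?)
  show "s \<in> Gr 2" "s' \<in> Gr 2" "s'' \<in> Gr 2"
    using word_component[of "[ga, ga]"] word_component[of "[gc, ga]"] word_component[of "[gc, gc]"]
    by (simp_all add: assms word_mult)
qed

text \<open>Here the antipode is applied to the left factors in a^2 -> a^2 \<otimes> a^2 + (q +
  q^-1) ab \<otimes> ca + b^2 \<otimes> c^2, giving d^2, - (q + q^-1) db and q^2 b^2. The vanishing
  sum belongs to b^2, whose counit is 0.\<close>

lemma minus_span:
  defines "s \<equiv> xd \<cdot> xd" and "s' \<equiv> (- (q + inverse q)) \<bullet> (xd \<cdot> xb)"
    and "s'' \<equiv> (q ^ 2) \<bullet> (xb \<cdot> xb)"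
  shows "s \<cdot> d_minus (b_minus q) \<oplus>\<^sub>A (s' \<cdot> d_minus (b_zero q) \<oplus>\<^sub>A s'' \<cdot> d_minus (b_plus q)) = \<one>\<^sub>A"
    "s \<cdot> d_plus (b_minus q) \<oplus>\<^sub>A (s' \<cdot> d_plus (b_zero q) \<oplus>\<^sub>A s'' \<cdot> d_plus (b_plus q)) = \<zero>\<^sub>A"
    "s \<in> Gr (- 2)" "s' \<in> Gr (- 2)" "s'' \<in> Gr (- 2)"
proof -
  show "s \<cdot> d_minus (b_minus q) \<oplus>\<^sub>A (s' \<cdot> d_minus (b_zero q) \<oplus>\<^sub>A s'' \<cdot> d_minus (b_plus q)) = \<one>\<^sub>A"
    by (rule A.space.lincomb_cong[of "[\<one>\<^sub>A, xb \<cdot> xc, xb \<cdot> (xb \<cdot> (xc \<cdot> xc))]"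
          "[(1, 0), (q, 1), (q * (q * q), 1), ((- q - inverse q) * q * q, 1), (q^2, 2), (q * (q * (q * q)), 2), ((- q - inverse q) * q * (q * q), 2)]"
          "[(1, 0)]"])
      (simp_all add: assms d_b A_normal A.a_ac All_less_Suc,
        (simp add: field_simps power2_eq_square power3_eq_cube)?)
  show "s \<cdot> d_plus (b_minus q) \<oplus>\<^sub>A (s' \<cdot> d_plus (b_zero q) \<oplus>\<^sub>A s'' \<cdot> d_plus (b_plus q)) = \<zero>\<^sub>A"
    by (rule A.space.lincomb_cong[of "[xb \<cdot> (xb \<cdot> (xd \<cdot> xd))]"
          "[(q^2, 0), (q * q * (q * q), 0), (q * ((- q - inverse q) * q * q), 0)]"
          "[]"])
      (simp_all add: assms d_b A_normal A.a_ac,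
        (simp add: field_simps power2_eq_square power3_eq_cube)?)
  show "s \<in> Gr (- 2)" "s' \<in> Gr (- 2)" "s'' \<in> Gr (- 2)"
    using word_component[of "[gd, gd]"] word_component[of "[gd, gb]"] word_component[of "[gb, gb]"]
    by (simp_all add: assms word_mult)
qed

lemma J_plus_linear: "linear_map A \<Omega> (\<lambda>x. (x, \<zero>\<^sub>A, \<zero>\<^sub>A))"
  and J_minus_linear: "linear_map A \<Omega> (\<lambda>x. (\<zero>\<^sub>A, x, \<zero>\<^sub>A))"
  by (rule linear_mapI; simp)+

lemma plus_calculus: "line_calculus q (- 2) (\<lambda>x. (x, \<zero>\<^sub>A, \<zero>\<^sub>A)) fst d_plus"
proof (unfold_locales, goal_cases)
  \<comment> \<open>Goal 10 is \<open>E_span\<close>; unifying its equation with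
    \<open>plus_span(1)\<close> determines all six witnesses.\<close>
  case 10
  show ?case
    by (intro exI conjI, rule_tac[3] plus_span(1)) (use plus_span(3-5) in simp_all)
qed (simp_all add: J_plus_linear fst_linear d_plus_linear d_components_mult d_plus_component[simplified] d_plus_gen
    del: id_apply)

lemma minus_calculus: "line_calculus q 2 (\<lambda>x. (\<zero>\<^sub>A, x, \<zero>\<^sub>A)) (\<lambda>w. fst (snd w)) d_minus"
proof (unfold_locales, goal_cases)
  case 10
  show ?case
    by (intro exI conjI, rule_tac[3] minus_span(1)) (use minus_span(3-5) in simp_all)
qed (simp_all add: J_minus_linear fst_snd_linear d_minus_linear d_components_mult d_minus_component d_minus_gen
    del: id_apply)

lemma forms10_eq: "S2_forms10 q = \<Omega>\<lparr>carrier := (\<lambda>x. (x, \<zero>\<^sub>A, \<zero>\<^sub>A)) ` Gr (- 2)\<rparr>"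
  and forms01_eq: "S2_forms01 q = \<Omega>\<lparr>carrier := (\<lambda>x. (\<zero>\<^sub>A, x, \<zero>\<^sub>A)) ` Gr 2\<rparr>"
  by (simp_all add: S2_forms10_def S2_forms01_def Setcompr_eq_image)

lemma del_eq: "del q = (\<lambda>f. (d_plus f, \<zero>\<^sub>A, \<zero>\<^sub>A))"
  and delbar_eq: "delbar q = (\<lambda>f. (\<zero>\<^sub>A, d_minus f, \<zero>\<^sub>A))"
  by (simp_all add: fun_eq_iff del_def delbar_def split: prod.split)

lemma ext_d_sphere: "f \<in> Gr 0 \<Longrightarrow> d f = (d_plus f, d_minus f, \<zero>\<^sub>A)"
  by (simp add: prod_eq_iff d_zero_component)

lemma lact_d_sphere:
  assumes "m \<in> carrier A" "f \<in> Gr 0"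
  shows "m \<rightharpoonup> d f = (m \<cdot> d_plus f, m \<cdot> d_minus f, \<zero>\<^sub>A)"
  by (subst ext_d_sphere[OF assms(2)]) (use assms in simp)

section \<open>The direct sum decomposition\<close>

lemma carrier_S2_forms:
  "carrier (S2_forms q) = carrier (S2_forms01 q) <+>\<^bsub>\<Omega>\<^esub> carrier (S2_forms10 q)"
proof -
  let ?S = "{m \<rightharpoonup> d n | m n. m \<in> carrier B \<and> n \<in> carrier B}"
  \<comment> \<open>The sum of the two lines in explicit form, which makes closure under the
    operations immediate.\<close>
  let ?M = "{(x, y, \<zero>\<^sub>A) | x y. x \<in> Gr (- 2) \<and> y \<in> Gr 2}"
  have S: "?S \<subseteq> carrier \<Omega>"
    by (auto simp del: forms_simps intro!: lact_ops(1) ext_d_closed component_closed)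
  note span = Om.cspan_subspace[OF S]
  have M: "?M = carrier (S2_forms01 q) <+>\<^bsub>\<Omega>\<^esub> carrier (S2_forms10 q)"
    by (force simp: set_add_def' S2_forms10_def S2_forms01_def component_closed)
  have "submodule ?M complex_ring \<Omega>"
    by (rule Om.subspaceI) (auto simp: component_closed)
  moreover have "?S \<subseteq> ?M"
  proof
    fix w assume "w \<in> ?S"
    then obtain m f where w: "w = m \<rightharpoonup> d f" and m: "m \<in> Gr 0" and f: "f \<in> Gr 0" by auto
    have "m \<cdot> d_plus f \<in> Gr (- 2)" "m \<cdot> d_minus f \<in> Gr 2"
      using component_mult[OF m d_plus_component[OF f]] component_mult[OF m d_minus_component[OF f]]
      by simp_all
    then show "w \<in> ?M"
      unfolding w lact_d_sphere[OF component_closed[OF m] f] by blast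
  qed
  ultimately have "cspan \<Omega> ?S \<subseteq> ?M"
    by (rule Om.cspan_least)
  moreover have "(x, y, \<zero>\<^sub>A) \<in> cspan \<Omega> ?S" if x: "x \<in> Gr (- 2)" and y: "y \<in> Gr 2" for x y
  proof -
    \<comment> \<open>A sum of forms (u s_i) d t_i has its e^+ and e^- slots governed by the same
      s_i and t_i. Since one slot becomes u and the other 0, each line is reached separately,
      although d itself mixes them.\<close>
    have comb: "(u \<cdot> (s1 \<cdot> d_plus t1 \<oplus>\<^sub>A (s2 \<cdot> d_plus t2 \<oplus>\<^sub>A s3 \<cdot> d_plus t3)),
        u \<cdot> (s1 \<cdot> d_minus t1 \<oplus>\<^sub>A (s2 \<cdot> d_minus t2 \<oplus>\<^sub>A s3 \<cdot> d_minus t3)), \<zero>\<^sub>A)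
        \<in> cspan \<Omega> ?S" (is "?w \<in> _")
      if u: "u \<in> Gr m" and s: "s1 \<in> Gr k" "s2 \<in> Gr k" "s3 \<in> Gr k"
        and t: "t1 \<in> Gr 0" "t2 \<in> Gr 0" "t3 \<in> Gr 0" and mk: "m + k = 0" for u s1 s2 s3 t1 t2 t3 m k
    proof -
      have us: "u \<cdot> s1 \<in> Gr 0" "u \<cdot> s2 \<in> Gr 0" "u \<cdot> s3 \<in> Gr 0"
        using component_mult[OF u s(1)] component_mult[OF u s(2)] component_mult[OF u s(3)] mk by simp_all
      note c = u[THEN component_closed] s[THEN component_closed] t[THEN component_closed]
        linear_mapD(1)[OF d_plus_linear] linear_mapD(1)[OF d_minus_linear]
      have "?w = (u \<cdot> s1) \<rightharpoonup> d t1 \<oplus>\<^bsub>\<Omega>\<^esub> ((u \<cdot> s2) \<rightharpoonup> d t2 \<oplus>\<^bsub>\<Omega>\<^esub> (u \<cdot> s3) \<rightharpoonup> d t3)"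
        by (simp add: lact_d_sphere t c A.r_distr A.m_assoc)
      moreover have mem: "m \<rightharpoonup> d f \<in> cspan \<Omega> ?S" if "m \<in> Gr 0" "f \<in> Gr 0" for m f
        by (rule Om.cspan_incl, rule CollectI, intro exI conjI, rule refl) (simp_all add: that)
      ultimately show ?thesis
        using Om.subspaceD(3)[OF span mem[OF us(1) t(1)]
            Om.subspaceD(3)[OF span mem[OF us(2) t(2)] mem[OF us(3) t(3)]]] by simp
    qed
    have "(x, \<zero>\<^sub>A, \<zero>\<^sub>A) \<in> cspan \<Omega> ?S"
      using comb[OF x plus_span(3-5) b_components(3,2,1)] component_closed[OF x]
      unfolding plus_span(1,2) by simp
    moreover have "(\<zero>\<^sub>A, y, \<zero>\<^sub>A) \<in> cspan \<Omega> ?S"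
      using comb[OF y minus_span(3-5) b_components(1,2,3)] component_closed[OF y]
      unfolding minus_span(1,2) by simp
    ultimately have "(x, \<zero>\<^sub>A, \<zero>\<^sub>A) \<oplus>\<^bsub>\<Omega>\<^esub> (\<zero>\<^sub>A, y, \<zero>\<^sub>A) \<in> cspan \<Omega> ?S"
      by (rule Om.subspaceD(3)[OF span])
    then show ?thesis using x y component_closed by simp
  qed
  ultimately have "cspan \<Omega> ?S = ?M" by blast
  then show ?thesis using M by (simp add: S2_forms_def)
qed

lemma forms_disjoint: "carrier (S2_forms01 q) \<inter> carrier (S2_forms10 q) = {\<zero>\<^bsub>\<Omega>\<^esub>}"
  by (auto simp: S2_forms10_def S2_forms01_def)

lemma twist_sphere: "f \<in> Gr 0 \<Longrightarrow> twist k f = f"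
  by (simp add: twist_component component_closed)

lemma decomposition:
  assumes f: "f \<in> Gr 0"
  shows "d f = del q f \<oplus>\<^bsub>\<Omega>\<^esub> delbar q f"
proof -
  have "del q f \<oplus>\<^bsub>\<Omega>\<^esub> delbar q f = (d_plus f, d_minus f, \<zero>\<^sub>A)"
    using linear_mapD(1)[OF d_plus_linear component_closed[OF f]]
      linear_mapD(1)[OF d_minus_linear component_closed[OF f]]
    by (simp add: del_eq delbar_eq)
  then show ?thesis using ext_d_sphere[OF f] by (rule trans[OF _ sym, rotated])
qed

lemma calculi:
  "first_order_calculus B (S2_forms10 q) (del q)"
  "left_covariant A \<Delta> \<epsilon> B (coaction_S2 q) (S2_forms10 q) (del q)"
  "first_order_calculus B (S2_forms01 q) (delbar q)"
  "left_covariant A \<Delta> \<epsilon> B (coaction_S2 q) (S2_forms01 q) (delbar q)"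
  unfolding forms10_eq forms01_eq del_eq delbar_eq
  by (rule line_calculus.calculus[OF plus_calculus] line_calculus.covariant[OF plus_calculus]
      line_calculus.calculus[OF minus_calculus] line_calculus.covariant[OF minus_calculus])+

lemma del_b:
  "del q (b_minus q) = (xb \<cdot> xb, \<zero>\<^sub>A, \<zero>\<^sub>A)"
  "del q (b_zero q) = (xd \<cdot> xb, \<zero>\<^sub>A, \<zero>\<^sub>A)"
  "del q (b_plus q) = (xd \<cdot> xd, \<zero>\<^sub>A, \<zero>\<^sub>A)"
  and delbar_b:
  "delbar q (b_minus q) = (\<zero>\<^sub>A, xa \<cdot> xa, \<zero>\<^sub>A)"
  "delbar q (b_zero q) = (\<zero>\<^sub>A, xc \<cdot> xa, \<zero>\<^sub>A)"
  "delbar q (b_plus q) = (\<zero>\<^sub>A, xc \<cdot> xc, \<zero>\<^sub>A)"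
  by (simp_all add: del_eq delbar_eq d_b)

lemmas b_closed [simp] = b_components[THEN component_closed]
lemmas b_twist = b_components[THEN twist_sphere]
lemmas forms_b = del_b delbar_b b_twist Om.minus_eq_smult

text \<open>In normal order the terms b d match with the factor q^2. The defect (q^4 - 1) b b c d is
  q^2 - q^-2 times the coefficient q^2 b b c d of \<open>b_plus q\<close> acting on
  \<open>del q (b_minus q)\<close>.\<close>

lemma del_plus_minus:
  "del q (b_plus q) \<leftharpoonup> (b_minus q) = (q powi 2) \<odot>\<^bsub>\<Omega>\<^esub> (b_minus q \<rightharpoonup> del q (b_plus q)) \<oplus>\<^bsub>\<Omega>\<^esub> (q powi 2 - q powi (-2)) \<odot>\<^bsub>\<Omega>\<^esub> (b_plus q \<rightharpoonup> del q (b_minus q))"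
  by (simp add: forms_b, simp add: b_products A_normal power_int_eqs A.a_ac,
      rule A.space.lincomb_cong[of "[xb \<cdot> xd, xb \<cdot> (xb \<cdot> (xc \<cdot> xd))]"
        "[(inverse q * (q * q), 0), (inverse q * (q * q * (q * (q * q))), 1)]"
        "[(q\<^sup>2 * inverse q, 0), (q\<^sup>2 * (inverse q * inverse q), 1), ((q\<^sup>2 - inverse q * inverse q) * (q * q), 1)]"])
    (simp_all add: All_less_Suc, (simp add: field_simps power2_eq_square)?)

text \<open>The terms c a match with the factor q^-2. The defect (q^-5 - q^-1) b c c a is q^-2 - q^2
  times q^-3 b c c a, which comes from \<open>b_minus q\<close> acting on
  \<open>delbar q (b_plus q)\<close>.\<close>

lemma delbar_minus_plus:
  "delbar q (b_minus q) \<leftharpoonup> (b_plus q) = (q powi (-2)) \<odot>\<^bsub>\<Omega>\<^esub> (b_plus q \<rightharpoonup> delbar q (b_minus q)) \<oplus>\<^bsub>\<Omega>\<^esub> (q powi (-2) - q powi 2) \<odot>\<^bsub>\<Omega>\<^esub> (b_minus q \<rightharpoonup> delbar q (b_plus q))"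
  by (simp add: forms_b, simp add: b_products A_normal power_int_eqs A.a_ac,
      rule A.space.lincomb_cong[of "[xb \<cdot> (xc \<cdot> (xc \<cdot> xa))]"
        "[(inverse q * inverse q * (inverse q * (inverse q * inverse q)), 0)]"
        "[(inverse q * inverse q * q, 0), ((inverse q * inverse q - q\<^sup>2) * (inverse q * (inverse q * inverse q)), 0)]"])
    (simp_all add: All_less_Suc, (simp add: field_simps power2_eq_square)?)

end

theorem corollary3p3:
  fixes q :: complex
  assumes "q \<noteq> 0"
  shows
    "let A = SL2 q; B = S2 q; \<Omega> = SL2_forms q; \<Omega>10 = S2_forms10 q; \<Omega>01 = S2_forms01 q;
         D = SL2_coproduct q; \<epsilon> = SL2_counit q; DL = coaction_S2 q;
         d = ext_d q; del = del q; dbar = delbar q;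
         b0 = b_zero q; bp = b_plus q; bm = b_minus q
     in
       carrier (S2_forms q) = carrier \<Omega>01 <+>\<^bsub>\<Omega>\<^esub> carrier \<Omega>10 \<and>
       carrier \<Omega>01 \<inter> carrier \<Omega>10 = {\<zero>\<^bsub>\<Omega>\<^esub>} \<and>
       first_order_calculus B \<Omega>10 del \<and> left_covariant A D \<epsilon> B DL \<Omega>10 del \<and>
       first_order_calculus B \<Omega>01 dbar \<and> left_covariant A D \<epsilon> B DL \<Omega>01 dbar \<and>
       (\<forall>f\<in>carrier B. d f = del f \<oplus>\<^bsub>\<Omega>\<^esub> dbar f) \<and>

       del bm \<triangleleft>\<^bsub>\<Omega>\<^esub> bp = (q powi (-2)) \<odot>\<^bsub>\<Omega>\<^esub> (bp \<triangleright>\<^bsub>\<Omega>\<^esub> del bm) \<and>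
       del bm \<triangleleft>\<^bsub>\<Omega>\<^esub> bm = (q powi 2) \<odot>\<^bsub>\<Omega>\<^esub> (bm \<triangleright>\<^bsub>\<Omega>\<^esub> del bm) \<and>
       del bm \<triangleleft>\<^bsub>\<Omega>\<^esub> b0 = b0 \<triangleright>\<^bsub>\<Omega>\<^esub> del bm \<and>
       del bp \<triangleleft>\<^bsub>\<Omega>\<^esub> bp = (q powi 2) \<odot>\<^bsub>\<Omega>\<^esub> (bp \<triangleright>\<^bsub>\<Omega>\<^esub> del bp) \<and>
       del bp \<triangleleft>\<^bsub>\<Omega>\<^esub> bm = (q powi 2) \<odot>\<^bsub>\<Omega>\<^esub> (bm \<triangleright>\<^bsub>\<Omega>\<^esub> del bp)
         \<oplus>\<^bsub>\<Omega>\<^esub> (q powi 2 - q powi (-2)) \<odot>\<^bsub>\<Omega>\<^esub> (bp \<triangleright>\<^bsub>\<Omega>\<^esub> del bm) \<and>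
       del bp \<triangleleft>\<^bsub>\<Omega>\<^esub> b0 = (q powi 4) \<odot>\<^bsub>\<Omega>\<^esub> (b0 \<triangleright>\<^bsub>\<Omega>\<^esub> del bp) \<and>

       dbar bm \<triangleleft>\<^bsub>\<Omega>\<^esub> bp = (q powi (-2)) \<odot>\<^bsub>\<Omega>\<^esub> (bp \<triangleright>\<^bsub>\<Omega>\<^esub> dbar bm)
         \<oplus>\<^bsub>\<Omega>\<^esub> (q powi (-2) - q powi 2) \<odot>\<^bsub>\<Omega>\<^esub> (bm \<triangleright>\<^bsub>\<Omega>\<^esub> dbar bp) \<and>
       dbar bm \<triangleleft>\<^bsub>\<Omega>\<^esub> bm = (q powi (-2)) \<odot>\<^bsub>\<Omega>\<^esub> (bm \<triangleright>\<^bsub>\<Omega>\<^esub> dbar bm) \<and>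
       dbar bm \<triangleleft>\<^bsub>\<Omega>\<^esub> b0 = (q powi (-4)) \<odot>\<^bsub>\<Omega>\<^esub> (b0 \<triangleright>\<^bsub>\<Omega>\<^esub> dbar bm) \<and>
       dbar bp \<triangleleft>\<^bsub>\<Omega>\<^esub> bp = (q powi (-2)) \<odot>\<^bsub>\<Omega>\<^esub> (bp \<triangleright>\<^bsub>\<Omega>\<^esub> dbar bp) \<and>
       dbar bp \<triangleleft>\<^bsub>\<Omega>\<^esub> bm = (q powi 2) \<odot>\<^bsub>\<Omega>\<^esub> (bm \<triangleright>\<^bsub>\<Omega>\<^esub> dbar bp) \<and>
       dbar bp \<triangleleft>\<^bsub>\<Omega>\<^esub> b0 = b0 \<triangleright>\<^bsub>\<Omega>\<^esub> dbar bp \<and>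

       del b0 = (q powi 2) \<odot>\<^bsub>\<Omega>\<^esub> (bm \<triangleright>\<^bsub>\<Omega>\<^esub> del bp)
         \<ominus>\<^bsub>\<Omega>\<^esub> (q powi (-2)) \<odot>\<^bsub>\<Omega>\<^esub> (bp \<triangleright>\<^bsub>\<Omega>\<^esub> del bm) \<and>
       dbar b0 = (bp \<triangleright>\<^bsub>\<Omega>\<^esub> dbar bm)
         \<ominus>\<^bsub>\<Omega>\<^esub> (q powi 4) \<odot>\<^bsub>\<Omega>\<^esub> (bm \<triangleright>\<^bsub>\<Omega>\<^esub> dbar bp) \<and>
       (b0 \<otimes>\<^bsub>A\<^esub> bm) \<triangleright>\<^bsub>\<Omega>\<^esub> del bp
         = (q powi (-3)) \<odot>\<^bsub>\<Omega>\<^esub>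
             (((\<one>\<^bsub>A\<^esub> \<oplus>\<^bsub>A\<^esub> inverse q \<odot>\<^bsub>A\<^esub> b0) \<otimes>\<^bsub>A\<^esub> bp) \<triangleright>\<^bsub>\<Omega>\<^esub> del bm) \<and>
       (b0 \<otimes>\<^bsub>A\<^esub> bp) \<triangleright>\<^bsub>\<Omega>\<^esub> dbar bm
         = (q powi 3) \<odot>\<^bsub>\<Omega>\<^esub>
             (((\<one>\<^bsub>A\<^esub> \<oplus>\<^bsub>A\<^esub> q \<odot>\<^bsub>A\<^esub> b0) \<otimes>\<^bsub>A\<^esub> bm) \<triangleright>\<^bsub>\<Omega>\<^esub> dbar bp)"
proof -
  interpret quantum_SL2 q by unfold_locales (rule assms)
  have "\<forall>f\<in>carrier (S2 q). ext_d q f = del q f \<oplus>\<^bsub>\<Omega>\<^esub> delbar q f"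
    using decomposition by simp
  then show ?thesis
    \<comment> \<open>The remaining conjuncts are equations of triples: the rounds of simplification
      pass to slots, order the words, and compare the scalars as rational expressions in q.\<close>
    by (simp only: Let_def)
      (intro conjI carrier_S2_forms forms_disjoint calculi del_plus_minus delbar_minus_plus,
        assumption, simp_all add: forms_b, simp_all add: b_products A_normal power_int_eqs A.a_ac,
        simp_all add: field_simps power2_eq_square power3_eq_cube power4_eq_xxxx A.space.smult_cancel)
qed

end
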